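(* Let $(\pi,\mathcal{H})$ be a representation of an almost unimodular group $G$. The following are equivalent: (i) $(\pi,\mathcal{H})\cong\operatorname{Ind}_{\ker\Delta_G}^G(\pi_1,\mathcal{H}_1)$ for some representation $(\pi_1,\mathcal{H}_1)$ of $\ker\Delta_G$. (ii) There exists a representation $U\colon\Delta_G(G)\hat{\ }\to U(\mathcal{H})$ satisfying $U_\gamma\pi(s)U_\gamma^*=(\gamma\mid\Delta_G(s))\pi(s)$ for all $\gamma\in\Delta_G(G)\hat{\ }$ and $s\in G$, where $(\cdot\mid\cdot)\colon\Delta_G(G)\hat{\ }\times\Delta_G(G)\to\mathbb{T}$ is the dual pairing.
   Context: Locally compact groups are Hausdorff; representations are strongly continuous and unitary, and $\cong$ is unitary equivalence. $\Delta_G\colon G\to\mathbb{R}_+=(0,\infty)$ is the modular function, $\mu_G(E\cdot s)=\Delta_G(s)\mu_G(E)$ for a left Haar measure $\mu_G$. $G$ is almost unimodular if $\ker\Delta_G$ is open in $G$. In this case $\Delta_G(G)\cong G/\ker\Delta_G$ is given the discrete topology and $\Delta_G(G)\hat{\ }$ denotes its compact Pontryagin dual group. $U(\mathcal{H})$ is the unitary group of $\mathcal{H}$. Induced representation: fix a normalized section $\sigma\colon\Delta_G(G)\to G$ for $\Delta_G$ ($\sigma(1)=e$, $\Delta_G\circ\sigma=\mathrm{id}$). Then $\operatorname{Ind}_{\ker\Delta_G}^G(\pi_1,\mathcal{H}_1)$ acts on $\ell^2(\Delta_G(G))\otimes\mathcal{H}_1$ by $[(\operatorname{Ind}\pi_1)(s)f](\delta)=\pi_1(\sigma(\delta)^{-1}s\,\sigma(\Delta_G(s)^{-1}\delta))f(\Delta_G(s)^{-1}\delta)$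 for $s\in G$, $\delta\in\Delta_G(G)$; up to unitary equivalence it is independent of $\sigma$. *)

theory Defs
  imports "HOL-Analysis.Analysis" "HOL-Algebra.Coset" "HOL-Algebra.Bij" "HOL-Algebra.Module"
begin

section \<open>Complex Hilbert spaces\<close>

definition complex_ring :: "complex ring" where
  "complex_ring = \<lparr>carrier = UNIV, mult = (*), one = 1, zero = 0, add = (+)\<rparr>"

text \<open>Hilbert spaces are carrier-based, so that one can quantify over them. As for every
  HOL-Algebra module record, the inherited fields \<open>mult\<close> and \<open>one\<close> carry no meaning.\<close>

record 'v hilbert = "(complex, 'v) module" +
  cinner :: "'v \<Rightarrow> 'v \<Rightarrow> complex"

definition hnorm :: "('v, 'm) hilbert_scheme \<Rightarrow> 'v \<Rightarrow> real" where
  "hnorm H x = sqrt (Re (cinner H x x))"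

text \<open>The value off the carrier is fixed because the library locale \<open>Metric_space\<close> requires
  symmetry and nonnegativity on the whole type.\<close>

definition hdist :: "('v, 'm) hilbert_scheme \<Rightarrow> 'v \<Rightarrow> 'v \<Rightarrow> real" where
  "hdist H x y = (if x \<in> carrier H \<and> y \<in> carrier H then hnorm H (x \<ominus>\<^bsub>H\<^esub> y) else 0)"

definition norm_topology :: "('v, 'm) hilbert_scheme \<Rightarrow> 'v topology" where
  "norm_topology H = Metric_space.mtopology (carrier H) (hdist H)"

locale complex_hilbert_space = Module.module complex_ring H for H (structure) +
  assumes cinner_add_left:
      "\<lbrakk>x \<in> carrier H; y \<in> carrier H; z \<in> carrier H\<rbrakk>
        \<Longrightarrow> cinner H (x \<oplus> y) z = cinner H x z + cinner H y z"
    and cinner_smult_left: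
      "\<lbrakk>x \<in> carrier H; y \<in> carrier H\<rbrakk> \<Longrightarrow> cinner H (c \<odot> x) y = c * cinner H x y"
    and cinner_commute:
      "\<lbrakk>x \<in> carrier H; y \<in> carrier H\<rbrakk> \<Longrightarrow> cinner H y x = cnj (cinner H x y)"
    and cinner_self_nonneg: "x \<in> carrier H \<Longrightarrow> 0 \<le> Re (cinner H x x)"
    and cinner_self_eq_0: "\<lbrakk>x \<in> carrier H; cinner H x x = 0\<rbrakk> \<Longrightarrow> x = \<zero>"
    and complete: "Metric_space.mcomplete (carrier H) (hdist H)"

text \<open>Operators are extensional functions, as in \<^const>\<open>BijGroup\<close>.\<close>

definition unitaries :: "('v, 'm) hilbert_scheme \<Rightarrow> ('w, 'n) hilbert_scheme \<Rightarrow> ('v \<Rightarrow> 'w) set" where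
  "unitaries H K = {W \<in> carrier H \<rightarrow>\<^sub>E carrier K. bij_betw W (carrier H) (carrier K) \<and>
     (\<forall>x\<in>carrier H. \<forall>y\<in>carrier H. W (x \<oplus>\<^bsub>H\<^esub> y) = W x \<oplus>\<^bsub>K\<^esub> W y) \<and>
     (\<forall>c. \<forall>x\<in>carrier H. W (c \<odot>\<^bsub>H\<^esub> x) = c \<odot>\<^bsub>K\<^esub> W x) \<and>
     (\<forall>x\<in>carrier H. \<forall>y\<in>carrier H. cinner K (W x) (W y) = cinner H x y)}"

definition unitary_group :: "('v, 'm) hilbert_scheme \<Rightarrow> ('v \<Rightarrow> 'v) monoid" where
  "unitary_group H = (BijGroup (carrier H))\<lparr>carrier := unitaries H H\<rparr>"

definition adjoint_op :: "('v, 'm) hilbert_scheme \<Rightarrow> ('v \<Rightarrow> 'v) \<Rightarrow> 'v \<Rightarrow> 'v" where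
  "adjoint_op H A = (\<lambda>y\<in>carrier H. THE z. z \<in> carrier H \<and>
     (\<forall>x\<in>carrier H. cinner H (A x) y = cinner H x z))"

text \<open>The Hilbert space tensor product of \<open>\<ell>\<^sup>2(I)\<close> and \<open>H\<close>, in its usual realization as the
  space of square-summable functions from \<open>I\<close> to \<open>H\<close>.\<close>

definition l2_space :: "'i set \<Rightarrow> ('v, 'm) hilbert_scheme \<Rightarrow> ('i \<Rightarrow> 'v) hilbert" where
  "l2_space I H =
    \<lparr>carrier = {f \<in> I \<rightarrow>\<^sub>E carrier H. (\<lambda>i. (hnorm H (f i))\<^sup>2) summable_on I},
     mult = undefined, one = undefined,
     zero = (\<lambda>i\<in>I. \<zero>\<^bsub>H\<^esub>),
     add = (\<lambda>f g. \<lambda>i\<in>I. f i \<oplus>\<^bsub>H\<^esub> g i),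
     smult = (\<lambda>c f. \<lambda>i\<in>I. c \<odot>\<^bsub>H\<^esub> f i),
     cinner = (\<lambda>f g. \<Sum>\<^sub>\<infinity>i\<in>I. cinner H (f i) (g i))\<rparr>"


section \<open>Locally compact groups and the modular function\<close>

locale locally_compact_group = group G for G (structure) +
  fixes T :: "'a topology"
  assumes topspace_eq: "topspace T = carrier G"
    and continuous_mult: "continuous_map (prod_topology T T) T (\<lambda>(x, y). x \<otimes> y)"
    and continuous_inv: "continuous_map T T (\<lambda>x. inv x)"
    and Hausdorff: "Hausdorff_space T"
    and locally_compact: "locally_compact_space T"

text \<open>A left Haar measure: a nonzero left-invariant Radon measure on the Borel sets.\<close>

definition left_haar_measure ::
  "('a, 'b) monoid_scheme \<Rightarrow> 'a topology \<Rightarrow> 'a measure \<Rightarrow> bool" where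
  "left_haar_measure G T \<mu> \<longleftrightarrow>
     sets \<mu> = sets (sigma (topspace T) {U. openin T U}) \<and>
     emeasure \<mu> (carrier G) \<noteq> 0 \<and>
     (\<forall>K. compactin T K \<longrightarrow> emeasure \<mu> K < \<infinity>) \<and>
     (\<forall>E\<in>sets \<mu>. emeasure \<mu> E = (INF U\<in>{U. openin T U \<and> E \<subseteq> U}. emeasure \<mu> U)) \<and>
     (\<forall>U. openin T U \<longrightarrow> emeasure \<mu> U = (SUP K\<in>{K. compactin T K \<and> K \<subseteq> U}. emeasure \<mu> K)) \<and>
     (\<forall>s\<in>carrier G. \<forall>E\<in>sets \<mu>. emeasure \<mu> (s <#\<^bsub>G\<^esub> E) = emeasure \<mu> E)"

definition modular_function ::
  "('a, 'b) monoid_scheme \<Rightarrow> 'a measure \<Rightarrow> ('a \<Rightarrow> real) \<Rightarrow> bool" where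
  "modular_function G \<mu> \<Delta> \<longleftrightarrow> (\<forall>s\<in>carrier G. 0 < \<Delta> s \<and>
     (\<forall>E\<in>sets \<mu>. emeasure \<mu> (E #>\<^bsub>G\<^esub> s) = ennreal (\<Delta> s) * emeasure \<mu> E))"

definition pos_real_group :: "real monoid" where
  "pos_real_group = \<lparr>carrier = {0<..}, mult = (*), one = 1\<rparr>"

abbreviation modular_kernel :: "('a, 'b) monoid_scheme \<Rightarrow> ('a \<Rightarrow> real) \<Rightarrow> 'a set" where
  "modular_kernel G \<Delta> \<equiv> kernel G pos_real_group \<Delta>"

abbreviation modular_image :: "('a, 'b) monoid_scheme \<Rightarrow> ('a \<Rightarrow> real) \<Rightarrow> real set" where
  "modular_image G \<Delta> \<equiv> \<Delta> ` carrier G"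

definition almost_unimodular ::
  "('a, 'b) monoid_scheme \<Rightarrow> 'a topology \<Rightarrow> ('a \<Rightarrow> real) \<Rightarrow> bool" where
  "almost_unimodular G T \<Delta> \<longleftrightarrow> openin T (modular_kernel G \<Delta>)"

definition normalized_section ::
  "('a, 'b) monoid_scheme \<Rightarrow> ('a \<Rightarrow> real) \<Rightarrow> (real \<Rightarrow> 'a) \<Rightarrow> bool" where
  "normalized_section G \<Delta> \<sigma> \<longleftrightarrow> \<sigma> \<in> modular_image G \<Delta> \<rightarrow> carrier G \<and>
     \<sigma> 1 = \<one>\<^bsub>G\<^esub> \<and> (\<forall>\<delta>\<in>modular_image G \<Delta>. \<Delta> (\<sigma> \<delta>) = \<delta>)"


section \<open>Pontryagin duals\<close>

definition circle_group :: "complex monoid" where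
  "circle_group = \<lparr>carrier = sphere 0 1, mult = (*), one = 1\<rparr>"

text \<open>The dual pairing of \<open>\<gamma>\<close> with \<open>a\<close> is the value \<open>\<gamma> a\<close>.\<close>

definition pontryagin_dual ::
  "('a, 'b) monoid_scheme \<Rightarrow> 'a topology \<Rightarrow> ('a \<Rightarrow> complex) monoid" where
  "pontryagin_dual A T =
    \<lparr>carrier = {\<gamma> \<in> hom A circle_group \<inter> extensional (carrier A).
       continuous_map T (top_of_set (sphere 0 1)) \<gamma>},
     mult = (\<lambda>\<gamma> \<eta>. \<lambda>a\<in>carrier A. \<gamma> a * \<eta> a),
     one = (\<lambda>a\<in>carrier A. 1)\<rparr>"

text \<open>The compact-open topology.\<close>

definition dual_topology ::
  "('a, 'b) monoid_scheme \<Rightarrow> 'a topology \<Rightarrow> ('a \<Rightarrow> complex) topology" where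
  "dual_topology A T = topology_generated_by
     {{\<gamma> \<in> carrier (pontryagin_dual A T). \<gamma> ` K \<subseteq> V} | K V. compactin T K \<and> open V}"

abbreviation modular_image_group ::
  "('a, 'b) monoid_scheme \<Rightarrow> ('a \<Rightarrow> real) \<Rightarrow> real monoid" where
  "modular_image_group G \<Delta> \<equiv> pos_real_group\<lparr>carrier := modular_image G \<Delta>\<rparr>"

abbreviation modular_dual ::
  "('a, 'b) monoid_scheme \<Rightarrow> ('a \<Rightarrow> real) \<Rightarrow> (real \<Rightarrow> complex) monoid" where
  "modular_dual G \<Delta> \<equiv>
     pontryagin_dual (modular_image_group G \<Delta>) (discrete_topology (modular_image G \<Delta>))"

abbreviation modular_dual_topology ::
  "('a, 'b) monoid_scheme \<Rightarrow> ('a \<Rightarrow> real) \<Rightarrow> (real \<Rightarrow> complex) topology" where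
  "modular_dual_topology G \<Delta> \<equiv>
     dual_topology (modular_image_group G \<Delta>) (discrete_topology (modular_image G \<Delta>))"


section \<open>Unitary representations\<close>

definition unitary_representation ::
  "('a, 'b) monoid_scheme \<Rightarrow> 'a topology \<Rightarrow> ('v, 'm) hilbert_scheme \<Rightarrow> ('a \<Rightarrow> 'v \<Rightarrow> 'v) \<Rightarrow> bool"
where
  "unitary_representation G T H \<pi> \<longleftrightarrow> complex_hilbert_space H \<and> \<pi> \<in> hom G (unitary_group H) \<and>
     (\<forall>x\<in>carrier H. continuous_map T (norm_topology H) (\<lambda>s. \<pi> s x))"

definition unitarily_equivalent ::
  "('a, 'b) monoid_scheme \<Rightarrow> ('v, 'm) hilbert_scheme \<Rightarrow> ('a \<Rightarrow> 'v \<Rightarrow> 'v) \<Rightarrow>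
     ('w, 'n) hilbert_scheme \<Rightarrow> ('a \<Rightarrow> 'w \<Rightarrow> 'w) \<Rightarrow> bool" where
  "unitarily_equivalent G H \<pi> K \<rho> \<longleftrightarrow>
     (\<exists>W\<in>unitaries H K. \<forall>s\<in>carrier G. \<forall>x\<in>carrier H. W (\<pi> s x) = \<rho> s (W x))"

text \<open>The representation of \<open>G\<close> on \<^term>\<open>l2_space (modular_image G \<Delta>) H\<^sub>1\<close> induced from a
  representation \<open>\<pi>\<^sub>1\<close> of the modular kernel on \<open>H\<^sub>1\<close>, with respect to the section \<open>\<sigma>\<close>.\<close>

definition induced_rep ::
  "('a, 'b) monoid_scheme \<Rightarrow> ('a \<Rightarrow> real) \<Rightarrow> (real \<Rightarrow> 'a) \<Rightarrow> ('v, 'm) hilbert_scheme \<Rightarrow>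
     ('a \<Rightarrow> 'v \<Rightarrow> 'v) \<Rightarrow> 'a \<Rightarrow> (real \<Rightarrow> 'v) \<Rightarrow> (real \<Rightarrow> 'v)" where
  "induced_rep G \<Delta> \<sigma> H\<^sub>1 \<pi>\<^sub>1 s =
     (\<lambda>f\<in>carrier (l2_space (modular_image G \<Delta>) H\<^sub>1). \<lambda>\<delta>\<in>modular_image G \<Delta>.
        \<pi>\<^sub>1 (inv\<^bsub>G\<^esub> (\<sigma> \<delta>) \<otimes>\<^bsub>G\<^esub> s \<otimes>\<^bsub>G\<^esub> \<sigma> (inverse (\<Delta> s) * \<delta>)) (f (inverse (\<Delta> s) * \<delta>)))"

definition induced_from_modular_kernel ::
  "('a, 'b) monoid_scheme \<Rightarrow> 'a topology \<Rightarrow> ('a \<Rightarrow> real) \<Rightarrow> (real \<Rightarrow> 'a) \<Rightarrow>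
     ('v, 'm) hilbert_scheme \<Rightarrow> ('a \<Rightarrow> 'v \<Rightarrow> 'v) \<Rightarrow>
     ('w, 'n) hilbert_scheme \<Rightarrow> ('a \<Rightarrow> 'w \<Rightarrow> 'w) \<Rightarrow> bool" where
  "induced_from_modular_kernel G T \<Delta> \<sigma> H \<pi> H\<^sub>1 \<pi>\<^sub>1 \<longleftrightarrow>
     unitary_representation (G\<lparr>carrier := modular_kernel G \<Delta>\<rparr>)
       (subtopology T (modular_kernel G \<Delta>)) H\<^sub>1 \<pi>\<^sub>1 \<and>
     unitarily_equivalent G H \<pi>
       (l2_space (modular_image G \<Delta>) H\<^sub>1) (induced_rep G \<Delta> \<sigma> H\<^sub>1 \<pi>\<^sub>1)"

text \<open>The relation \<open>U\<^sub>\<gamma> \<pi>(s) U\<^sub>\<gamma>\<^sup>* = (\<gamma> | \<Delta>(s)) \<pi>(s)\<close>.\<close>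

definition implements_dual_action ::
  "('a, 'b) monoid_scheme \<Rightarrow> ('a \<Rightarrow> real) \<Rightarrow> ('v, 'm) hilbert_scheme \<Rightarrow> ('a \<Rightarrow> 'v \<Rightarrow> 'v) \<Rightarrow>
     ((real \<Rightarrow> complex) \<Rightarrow> 'v \<Rightarrow> 'v) \<Rightarrow> bool" where
  "implements_dual_action G \<Delta> H \<pi> U \<longleftrightarrow>
     (\<forall>\<gamma>\<in>carrier (modular_dual G \<Delta>). \<forall>s\<in>carrier G. \<forall>x\<in>carrier H.
        U \<gamma> (\<pi> s (adjoint_op H (U \<gamma>) x)) = \<gamma> (\<Delta> s) \<odot>\<^bsub>H\<^esub> \<pi> s x)"

end

theory Submission
  imports Defs
begin

text \<open>
  Let \<open>D = \<Delta>(G)\<close> and let \<open>N\<close> be the kernel of \<open>\<Delta>\<close>.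

  An induced representation moves the value of \<open>f \<in> \<ell>\<^sup>2(D) \<otimes> H\<^sub>1\<close> at \<open>\<delta>\<close> to \<open>\<Delta>(s) \<delta>\<close>. Hence
  the multiplication operators \<open>(M\<^sub>\<gamma> f)(\<delta>) = \<gamma>(\<delta>) f(\<delta>)\<close> commute with it up to the factor
  \<open>\<gamma>(\<Delta>(s))\<close>. They form a representation of the dual group, which is strongly continuous because
  \<open>f\<close> is concentrated, up to a small error, on a finite subset of \<open>D\<close>. This is
  \<open>dual_action_if_induced\<close>.

  Conversely, a representation \<open>U\<close> of the dual group of \<open>D\<close> splits \<open>H\<close> into the eigenspaces
  \<open>E\<^sub>\<delta> = {x. U\<^sub>\<gamma> x = \<gamma>(\<delta>) x for all \<gamma>}\<close>, and the relation between \<open>U\<close> and \<open>\<pi>\<close> says that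
  \<open>\<pi>(s)\<close> carries \<open>E\<^sub>\<delta>\<close> to the eigenspace of \<open>\<Delta>(s) \<delta>\<close>. In particular \<open>N\<close> acts on \<open>E\<^sub>1\<close>, and
  \<open>\<pi>(\<sigma>(\<delta>))\<^sup>*\<close> identifies \<open>E\<^sub>\<delta>\<close> with \<open>E\<^sub>1\<close>. Applying it to each component of a vector gives the
  required equivalence of \<open>H\<close> with \<open>\<ell>\<^sup>2(D) \<otimes> E\<^sub>1\<close> (\<open>fibre_map_unitary\<close>,
  \<open>fibre_map_intertwines\<close>).

  What needs analysis is that the eigenspaces span \<open>H\<close> (\<open>eigenspaces_total\<close>). The usual proof
  integrates over the compact dual group. The proof below uses no invariant measure, only finite
  averages of translates. The mean ergodic theorem (\<open>mean_ergodic\<close>), applied to the twisted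
  representations \<open>\<gamma> \<mapsto> \<gamma>(a) U\<^sub>\<gamma>\<close>, yields the projections onto the eigenspaces. It also shows that,
  for \<open>x\<close> orthogonal to all of them, the functions \<open>\<gamma> \<mapsto> \<gamma>(a) \<langle>U\<^sub>\<gamma> x, x\<rangle>\<close> have averages that are
  small uniformly under translation. This property passes to linear combinations, hence to
  \<open>p(\<gamma>) \<langle>U\<^sub>\<gamma> x, x\<rangle>\<close> for every trigonometric polynomial \<open>p\<close>. If \<open>x \<noteq> 0\<close>, choose \<open>p \<ge> 0\<close> concentrated near
  the trivial character, where \<open>\<langle>U\<^sub>\<gamma> x, x\<rangle>\<close> is close to \<open>\<parallel>x\<parallel>\<^sup>2\<close>. Then finitely many translates of this
  function have a sum with real part bounded below by a positive constant, and averages of that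
  sum cannot be small.
\<close>


section \<open>Geometry of inner product spaces\<close>

lemma complex_ring_simps [simp]:
  "carrier complex_ring = UNIV" "mult complex_ring = (*)" "one complex_ring = 1"
  "zero complex_ring = 0" "add complex_ring = (+)"
  by (simp_all add: complex_ring_def)

text \<open>Completeness is left out so that subspaces can be treated as inner product spaces before
  they are known to be complete.\<close>

locale complex_inner_space = Module.module complex_ring H for H (structure) +
  assumes inner_add_left:
      "\<lbrakk>x \<in> carrier H; y \<in> carrier H; z \<in> carrier H\<rbrakk>
        \<Longrightarrow> cinner H (x \<oplus> y) z = cinner H x z + cinner H y z"
    and inner_smult_left:
      "\<lbrakk>x \<in> carrier H; y \<in> carrier H\<rbrakk> \<Longrightarrow> cinner H (c \<odot> x) y = c * cinner H x y"
    and inner_commute: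
      "\<lbrakk>x \<in> carrier H; y \<in> carrier H\<rbrakk> \<Longrightarrow> cinner H y x = cnj (cinner H x y)"
    and inner_self_nonneg: "x \<in> carrier H \<Longrightarrow> 0 \<le> Re (cinner H x x)"
    and inner_self_eq_0: "\<lbrakk>x \<in> carrier H; cinner H x x = 0\<rbrakk> \<Longrightarrow> x = \<zero>"

lemma complex_hilbert_space_iff:
  "complex_hilbert_space H \<longleftrightarrow>
     complex_inner_space H \<and> Metric_space.mcomplete (carrier H) (hdist H)"
  by (auto simp: complex_hilbert_space_def complex_inner_space_def
      complex_hilbert_space_axioms_def complex_inner_space_axioms_def)

context complex_inner_space
begin

lemma scale_closed [simp, intro]: "x \<in> carrier H \<Longrightarrow> c \<odot> x \<in> carrier H"
  by (rule smult_closed) auto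

lemma inner_add_right:
  assumes "x \<in> carrier H" "y \<in> carrier H" "z \<in> carrier H"
  shows "cinner H x (y \<oplus> z) = cinner H x y + cinner H x z"
  using assms inner_add_left[of y z x] inner_commute[of _ x] by simp

lemma inner_smult_right:
  assumes "x \<in> carrier H" "y \<in> carrier H"
  shows "cinner H x (c \<odot> y) = cnj c * cinner H x y"
  using assms inner_smult_left[of y x c] inner_commute[of _ x] by simp

lemma inner_zero_left: "x \<in> carrier H \<Longrightarrow> cinner H \<zero> x = 0"
  using inner_add_left[of \<zero> \<zero> x] by simp

lemma inner_zero_right: "x \<in> carrier H \<Longrightarrow> cinner H x \<zero> = 0"
  using inner_zero_left[of x] inner_commute[of \<zero> x] by simp

lemma inner_minus_left:
  assumes "x \<in> carrier H" "y \<in> carrier H" "z \<in> carrier H"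
  shows "cinner H (x \<ominus> y) z = cinner H x z - cinner H y z"
proof -
  have "cinner H (\<ominus> y \<oplus> y) z = 0"
    using assms by (simp add: M.l_neg inner_zero_left)
  then have "cinner H (\<ominus> y) z = - cinner H y z"
    using assms inner_add_left[of "\<ominus> y" y z] by (simp add: eq_neg_iff_add_eq_0)
  then show ?thesis
    using assms by (simp add: a_minus_def inner_add_left)
qed

lemma inner_minus_right:
  assumes "x \<in> carrier H" "y \<in> carrier H" "z \<in> carrier H"
  shows "cinner H x (y \<ominus> z) = cinner H x y - cinner H x z"
  using assms inner_minus_left[of y z x] inner_commute[of _ x] by simp

lemmas inner_simps = inner_add_left inner_add_right inner_smult_left inner_smult_right
  inner_zero_left inner_zero_right inner_minus_left inner_minus_right

lemma inner_self_real: "x \<in> carrier H \<Longrightarrow> cinner H x x = complex_of_real ((hnorm H x)\<^sup>2)"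
  using inner_commute[of x x] inner_self_nonneg[of x]
  by (simp add: hnorm_def complex_eq_iff)

lemma hnorm_nonneg [simp]: "x \<in> carrier H \<Longrightarrow> 0 \<le> hnorm H x"
  by (simp add: hnorm_def inner_self_nonneg)

lemma hnorm_eq_0_iff: "x \<in> carrier H \<Longrightarrow> hnorm H x = 0 \<longleftrightarrow> x = \<zero>"
  using inner_self_real[of x] inner_self_eq_0[of x] by (auto simp: hnorm_def inner_zero_left)

lemma hnorm_sq: "x \<in> carrier H \<Longrightarrow> (hnorm H x)\<^sup>2 = Re (cinner H x x)"
  by (simp add: inner_self_real)

lemma minus_eq_zero_iff:
  "x \<in> carrier H \<Longrightarrow> y \<in> carrier H \<Longrightarrow> x \<ominus> y = \<zero> \<longleftrightarrow> x = y"
  by (metis M.add.inv_closed M.l_zero M.minus_equality M.minus_minus M.r_neg a_minus_def)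

text \<open>Together with \<open>inner_simps\<close>, this reduces identities between vectors to identities
  between complex numbers.\<close>

lemma vector_eqI:
  assumes "x \<in> carrier H" "y \<in> carrier H"
    and "\<And>z. z \<in> carrier H \<Longrightarrow> cinner H x z = cinner H y z"
  shows "x = y"
proof -
  have "cinner H (x \<ominus> y) (x \<ominus> y) = 0"
    using assms by (simp add: inner_minus_left)
  then show ?thesis
    using assms inner_self_eq_0[of "x \<ominus> y"] by (simp add: minus_eq_zero_iff)
qed

text \<open>The vector \<open>\<parallel>y\<parallel>\<^sup>2 x - \<langle>x, y\<rangle> y\<close> has a nonnegative squared norm, which is
  \<open>\<parallel>y\<parallel>\<^sup>2 (\<parallel>x\<parallel>\<^sup>2 \<parallel>y\<parallel>\<^sup>2 - |\<langle>x, y\<rangle>|\<^sup>2)\<close>.\<close>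

lemma Cauchy_Schwarz:
  assumes x: "x \<in> carrier H" and y: "y \<in> carrier H"
  shows "cmod (cinner H x y) \<le> hnorm H x * hnorm H y"
proof (cases "y = \<zero>")
  case True
  then show ?thesis
    using x by (simp add: inner_zero_right)
next
  case False
  define c where "c = cinner H x y"
  define r where "r = (hnorm H y)\<^sup>2"
  have r: "r > 0"
    using False y hnorm_eq_0_iff[of y] by (simp add: r_def)
  define z where "z = of_real r \<odot> x \<ominus> c \<odot> y"
  have yx: "cinner H y x = cnj c"
    using inner_commute[OF x y] c_def by simp
  have yy: "cinner H y y = of_real r" and xx: "cinner H x x = of_real ((hnorm H x)\<^sup>2)"
    using inner_self_real x y r_def by auto
  have cc: "c * cnj c = of_real ((cmod c)\<^sup>2)"
    by (rule complex_norm_square[symmetric])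
  have "cinner H z z = of_real (r * (r * (hnorm H x)\<^sup>2 - (cmod c)\<^sup>2))"
    unfolding z_def using x y
    by (simp add: inner_simps yx yy xx c_def[symmetric] algebra_simps cc flip: of_real_power)
  moreover have "0 \<le> Re (cinner H z z)"
    unfolding z_def using x y by (intro inner_self_nonneg) auto
  ultimately have "0 \<le> r * (r * (hnorm H x)\<^sup>2 - (cmod c)\<^sup>2)"
    by simp
  then have "(cmod c)\<^sup>2 \<le> (hnorm H x * hnorm H y)\<^sup>2"
    using r by (simp add: zero_le_mult_iff r_def power_mult_distrib mult.commute)
  then show ?thesis
    using x y c_def by (simp add: power2_le_iff_abs_le)
qed

lemma hnorm_sq_add:
  assumes "x \<in> carrier H" "y \<in> carrier H"
  shows "(hnorm H (x \<oplus> y))\<^sup>2 = (hnorm H x)\<^sup>2 + 2 * Re (cinner H x y) + (hnorm H y)\<^sup>2"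
  using assms inner_commute[of x y] by (simp add: hnorm_sq inner_simps)

lemma hnorm_sq_minus:
  assumes "x \<in> carrier H" "y \<in> carrier H"
  shows "(hnorm H (x \<ominus> y))\<^sup>2 = (hnorm H x)\<^sup>2 - 2 * Re (cinner H x y) + (hnorm H y)\<^sup>2"
  using assms inner_commute[of x y] by (simp add: hnorm_sq inner_simps)

lemma hnorm_triangle:
  assumes "x \<in> carrier H" "y \<in> carrier H"
  shows "hnorm H (x \<oplus> y) \<le> hnorm H x + hnorm H y"
proof (rule power2_le_imp_le)
  have "Re (cinner H x y) \<le> hnorm H x * hnorm H y"
    using Cauchy_Schwarz[OF assms] complex_Re_le_cmod order_trans by blast
  then show "(hnorm H (x \<oplus> y))\<^sup>2 \<le> (hnorm H x + hnorm H y)\<^sup>2"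
    using assms by (simp add: hnorm_sq_add power2_sum)
  show "0 \<le> hnorm H x + hnorm H y"
    using assms by simp
qed

lemma hnorm_minus_commute:
  assumes "x \<in> carrier H" "y \<in> carrier H"
  shows "hnorm H (x \<ominus> y) = hnorm H (y \<ominus> x)"
proof -
  have "(hnorm H (x \<ominus> y))\<^sup>2 = (hnorm H (y \<ominus> x))\<^sup>2"
    using assms inner_commute[of x y] by (simp add: hnorm_sq_minus)
  then show ?thesis
    using assms by simp
qed

lemma hnorm_smult: "x \<in> carrier H \<Longrightarrow> hnorm H (c \<odot> x) = cmod c * hnorm H x"
proof -
  assume x: "x \<in> carrier H"
  have "cinner H (c \<odot> x) (c \<odot> x) = of_real ((cmod c * hnorm H x)\<^sup>2)"
    using x by (simp add: inner_simps inner_self_real[of x] power_mult_distrib complex_norm_square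
        del: of_real_power)
  then have "Re (cinner H (c \<odot> x) (c \<odot> x)) = (cmod c * hnorm H x)\<^sup>2"
    by simp
  then show ?thesis
    using x by (simp add: hnorm_def[of H "c \<odot> x"])
qed

lemma Metric_space: "Metric_space (carrier H) (hdist H)"
proof
  fix x y z
  show "0 \<le> hdist H x y" "hdist H x y = hdist H y x"
    by (auto simp: hdist_def intro: hnorm_minus_commute)
  show "hdist H x y = 0 \<longleftrightarrow> x = y" if "x \<in> carrier H" "y \<in> carrier H"
    using that by (simp add: hdist_def hnorm_eq_0_iff minus_eq_zero_iff)
  show "hdist H x z \<le> hdist H x y + hdist H y z"
    if xyz: "x \<in> carrier H" "y \<in> carrier H" "z \<in> carrier H"
  proof -
    have "x \<ominus> z = (x \<ominus> y) \<oplus> (y \<ominus> z)"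
      using xyz by (intro vector_eqI) (auto simp: inner_simps)
    then show ?thesis
      using xyz hnorm_triangle[of "x \<ominus> y" "y \<ominus> z"] by (simp add: hdist_def)
  qed
qed

lemma continuous_map_norm_topology_iff:
  "continuous_map X (norm_topology H) f \<longleftrightarrow> f \<in> topspace X \<rightarrow> carrier H \<and>
    (\<forall>x\<in>topspace X. \<forall>e>0. \<exists>U. openin X U \<and> x \<in> U \<and> (\<forall>y\<in>U. hnorm H (f y \<ominus> f x) < e))"
proof -
  interpret Metric_space "carrier H" "hdist H"
    by (rule Metric_space)
  show ?thesis
  proof
    assume L: "continuous_map X (norm_topology H) f"
    then have f: "f \<in> topspace X \<rightarrow> carrier H"
      using continuous_map_funspace[of X mtopology f] by (simp add: norm_topology_def)
    have "\<exists>U. openin X U \<and> x \<in> U \<and> (\<forall>y\<in>U. hnorm H (f y \<ominus> f x) < e)"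
      if x: "x \<in> topspace X" and e: "e > 0" for x e
    proof -
      obtain U where U: "openin X U" "x \<in> U" "\<forall>y\<in>U. f y \<in> mball (f x) e"
        using L x e unfolding norm_topology_def continuous_map_to_metric by meson
      have "hnorm H (f y \<ominus> f x) < e" if "y \<in> U" for y
      proof -
        have "f x \<in> carrier H" "f y \<in> carrier H"
          using f x openin_subset[OF U(1)] that by auto
        with U(3) that show ?thesis
          by (auto simp: hdist_def hnorm_minus_commute split: if_splits)
      qed
      with U(1,2) show ?thesis
        by (intro exI[of _ U]) simp
    qed
    with f show "f \<in> topspace X \<rightarrow> carrier H \<and> (\<forall>x\<in>topspace X. \<forall>e>0. \<exists>U. openin X U \<and>
        x \<in> U \<and> (\<forall>y\<in>U. hnorm H (f y \<ominus> f x) < e))"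
      by simp
  next
    assume R: "f \<in> topspace X \<rightarrow> carrier H \<and> (\<forall>x\<in>topspace X. \<forall>e>0. \<exists>U. openin X U \<and>
        x \<in> U \<and> (\<forall>y\<in>U. hnorm H (f y \<ominus> f x) < e))"
    have "\<exists>U. openin X U \<and> x \<in> U \<and> (\<forall>y\<in>U. f y \<in> mball (f x) e)"
      if x: "x \<in> topspace X" and e: "e > 0" for x e
    proof -
      obtain U where U: "openin X U" "x \<in> U" "\<forall>y\<in>U. hnorm H (f y \<ominus> f x) < e"
        using conjunct2[OF R] x e by meson
      have "f y \<in> mball (f x) e" if "y \<in> U" for y
      proof -
        have "f x \<in> carrier H" "f y \<in> carrier H"
          using R x openin_subset[OF U(1)] that by auto
        with U(3) that show ?thesis
          by (auto simp: hdist_def hnorm_minus_commute split: if_splits)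
      qed
      with U(1,2) show ?thesis
        by (intro exI[of _ U]) simp
    qed
    then show "continuous_map X (norm_topology H) f"
      unfolding norm_topology_def continuous_map_to_metric by simp
  qed
qed

lemma mcomplete_iff:
  "Metric_space.mcomplete (carrier H) (hdist H) \<longleftrightarrow>
    (\<forall>s. range s \<subseteq> carrier H \<and>
         (\<forall>e>0. \<exists>N. \<forall>m\<ge>N. \<forall>n\<ge>N. hnorm H (s m \<ominus> s n) < e) \<longrightarrow>
         (\<exists>l\<in>carrier H. (\<lambda>n. hnorm H (s n \<ominus> l)) \<longlonglongrightarrow> 0))"
proof -
  interpret Metric_space "carrier H" "hdist H"
    by (rule Metric_space)
  have Cauchy: "MCauchy s \<longleftrightarrow> range s \<subseteq> carrier H \<and>
         (\<forall>e>0. \<exists>N. \<forall>m\<ge>N. \<forall>n\<ge>N. hnorm H (s m \<ominus> s n) < e)" for s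
  proof (cases "range s \<subseteq> carrier H")
    case True
    then have "s n \<in> carrier H" for n
      by auto
    then show ?thesis
      using True unfolding MCauchy_def hdist_def by auto
  qed (simp add: MCauchy_def)
  have lim: "(\<exists>l. limitin mtopology s l sequentially) \<longleftrightarrow>
      (\<exists>l\<in>carrier H. (\<lambda>n. hnorm H (s n \<ominus> l)) \<longlonglongrightarrow> 0)" if "range s \<subseteq> carrier H" for s
  proof -
    have s: "s n \<in> carrier H" for n
      using that by auto
    have "limitin mtopology s l sequentially \<longleftrightarrow>
        l \<in> carrier H \<and> (\<lambda>n. hnorm H (s n \<ominus> l)) \<longlonglongrightarrow> 0" for l
      using s unfolding limit_metric_sequentially
      by (auto simp: LIMSEQ_iff hdist_def)
    then show ?thesis
      by blast
  qed
  show ?thesis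
    unfolding mcomplete_def Cauchy by (intro iff_allI imp_cong refl) (simp add: lim)
qed

lemma inner_tendsto:
  assumes "\<And>n. s n \<in> carrier H" "l \<in> carrier H" "z \<in> carrier H"
    and "(\<lambda>n. hnorm H (s n \<ominus> l)) \<longlonglongrightarrow> 0"
  shows "(\<lambda>n. cinner H (s n) z) \<longlonglongrightarrow> cinner H l z"
proof -
  have lim: "(\<lambda>n. hnorm H (s n \<ominus> l) * hnorm H z) \<longlonglongrightarrow> 0"
    using tendsto_mult_right[OF assms(4)] by simp
  have bound: "cmod (cinner H (s n) z - cinner H l z) \<le> hnorm H (s n \<ominus> l) * hnorm H z" for n
    using Cauchy_Schwarz[of "s n \<ominus> l" z] assms by (simp add: inner_minus_left)
  have "(\<lambda>n. cinner H (s n) z - cinner H l z) \<longlonglongrightarrow> 0"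
    by (rule Lim_null_comparison[OF _ lim]) (simp add: bound)
  then show ?thesis
    by (rule LIM_zero_cancel)
qed

lemma inner_finsum_left:
  assumes "finite F" "f \<in> F \<rightarrow> carrier H" "z \<in> carrier H"
  shows "cinner H (finsum H f F) z = (\<Sum>i\<in>F. cinner H (f i) z)"
  using assms
proof (induction F rule: finite_induct)
  case (insert i F)
  then have "f \<in> F \<rightarrow> carrier H" "f i \<in> carrier H"
    by auto
  with insert show ?case
    by (simp add: inner_add_left)
qed (simp add: inner_zero_left)

lemma scale_scale: "x \<in> carrier H \<Longrightarrow> c \<odot> (d \<odot> x) = (c * d) \<odot> x"
  using smult_assoc1[of c d x] by simp

lemma scale_one: "x \<in> carrier H \<Longrightarrow> 1 \<odot> x = x"
  using smult_one[of x] by simp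

lemma minus_eq_add_scale:
  assumes "x \<in> carrier H" "y \<in> carrier H"
  shows "x \<ominus> y = x \<oplus> (-1) \<odot> y"
  using assms by (intro vector_eqI) (auto simp: inner_simps)

lemma uminus_eq_scale: "x \<in> carrier H \<Longrightarrow> \<ominus> x = (-1) \<odot> x"
proof -
  assume x: "x \<in> carrier H"
  have "(-1) \<odot> x \<oplus> x = \<zero>"
    using x by (intro vector_eqI) (auto simp: inner_simps)
  with x show ?thesis
    by (intro M.minus_equality) auto
qed

lemma complex_inner_subspace:
  assumes "submodule S complex_ring H"
  shows "complex_inner_space (H\<lparr>carrier := S\<rparr>)"
proof -
  have S: "S \<subseteq> carrier H"
    by (rule submoduleE(1)[OF assms])
  have "Module.module complex_ring (H\<lparr>carrier := S\<rparr>)"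
    by (rule submodule.submodule_is_module[OF assms module_axioms])
  moreover have "complex_inner_space_axioms (H\<lparr>carrier := S\<rparr>)"
    using S by unfold_locales
      (auto simp: subset_iff inner_add_left inner_smult_left intro: inner_commute inner_self_nonneg
        inner_self_eq_0)
  ultimately show ?thesis
    by (rule complex_inner_space.intro)
qed

text \<open>Subtraction in the subspace refers to additive inverses taken within the subspace, so the
  two differences are different terms. Their norms agree because both expand into the same inner
  products.\<close>

lemma hnorm_minus_subspace:
  assumes "submodule S complex_ring H" "x \<in> S" "y \<in> S"
  shows "hnorm (H\<lparr>carrier := S\<rparr>) (x \<ominus>\<^bsub>H\<lparr>carrier := S\<rparr>\<^esub> y) = hnorm H (x \<ominus> y)"
proof -
  interpret S: complex_inner_space "H\<lparr>carrier := S\<rparr>"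
    by (rule complex_inner_subspace) fact
  have H: "x \<in> carrier H" "y \<in> carrier H"
    using assms submoduleE(1) by blast+
  have "(hnorm (H\<lparr>carrier := S\<rparr>) (x \<ominus>\<^bsub>H\<lparr>carrier := S\<rparr>\<^esub> y))\<^sup>2 = (hnorm H (x \<ominus> y))\<^sup>2"
    using assms H S.hnorm_sq_minus[of x y] by (simp add: hnorm_sq_minus) (simp add: hnorm_def)
  moreover have "0 \<le> hnorm (H\<lparr>carrier := S\<rparr>) (x \<ominus>\<^bsub>H\<lparr>carrier := S\<rparr>\<^esub> y)"
    using assms by (intro S.hnorm_nonneg S.M.minus_closed) auto
  moreover have "0 \<le> hnorm H (x \<ominus> y)"
    using H by simp
  ultimately show ?thesis
    by (rule power2_eq_imp_eq)
qed

lemma complex_hilbert_subspace: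
  assumes S: "submodule S complex_ring H"
    and complete: "Metric_space.mcomplete (carrier H) (hdist H)"
    and limits: "\<And>s l. \<lbrakk>range s \<subseteq> S; l \<in> carrier H; (\<lambda>n. hnorm H (s n \<ominus> l)) \<longlonglongrightarrow> 0\<rbrakk> \<Longrightarrow> l \<in> S"
  shows "complex_hilbert_space (H\<lparr>carrier := S\<rparr>)"
proof -
  interpret S: complex_inner_space "H\<lparr>carrier := S\<rparr>"
    by (rule complex_inner_subspace) fact
  have "Metric_space.mcomplete (carrier (H\<lparr>carrier := S\<rparr>)) (hdist (H\<lparr>carrier := S\<rparr>))"
    unfolding S.mcomplete_iff
  proof (intro allI impI)
    fix s :: "nat \<Rightarrow> _"
    assume *: "range s \<subseteq> carrier (H\<lparr>carrier := S\<rparr>) \<and> (\<forall>e>0. \<exists>N. \<forall>m\<ge>N. \<forall>n\<ge>N.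
      hnorm (H\<lparr>carrier := S\<rparr>) (s m \<ominus>\<^bsub>H\<lparr>carrier := S\<rparr>\<^esub> s n) < e)"
    then have s: "s n \<in> S" for n
      by auto
    have "\<forall>e>0. \<exists>N. \<forall>m\<ge>N. \<forall>n\<ge>N. hnorm H (s m \<ominus> s n) < e"
      using conjunct2[OF *] by (simp add: hnorm_minus_subspace[OF S s s])
    moreover have "range s \<subseteq> carrier H"
      using s submoduleE(1)[OF S] by blast
    ultimately obtain l where l: "l \<in> carrier H" "(\<lambda>n. hnorm H (s n \<ominus> l)) \<longlonglongrightarrow> 0"
      using complete unfolding mcomplete_iff by meson
    have "l \<in> S"
      by (rule limits[of s]) (use s l in auto)
    with l(2) show "\<exists>l\<in>carrier (H\<lparr>carrier := S\<rparr>).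
        (\<lambda>n. hnorm (H\<lparr>carrier := S\<rparr>) (s n \<ominus>\<^bsub>H\<lparr>carrier := S\<rparr>\<^esub> l)) \<longlonglongrightarrow> 0"
      by (intro bexI[of _ l]) (simp_all add: hnorm_minus_subspace[OF S s])
  qed
  then show ?thesis
    unfolding complex_hilbert_space_iff using S.complex_inner_space_axioms by blast
qed

end


section \<open>Unitary group actions\<close>

lemma unitaries_closed: "W \<in> unitaries H K \<Longrightarrow> x \<in> carrier H \<Longrightarrow> W x \<in> carrier K"
  by (auto simp: unitaries_def PiE_def)

lemma unitaries_add:
  "\<lbrakk>W \<in> unitaries H K; x \<in> carrier H; y \<in> carrier H\<rbrakk> \<Longrightarrow> W (x \<oplus>\<^bsub>H\<^esub> y) = W x \<oplus>\<^bsub>K\<^esub> W y"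
  by (simp add: unitaries_def)

lemma unitaries_smult:
  "\<lbrakk>W \<in> unitaries H K; x \<in> carrier H\<rbrakk> \<Longrightarrow> W (c \<odot>\<^bsub>H\<^esub> x) = c \<odot>\<^bsub>K\<^esub> W x"
  by (simp add: unitaries_def)

lemma unitaries_inner:
  "\<lbrakk>W \<in> unitaries H K; x \<in> carrier H; y \<in> carrier H\<rbrakk> \<Longrightarrow> cinner K (W x) (W y) = cinner H x y"
  by (simp add: unitaries_def)

lemma unitaries_bij: "W \<in> unitaries H K \<Longrightarrow> bij_betw W (carrier H) (carrier K)"
  by (simp add: unitaries_def)

lemma unitary_group_simps:
  "carrier (unitary_group H) = unitaries H H"
  "\<lbrakk>V \<in> unitaries H H; W \<in> unitaries H H\<rbrakk>
    \<Longrightarrow> mult (unitary_group H) V W = compose (carrier H) V W"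
  by (auto simp: unitary_group_def BijGroup_def Bij_def unitaries_def PiE_def)

text \<open>A map that preserves inner products is injective, so only surjectivity has to be checked.\<close>

lemma (in complex_inner_space) unitariesI:
  assumes "W \<in> carrier H \<rightarrow>\<^sub>E carrier K"
    and surj: "\<And>y. y \<in> carrier K \<Longrightarrow> \<exists>x\<in>carrier H. W x = y"
    and "\<And>x y. \<lbrakk>x \<in> carrier H; y \<in> carrier H\<rbrakk> \<Longrightarrow> W (x \<oplus> y) = W x \<oplus>\<^bsub>K\<^esub> W y"
    and "\<And>c x. x \<in> carrier H \<Longrightarrow> W (c \<odot> x) = c \<odot>\<^bsub>K\<^esub> W x"
    and inner: "\<And>x y. \<lbrakk>x \<in> carrier H; y \<in> carrier H\<rbrakk> \<Longrightarrow> cinner K (W x) (W y) = cinner H x y"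
  shows "W \<in> unitaries H K"
proof -
  have "inj_on W (carrier H)"
  proof (rule inj_onI)
    fix x y assume xy: "x \<in> carrier H" "y \<in> carrier H" "W x = W y"
    have "cinner H x z = cinner H y z" if "z \<in> carrier H" for z
      using inner[OF xy(1) that] inner[OF xy(2) that] xy(3) by simp
    with xy show "x = y"
      by (intro vector_eqI)
  qed
  moreover have "W ` carrier H = carrier K"
    using assms(1) surj by (auto simp: image_iff PiE_def)
  ultimately show ?thesis
    using assms by (simp add: unitaries_def bij_betw_def)
qed

lemma cnj_mult_self_if_norm_1: "cmod z = 1 \<Longrightarrow> cnj z * z = 1"
  using complex_norm_square[of z] by (simp add: mult.commute)

lemma (in complex_inner_space) scaled_unitary:
  assumes W: "W \<in> unitaries H H" and c: "cmod c = 1"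
  shows "(\<lambda>x\<in>carrier H. c \<odot> W x) \<in> unitaries H H"
proof (rule unitariesI)
  have cc: "cnj c * c = 1"
    using c by (rule cnj_mult_self_if_norm_1)
  note closed = unitaries_closed[OF W]
  show "(\<lambda>x\<in>carrier H. c \<odot> W x) \<in> carrier H \<rightarrow>\<^sub>E carrier H"
    using closed by auto
  show "\<exists>x\<in>carrier H. (\<lambda>x\<in>carrier H. c \<odot> W x) x = y" if y: "y \<in> carrier H" for y
  proof -
    have "cnj c \<odot> y \<in> W ` carrier H"
      using unitaries_bij[OF W] y by (simp add: bij_betw_def)
    then obtain x where x: "x \<in> carrier H" "W x = cnj c \<odot> y"
      by auto
    have "c \<odot> (cnj c \<odot> y) = y"
      using y cc by (simp add: scale_scale scale_one mult.commute)
    with x show ?thesis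
      by (auto intro!: bexI[of _ x])
  qed
  fix x y assume xy: "x \<in> carrier H" "y \<in> carrier H"
  show "(\<lambda>x\<in>carrier H. c \<odot> W x) (x \<oplus> y)
      = (\<lambda>x\<in>carrier H. c \<odot> W x) x \<oplus> (\<lambda>x\<in>carrier H. c \<odot> W x) y"
    using xy by (simp add: unitaries_add[OF W] closed smult_r_distr)
  show "cinner H ((\<lambda>x\<in>carrier H. c \<odot> W x) x) ((\<lambda>x\<in>carrier H. c \<odot> W x) y) = cinner H x y"
  proof -
    have "cinner H (c \<odot> W x) (c \<odot> W y) = (cnj c * c) * cinner H (W x) (W y)"
      using xy closed by (simp add: inner_simps)
    with xy show ?thesis
      by (simp add: cc unitaries_inner[OF W])
  qed
next
  fix d x assume "x \<in> carrier H"
  then show "(\<lambda>x\<in>carrier H. c \<odot> W x) (d \<odot> x) = d \<odot> (\<lambda>x\<in>carrier H. c \<odot> W x) x"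
    by (simp add: unitaries_smult[OF W] unitaries_closed[OF W] scale_scale mult.commute)
qed

lemma hom_unitary_groupI:
  assumes "\<And>g. g \<in> carrier G \<Longrightarrow> V g \<in> unitaries H H"
    and "\<And>g h x. \<lbrakk>g \<in> carrier G; h \<in> carrier G; x \<in> carrier H\<rbrakk>
           \<Longrightarrow> V (g \<otimes>\<^bsub>G\<^esub> h) x = V g (V h x)"
    and "\<And>g h. \<lbrakk>g \<in> carrier G; h \<in> carrier G\<rbrakk> \<Longrightarrow> g \<otimes>\<^bsub>G\<^esub> h \<in> carrier G"
  shows "V \<in> hom G (unitary_group H)"
proof (rule homI)
  fix g h assume gh: "g \<in> carrier G" "h \<in> carrier G"
  have "V (g \<otimes>\<^bsub>G\<^esub> h) = compose (carrier H) (V g) (V h)"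
  proof (rule extensionalityI)
    show "V (g \<otimes>\<^bsub>G\<^esub> h) \<in> extensional (carrier H)"
      using assms(1)[OF assms(3)[OF gh]] by (simp add: unitaries_def PiE_def)
  qed (use assms(2)[OF gh] in \<open>auto simp: compose_def\<close>)
  then show "V (g \<otimes>\<^bsub>G\<^esub> h) = V g \<otimes>\<^bsub>unitary_group H\<^esub> V h"
    using gh assms(1) by (simp add: unitary_group_simps)
qed (simp add: unitary_group_simps assms(1))

locale unitary_action = complex_inner_space H + G: Group.group G
  for H :: "('v, 'm) hilbert_scheme" (structure) and G :: "('g, 'b) monoid_scheme" +
  fixes V :: "'g \<Rightarrow> 'v \<Rightarrow> 'v"
  assumes hom: "V \<in> hom G (unitary_group H)"
begin

lemma act_unitary: "g \<in> carrier G \<Longrightarrow> V g \<in> unitaries H H"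
  using hom by (auto simp: hom_def unitary_group_simps)

lemma act_closed [simp, intro]: "g \<in> carrier G \<Longrightarrow> x \<in> carrier H \<Longrightarrow> V g x \<in> carrier H"
  by (rule unitaries_closed[OF act_unitary])

lemma act_add:
  "\<lbrakk>g \<in> carrier G; x \<in> carrier H; y \<in> carrier H\<rbrakk> \<Longrightarrow> V g (x \<oplus> y) = V g x \<oplus> V g y"
  by (rule unitaries_add[OF act_unitary])

lemma act_smult: "\<lbrakk>g \<in> carrier G; x \<in> carrier H\<rbrakk> \<Longrightarrow> V g (c \<odot> x) = c \<odot> V g x"
  by (rule unitaries_smult[OF act_unitary])

lemma act_inner:
  "\<lbrakk>g \<in> carrier G; x \<in> carrier H; y \<in> carrier H\<rbrakk> \<Longrightarrow> cinner H (V g x) (V g y) = cinner H x y"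
  by (rule unitaries_inner[OF act_unitary])

lemma act_mult:
  assumes "g \<in> carrier G" "h \<in> carrier G" "x \<in> carrier H"
  shows "V (g \<otimes>\<^bsub>G\<^esub> h) x = V g (V h x)"
  using hom_mult[OF hom assms(1,2)] assms act_unitary
  by (simp add: unitary_group_simps compose_def)

lemma act_one:
  assumes "x \<in> carrier H"
  shows "V \<one>\<^bsub>G\<^esub> x = x"
proof -
  have "V \<one>\<^bsub>G\<^esub> (V \<one>\<^bsub>G\<^esub> x) = V \<one>\<^bsub>G\<^esub> x"
    using act_mult[of "\<one>\<^bsub>G\<^esub>" "\<one>\<^bsub>G\<^esub>" x] assms by simp
  moreover have "inj_on (V \<one>\<^bsub>G\<^esub>) (carrier H)"
    using unitaries_bij[OF act_unitary[OF G.one_closed]] bij_betw_def by blast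
  ultimately show ?thesis
    using assms by (simp add: inj_on_eq_iff)
qed

lemma act_inv_act:
  "\<lbrakk>g \<in> carrier G; x \<in> carrier H\<rbrakk> \<Longrightarrow> V (inv\<^bsub>G\<^esub> g) (V g x) = x"
  using act_mult[of "inv\<^bsub>G\<^esub> g" g x] by (simp add: act_one)

lemma act_act_inv:
  "\<lbrakk>g \<in> carrier G; x \<in> carrier H\<rbrakk> \<Longrightarrow> V g (V (inv\<^bsub>G\<^esub> g) x) = x"
  using act_mult[of g "inv\<^bsub>G\<^esub> g" x] by (simp add: act_one)

lemma act_inner_adjoint:
  assumes "g \<in> carrier G" "x \<in> carrier H" "y \<in> carrier H"
  shows "cinner H (V g x) y = cinner H x (V (inv\<^bsub>G\<^esub> g) y)"
  using act_inner[of g x "V (inv\<^bsub>G\<^esub> g) y"] assms by (simp add: act_act_inv)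

lemma act_hnorm: "\<lbrakk>g \<in> carrier G; x \<in> carrier H\<rbrakk> \<Longrightarrow> hnorm H (V g x) = hnorm H x"
  by (simp add: hnorm_def act_inner)

text \<open>The inverse operator satisfies the description in \<^const>\<open>adjoint_op\<close> because \<open>V g\<close> preserves
  inner products, and \<open>vector_eqI\<close> shows that nothing else does.\<close>

lemma adjoint_act:
  assumes g: "g \<in> carrier G" and x: "x \<in> carrier H"
  shows "adjoint_op H (V g) x = V (inv\<^bsub>G\<^esub> g) x"
proof -
  have "(THE z. z \<in> carrier H \<and> (\<forall>w\<in>carrier H. cinner H (V g w) x = cinner H w z))
      = V (inv\<^bsub>G\<^esub> g) x"
  proof (rule the_equality)
    fix z assume z: "z \<in> carrier H \<and> (\<forall>w\<in>carrier H. cinner H (V g w) x = cinner H w z)"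
    show "z = V (inv\<^bsub>G\<^esub> g) x"
    proof (rule vector_eqI)
      fix w assume w: "w \<in> carrier H"
      then have "cinner H w z = cinner H w (V (inv\<^bsub>G\<^esub> g) x)"
        using z g x by (metis act_inner_adjoint)
      then show "cinner H z w = cinner H (V (inv\<^bsub>G\<^esub> g) x) w"
        using z g x w by (metis G.inv_closed act_closed inner_commute)
    qed (use z g x in auto)
  qed (use g x in \<open>auto simp: act_inner_adjoint\<close>)
  then show ?thesis
    using x by (simp add: adjoint_op_def)
qed

end


section \<open>Finite averages and the mean ergodic theorem\<close>

text \<open>Expectations with respect to finitely supported probability measures with dyadic weights.
  They take the place of integration over the group. Generating them by midpoints makes their
  basic properties immediate inductions, and midpoints of orbit vectors are all that the
  minimal norm argument of the mean ergodic theorem uses.\<close>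

inductive_set averages :: "'c set \<Rightarrow> (('c \<Rightarrow> complex) \<Rightarrow> complex) set" for S where
  point: "g \<in> S \<Longrightarrow> (\<lambda>f. f g) \<in> averages S"
| midpoint: "\<lbrakk>M \<in> averages S; N \<in> averages S\<rbrakk> \<Longrightarrow> (\<lambda>f. (M f + N f) / 2) \<in> averages S"

lemma average_add: "M \<in> averages S \<Longrightarrow> M (\<lambda>g. f g + f' g) = M f + M f'"
  by (induction rule: averages.induct) (auto simp: field_simps)

lemma average_cmult: "M \<in> averages S \<Longrightarrow> M (\<lambda>g. c * f g) = c * M f"
  by (induction rule: averages.induct) (auto simp: field_simps)

lemma average_const: "M \<in> averages S \<Longrightarrow> M (\<lambda>g. c) = c"
  by (induction rule: averages.induct) auto

lemma average_cong:
  "\<lbrakk>M \<in> averages S; \<And>g. g \<in> S \<Longrightarrow> f g = f' g\<rbrakk> \<Longrightarrow> M f = M f'"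
  by (induction rule: averages.induct) auto

lemma average_sum: "M \<in> averages S \<Longrightarrow> M (\<lambda>g. \<Sum>i\<in>I. f i g) = (\<Sum>i\<in>I. M (f i))"
proof (induction I rule: infinite_finite_induct)
  case (insert i I)
  then show ?case
    by (simp add: average_add[OF insert.prems])
qed (simp_all add: average_const)

lemma average_bound:
  "\<lbrakk>M \<in> averages S; \<And>g. g \<in> S \<Longrightarrow> cmod (f g) \<le> B\<rbrakk> \<Longrightarrow> cmod (M f) \<le> B"
proof (induction rule: averages.induct)
  case (midpoint M N)
  then show ?case
    using norm_triangle_ineq[of "M f" "N f"] by (simp add: norm_divide)
qed auto

lemma average_Re_ge:
  "\<lbrakk>M \<in> averages S; \<And>g. g \<in> S \<Longrightarrow> B \<le> Re (f g)\<rbrakk> \<Longrightarrow> B \<le> Re (M f)"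
  by (induction rule: averages.induct) auto

lemma average_Fubini:
  assumes "M \<in> averages S" "N \<in> averages T"
  shows "M (\<lambda>g. N (\<lambda>h. f g h)) = N (\<lambda>h. M (\<lambda>g. f g h))"
  using assms(1)
proof (induction rule: averages.induct)
  case (midpoint M M')
  have "N (\<lambda>h. (M (\<lambda>g. f g h) + M' (\<lambda>g. f g h)) / 2)
      = N (\<lambda>h. (1/2) * (M (\<lambda>g. f g h) + M' (\<lambda>g. f g h)))"
    by simp
  also have "\<dots> = (N (\<lambda>h. M (\<lambda>g. f g h)) + N (\<lambda>h. M' (\<lambda>g. f g h))) / 2"
    by (simp only: average_cmult[OF assms(2)] average_add[OF assms(2)]) simp
  finally show ?case
    using midpoint by simp
qed auto

lemma (in Group.group) average_translate:
  assumes "M \<in> averages (carrier G)" "g \<in> carrier G"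
  shows "(\<lambda>f. M (\<lambda>h. f (g \<otimes> h))) \<in> averages (carrier G)"
  using assms
  by (induction rule: averages.induct) (auto intro: averages.intros)

text \<open>This is the convolution of the two measures.\<close>

lemma (in Group.group) average_convolve:
  assumes "M \<in> averages (carrier G)" "N \<in> averages (carrier G)"
  shows "(\<lambda>f. M (\<lambda>g. N (\<lambda>h. f (g \<otimes> h)))) \<in> averages (carrier G)"
  using assms
  by (induction rule: averages.induct) (auto intro: averages.midpoint average_translate)

text \<open>Functions that are almost convergent to zero, in the sense of Lorentz. One average has to be
  small on all translates at once; this uniformity is what makes sums of such functions
  tractable without an invariant mean.\<close>

definition mean_null :: "('g, 'b) monoid_scheme \<Rightarrow> ('g \<Rightarrow> complex) \<Rightarrow> bool" where
  "mean_null G f \<longleftrightarrow> (\<forall>e>0. \<exists>M\<in>averages (carrier G).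
     \<forall>g\<in>carrier G. cmod (M (\<lambda>h. f (g \<otimes>\<^bsub>G\<^esub> h))) \<le> e)"

lemma mean_nullI:
  assumes "\<And>e. e > 0 \<Longrightarrow> \<exists>M. M \<in> averages (carrier G) \<and>
     (\<forall>g\<in>carrier G. cmod (M (\<lambda>h. f (g \<otimes>\<^bsub>G\<^esub> h))) \<le> e)"
  shows "mean_null G f"
  using assms by (simp add: mean_null_def Bex_def)

lemma mean_nullD:
  assumes "mean_null G f" "e > 0"
  shows "\<exists>M\<in>averages (carrier G). \<forall>g\<in>carrier G. cmod (M (\<lambda>h. f (g \<otimes>\<^bsub>G\<^esub> h))) \<le> e"
  using assms by (simp add: mean_null_def)

lemma (in Group.group) mean_null_cong:
  assumes "mean_null G f" and eq: "\<And>g. g \<in> carrier G \<Longrightarrow> f g = f' g"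
  shows "mean_null G f'"
proof (rule mean_nullI)
  fix e :: real assume e: "e > 0"
  obtain M where M: "M \<in> averages (carrier G)"
    "\<forall>g\<in>carrier G. cmod (M (\<lambda>h. f (g \<otimes> h))) \<le> e"
    using mean_nullD[OF assms(1) e] by (rule bexE)
  have "M (\<lambda>h. f' (g \<otimes> h)) = M (\<lambda>h. f (g \<otimes> h))" if "g \<in> carrier G" for g
    using that by (intro average_cong[OF M(1)]) (simp add: eq)
  with M show "\<exists>M. M \<in> averages (carrier G) \<and>
      (\<forall>g\<in>carrier G. cmod (M (\<lambda>h. f' (g \<otimes> h))) \<le> e)"
    by (intro exI[of _ M]) simp
qed

lemma (in Group.group) mean_null_zero: "mean_null G (\<lambda>g. 0)"
  using averages.point[OF one_closed] by (intro mean_nullI) auto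

lemma (in Group.group) mean_null_cmult:
  assumes "mean_null G f"
  shows "mean_null G (\<lambda>g. c * f g)"
proof (rule mean_nullI)
  fix e :: real assume e: "e > 0"
  define d where "d = e / (cmod c + 1)"
  have d: "d > 0" "cmod c * d \<le> e"
    using e by (auto simp: d_def field_simps add_pos_nonneg add_nonneg_pos)
  obtain M where M: "M \<in> averages (carrier G)"
    "\<forall>g\<in>carrier G. cmod (M (\<lambda>h. f (g \<otimes> h))) \<le> d"
    using mean_nullD[OF assms d(1)] by (rule bexE)
  have "cmod (M (\<lambda>h. c * f (g \<otimes> h))) \<le> e" if "g \<in> carrier G" for g
    using mult_left_mono[OF bspec[OF M(2) that], of "cmod c"] d(2)
    by (simp add: average_cmult[OF M(1)] norm_mult)
  with M(1) show "\<exists>M. M \<in> averages (carrier G) \<and>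
      (\<forall>g\<in>carrier G. cmod (M (\<lambda>h. c * f (g \<otimes> h))) \<le> e)"
    by (intro exI[of _ M]) simp
qed

text \<open>The convolution of an average that is good for \<open>f\<close> with one that is good for \<open>f'\<close> is good
  for both. It averages translates of a quantity that is uniformly small already, and by
  commutativity either factor can be taken to act first.\<close>

lemma (in Group.comm_group) mean_null_add:
  assumes "mean_null G f" "mean_null G f'"
  shows "mean_null G (\<lambda>g. f g + f' g)"
proof (rule mean_nullI)
  fix e :: real assume e: "e > 0"
  obtain M where M: "M \<in> averages (carrier G)"
    "\<forall>g\<in>carrier G. cmod (M (\<lambda>h. f (g \<otimes> h))) \<le> e / 2"
    using mean_nullD[OF assms(1) half_gt_zero[OF e]] by (rule bexE)
  obtain M' where M': "M' \<in> averages (carrier G)"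
    "\<forall>g\<in>carrier G. cmod (M' (\<lambda>h. f' (g \<otimes> h))) \<le> e / 2"
    using mean_nullD[OF assms(2) half_gt_zero[OF e]] by (rule bexE)
  define N where "N = (\<lambda>F. M' (\<lambda>h. M (\<lambda>k. F (h \<otimes> k))))"
  have N: "N \<in> averages (carrier G)"
    unfolding N_def using M'(1) M(1) by (rule average_convolve)
  have "cmod (N (\<lambda>h. f (g \<otimes> h) + f' (g \<otimes> h))) \<le> e" if g: "g \<in> carrier G" for g
  proof -
    have "N (\<lambda>h. f (g \<otimes> h)) = M' (\<lambda>h. M (\<lambda>k. f ((g \<otimes> h) \<otimes> k)))"
      unfolding N_def using g by (intro average_cong[OF M'(1)] average_cong[OF M(1)]) (simp add: m_assoc)
    also have "cmod \<dots> \<le> e / 2"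
      by (rule average_bound[OF M'(1)]) (use g M(2) in auto)
    finally have 1: "cmod (N (\<lambda>h. f (g \<otimes> h))) \<le> e / 2" .
    have "N (\<lambda>h. f' (g \<otimes> h)) = M (\<lambda>k. M' (\<lambda>h. f' (g \<otimes> (h \<otimes> k))))"
      unfolding N_def using M'(1) M(1) by (rule average_Fubini)
    also have "\<dots> = M (\<lambda>k. M' (\<lambda>h. f' ((g \<otimes> k) \<otimes> h)))"
      using g by (intro average_cong[OF M(1)] average_cong[OF M'(1)]) (simp add: m_ac)
    also have "cmod \<dots> \<le> e / 2"
      by (rule average_bound[OF M(1)]) (use g M'(2) in auto)
    finally have 2: "cmod (N (\<lambda>h. f' (g \<otimes> h))) \<le> e / 2" .
    show ?thesis
      using 1 2 norm_triangle_ineq[of "N (\<lambda>h. f (g \<otimes> h))" "N (\<lambda>h. f' (g \<otimes> h))"]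
      by (simp add: average_add[OF N])
  qed
  with N show "\<exists>N. N \<in> averages (carrier G) \<and>
      (\<forall>g\<in>carrier G. cmod (N (\<lambda>h. f (g \<otimes> h) + f' (g \<otimes> h))) \<le> e)"
    by (intro exI[of _ N]) simp
qed

text \<open>The theorem of Alaoglu and Birkhoff. A sequence in the convex hull \<open>C\<close> of the orbit of \<open>x\<close>
  whose norms tend to the infimum is a Cauchy sequence by the parallelogram law. Its limit is
  fixed, since \<open>V g\<close> maps \<open>C\<close> to itself and preserves norms, so that the sequence and its image
  both minimize the norm and must approach each other.\<close>

theorem (in unitary_action) mean_ergodic:
  assumes complete: "Metric_space.mcomplete (carrier H) (hdist H)"
    and x: "x \<in> carrier H"
  obtains y where "y \<in> carrier H" "\<And>g. g \<in> carrier G \<Longrightarrow> V g y = y"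
    "\<And>e. e > 0 \<Longrightarrow> \<exists>M\<in>averages (carrier G). \<forall>z\<in>carrier H.
       cmod (M (\<lambda>g. cinner H (V g x) z) - cinner H y z) \<le> e * hnorm H z"
proof -
  define C where "C = {y \<in> carrier H. \<exists>M\<in>averages (carrier G).
    \<forall>z\<in>carrier H. cinner H y z = M (\<lambda>g. cinner H (V g x) z)}"
  have C_closed: "y \<in> carrier H" if "y \<in> C" for y
    using that by (simp add: C_def)
  have C_act: "V g y \<in> C" if g: "g \<in> carrier G" and y: "y \<in> C" for g y
  proof -
    obtain M where M: "M \<in> averages (carrier G)"
      "\<And>z. z \<in> carrier H \<Longrightarrow> cinner H y z = M (\<lambda>h. cinner H (V h x) z)"
      using y by (auto simp: C_def)
    have "cinner H (V g y) z = M (\<lambda>h. cinner H (V (g \<otimes>\<^bsub>G\<^esub> h) x) z)" if z: "z \<in> carrier H" for z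
    proof -
      have "cinner H (V g y) z = M (\<lambda>h. cinner H (V h x) (V (inv\<^bsub>G\<^esub> g) z))"
        using g y z C_closed by (simp add: act_inner_adjoint M(2))
      also have "\<dots> = M (\<lambda>h. cinner H (V (g \<otimes>\<^bsub>G\<^esub> h) x) z)"
        using g x z by (intro average_cong[OF M(1)]) (simp add: act_mult act_inner_adjoint)
      finally show ?thesis .
    qed
    then have "\<exists>N\<in>averages (carrier G). \<forall>z\<in>carrier H.
        cinner H (V g y) z = N (\<lambda>h. cinner H (V h x) z)"
      by (intro bexI[OF _ G.average_translate[OF M(1) g]]) simp
    then show ?thesis
      using g C_closed[OF y] by (simp add: C_def)
  qed
  have C_mid: "(1/2) \<odot> (y \<oplus> y') \<in> C" if y: "y \<in> C" and y': "y' \<in> C" for y y'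
  proof -
    obtain M M' where M: "M \<in> averages (carrier G)" "M' \<in> averages (carrier G)"
      "\<And>z. z \<in> carrier H \<Longrightarrow> cinner H y z = M (\<lambda>h. cinner H (V h x) z)"
      "\<And>z. z \<in> carrier H \<Longrightarrow> cinner H y' z = M' (\<lambda>h. cinner H (V h x) z)"
      using y y' by (auto simp: C_def)
    have "\<exists>N\<in>averages (carrier G). \<forall>z\<in>carrier H.
        cinner H ((1/2) \<odot> (y \<oplus> y')) z = N (\<lambda>h. cinner H (V h x) z)"
      using C_closed[OF y] C_closed[OF y']
      by (intro bexI[OF _ averages.midpoint[OF M(1,2)]]) (simp add: inner_simps M(3,4))
    then show ?thesis
      using C_closed[OF y] C_closed[OF y'] by (simp add: C_def)
  qed
  have "x \<in> C"
    unfolding C_def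
    by (auto intro!: x bexI[OF _ averages.point[OF G.one_closed]] simp: act_one[OF x])
  define d where "d = (INF y\<in>C. (hnorm H y)\<^sup>2)"
  have bdd: "bdd_below ((\<lambda>y. (hnorm H y)\<^sup>2) ` C)"
    by (auto intro: bdd_belowI[of _ 0])
  have d_le: "d \<le> (hnorm H y)\<^sup>2" if "y \<in> C" for y
    unfolding d_def using bdd that by (rule cINF_lower)
  have "\<exists>y\<in>C. (hnorm H y)\<^sup>2 < d + 1 / real (Suc n)" for n
    using cINF_less_iff[OF _ bdd, of "d + 1 / real (Suc n)"] \<open>x \<in> C\<close> unfolding d_def by fastforce
  then obtain s where s: "\<And>n. s n \<in> C" "\<And>n. (hnorm H (s n))\<^sup>2 < d + 1 / real (Suc n)"
    by metis
  \<comment> \<open>the parallelogram law, as the midpoint of two elements of \<open>C\<close> has squared norm at least \<open>d\<close>\<close>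
  have close: "(hnorm H (y \<ominus> y'))\<^sup>2 \<le> 2 * ((hnorm H y)\<^sup>2 - d) + 2 * ((hnorm H y')\<^sup>2 - d)"
    if y: "y \<in> C" and y': "y' \<in> C" for y y'
  proof -
    have "d \<le> (hnorm H ((1/2) \<odot> (y \<oplus> y')))\<^sup>2"
      by (rule d_le[OF C_mid[OF y y']])
    also have "\<dots> = (1/4) * (hnorm H (y \<oplus> y'))\<^sup>2"
      using C_closed[OF y] C_closed[OF y'] by (simp add: hnorm_smult norm_divide power_divide)
    finally show ?thesis
      using C_closed[OF y] C_closed[OF y'] by (simp add: hnorm_sq_add hnorm_sq_minus)
  qed
  have Cauchy_bound: "(hnorm H (s m \<ominus> s n))\<^sup>2 \<le> 2 / real (Suc m) + 2 / real (Suc n)" for m n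
    using close[OF s(1)[of m] s(1)[of n]] s(2)[of m] s(2)[of n] by simp
  have inverse_small: "\<exists>N. \<forall>n\<ge>N. 1 / real (Suc n) < r" if "r > 0" for r :: real
    using LIMSEQ_D[OF LIMSEQ_inverse_real_of_nat that] by (simp add: inverse_eq_divide)
  have "\<exists>N. \<forall>m\<ge>N. \<forall>n\<ge>N. hnorm H (s m \<ominus> s n) < e" if e: "e > 0" for e
  proof -
    obtain N where N: "\<And>n. n \<ge> N \<Longrightarrow> 1 / real (Suc n) < e\<^sup>2 / 4"
      using inverse_small[of "e\<^sup>2 / 4"] e by auto
    have "hnorm H (s m \<ominus> s n) < e" if "m \<ge> N" "n \<ge> N" for m n
    proof (rule power2_less_imp_less)
      show "(hnorm H (s m \<ominus> s n))\<^sup>2 < e\<^sup>2"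
        using Cauchy_bound[of m n] N[OF that(1)] N[OF that(2)] by simp
    qed (use e in simp)
    then show ?thesis by blast
  qed
  moreover have "range s \<subseteq> carrier H"
    using s(1) C_closed by auto
  ultimately obtain y where y: "y \<in> carrier H" "(\<lambda>n. hnorm H (s n \<ominus> y)) \<longlonglongrightarrow> 0"
    using complete unfolding mcomplete_iff by meson
  have s_closed: "s n \<in> carrier H" for n
    using s(1) C_closed by simp
  have fixed: "V g y = y" if g: "g \<in> carrier G" for g
  proof (rule vector_eqI)
    fix z assume z: "z \<in> carrier H"
    have "(\<lambda>n. hnorm H (V g (s n) \<ominus> s n)) \<longlonglongrightarrow> 0"
    proof (rule Lim_null_comparison)
      have "hnorm H (V g (s n) \<ominus> s n) \<le> 2 * sqrt (1 / real (Suc n))" for n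
      proof (rule power2_le_imp_le)
        show "(hnorm H (V g (s n) \<ominus> s n))\<^sup>2 \<le> (2 * sqrt (1 / real (Suc n)))\<^sup>2"
          using close[OF C_act[OF g s(1)[of n]] s(1)[of n]] s(2)[of n] act_hnorm[OF g s_closed[of n]]
          by (simp add: power_mult_distrib)
      qed simp
      then show "\<forall>\<^sub>F n in sequentially.
          norm (hnorm H (V g (s n) \<ominus> s n)) \<le> 2 * sqrt (1 / real (Suc n))"
        using g s_closed by simp
      have "(\<lambda>n. 2 * sqrt (1 / real (Suc n))) \<longlonglongrightarrow> 2 * sqrt 0"
        using LIMSEQ_inverse_real_of_nat by (intro tendsto_intros) (simp add: inverse_eq_divide)
      then show "(\<lambda>n. 2 * sqrt (1 / real (Suc n))) \<longlonglongrightarrow> 0"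
        by simp
    qed
    moreover have "V g (s n) \<ominus> s n = (V g (s n) \<ominus> s n) \<ominus> \<zero>" for n
      using g s_closed by (intro vector_eqI) (auto simp: inner_simps)
    ultimately have "(\<lambda>n. cinner H (V g (s n) \<ominus> s n) z) \<longlonglongrightarrow> cinner H \<zero> z"
      using g s_closed z by (intro inner_tendsto) auto
    then have "(\<lambda>n. cinner H (s n) (V (inv\<^bsub>G\<^esub> g) z) - cinner H (s n) z) \<longlonglongrightarrow> 0"
      using g s_closed z by (simp add: inner_simps act_inner_adjoint)
    moreover have "(\<lambda>n. cinner H (s n) (V (inv\<^bsub>G\<^esub> g) z) - cinner H (s n) z)
        \<longlonglongrightarrow> cinner H y (V (inv\<^bsub>G\<^esub> g) z) - cinner H y z"
      using s_closed y g z by (intro tendsto_diff inner_tendsto) auto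
    ultimately have "cinner H y (V (inv\<^bsub>G\<^esub> g) z) - cinner H y z = 0"
      using LIMSEQ_unique by blast
    then show "cinner H (V g y) z = cinner H y z"
      using g y z by (simp add: act_inner_adjoint)
  qed (use g y in auto)
  have approx: "\<exists>M\<in>averages (carrier G). \<forall>z\<in>carrier H.
       cmod (M (\<lambda>g. cinner H (V g x) z) - cinner H y z) \<le> e * hnorm H z" if e: "e > 0" for e
  proof -
    obtain n where n: "hnorm H (s n \<ominus> y) < e"
      using LIMSEQ_D[OF y(2) e] y s_closed by fastforce
    obtain M where M: "M \<in> averages (carrier G)"
      "\<And>z. z \<in> carrier H \<Longrightarrow> cinner H (s n) z = M (\<lambda>h. cinner H (V h x) z)"
      using s(1)[of n] by (auto simp: C_def)
    have "cmod (M (\<lambda>h. cinner H (V h x) z) - cinner H y z) \<le> e * hnorm H z"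
      if z: "z \<in> carrier H" for z
    proof -
      have "cmod (cinner H (s n \<ominus> y) z) \<le> hnorm H (s n \<ominus> y) * hnorm H z"
        using s_closed y z by (intro Cauchy_Schwarz) auto
      also have "\<dots> \<le> e * hnorm H z"
        using n z by (intro mult_right_mono) auto
      finally show ?thesis
        using s_closed y z by (simp add: inner_minus_left M(2))
    qed
    then show ?thesis
      by (intro bexI[OF _ M(1)]) simp
  qed
  show thesis
    using that[OF y(1) fixed] approx by simp
qed

text \<open>The limit \<open>y\<close> is the orthogonal projection of \<open>x\<close> onto the fixed vectors: if \<open>z\<close> is fixed,
  then \<open>\<langle>V g x, z\<rangle>\<close> is the constant \<open>\<langle>x, z\<rangle>\<close>, which averaging does not change. Translating an
  average by \<open>g\<close> amounts to replacing \<open>w\<close> by \<open>V g\<^sup>-\<^sup>1 w\<close>, of the same norm, so the estimate of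
  the ergodic theorem is uniform in \<open>g\<close>.\<close>

corollary (in unitary_action) ergodic_projection:
  assumes complete: "Metric_space.mcomplete (carrier H) (hdist H)"
    and x: "x \<in> carrier H"
  shows "\<exists>y\<in>carrier H. (\<forall>g\<in>carrier G. V g y = y) \<and>
    (\<forall>z\<in>carrier H. (\<forall>g\<in>carrier G. V g z = z) \<longrightarrow> cinner H x z = cinner H y z) \<and>
    (\<forall>w\<in>carrier H. mean_null G (\<lambda>g. cinner H (V g x) w - cinner H y w))"
proof -
  obtain y where y: "y \<in> carrier H" "\<And>g. g \<in> carrier G \<Longrightarrow> V g y = y"
    and ergodic: "\<And>e. e > 0 \<Longrightarrow> \<exists>M\<in>averages (carrier G). \<forall>z\<in>carrier H.
       cmod (M (\<lambda>g. cinner H (V g x) z) - cinner H y z) \<le> e * hnorm H z"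
    using mean_ergodic[OF assms] by blast
  have null: "mean_null G (\<lambda>g. cinner H (V g x) w - cinner H y w)" if w: "w \<in> carrier H" for w
  proof (rule mean_nullI)
    fix e :: real assume e: "e > 0"
    define d where "d = e / (hnorm H w + 1)"
    have "hnorm H w + 1 > 0"
      using w by (simp add: add_nonneg_pos)
    with e have d: "d > 0" "d * hnorm H w \<le> e"
      by (auto simp: d_def divide_simps algebra_simps)
    obtain M where M: "M \<in> averages (carrier G)" "\<forall>z\<in>carrier H.
        cmod (M (\<lambda>g. cinner H (V g x) z) - cinner H y z) \<le> d * hnorm H z"
      using ergodic[OF d(1)] by (rule bexE)
    have "cmod (M (\<lambda>h. cinner H (V (g \<otimes>\<^bsub>G\<^esub> h) x) w - cinner H y w)) \<le> e"
      if g: "g \<in> carrier G" for g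
    proof -
      have "M (\<lambda>h. cinner H (V (g \<otimes>\<^bsub>G\<^esub> h) x) w - cinner H y w)
          = M (\<lambda>h. cinner H (V h x) (V (inv\<^bsub>G\<^esub> g) w) + - cinner H y w)"
        using g x w by (intro average_cong[OF M(1)]) (simp add: act_mult act_inner_adjoint)
      also have "\<dots> = M (\<lambda>h. cinner H (V h x) (V (inv\<^bsub>G\<^esub> g) w)) - cinner H y w"
        by (simp only: average_add[OF M(1)] average_const[OF M(1)]) simp
      finally have "M (\<lambda>h. cinner H (V (g \<otimes>\<^bsub>G\<^esub> h) x) w - cinner H y w)
          = M (\<lambda>h. cinner H (V h x) (V (inv\<^bsub>G\<^esub> g) w)) - cinner H y w" .
      moreover have "cinner H y w = cinner H y (V (inv\<^bsub>G\<^esub> g) w)"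
        using act_inner_adjoint[of g y w] g y w by simp
      ultimately have "cmod (M (\<lambda>h. cinner H (V (g \<otimes>\<^bsub>G\<^esub> h) x) w - cinner H y w))
          \<le> d * hnorm H (V (inv\<^bsub>G\<^esub> g) w)"
        using bspec[OF M(2), of "V (inv\<^bsub>G\<^esub> g) w"] g w by simp
      with d(2) g w show ?thesis
        by (simp add: act_hnorm)
    qed
    with M(1) show "\<exists>M. M \<in> averages (carrier G) \<and> (\<forall>g\<in>carrier G.
        cmod (M (\<lambda>h. cinner H (V (g \<otimes>\<^bsub>G\<^esub> h) x) w - cinner H y w)) \<le> e)"
      by (intro exI[of _ M]) simp
  qed
  have proj: "cinner H x z = cinner H y z"
    if z: "z \<in> carrier H" and fixed: "\<And>g. g \<in> carrier G \<Longrightarrow> V g z = z" for z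
  proof -
    have "cmod (cinner H x z - cinner H y z) \<le> 0 + d" if d: "d > 0" for d
    proof -
      obtain M where M: "M \<in> averages (carrier G)" "\<forall>g\<in>carrier G.
          cmod (M (\<lambda>h. cinner H (V (g \<otimes>\<^bsub>G\<^esub> h) x) z - cinner H y z)) \<le> d"
        using mean_nullD[OF null[OF z] d] by (rule bexE)
      have "M (\<lambda>h. cinner H (V (\<one>\<^bsub>G\<^esub> \<otimes>\<^bsub>G\<^esub> h) x) z - cinner H y z)
          = M (\<lambda>h. cinner H x z - cinner H y z)"
        using x z by (intro average_cong[OF M(1)]) (simp add: act_inner_adjoint fixed)
      with bspec[OF M(2) G.one_closed] show ?thesis
        by (simp add: average_const[OF M(1)])
    qed
    then have "cmod (cinner H x z - cinner H y z) \<le> 0"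
      by (rule field_le_epsilon)
    then show ?thesis
      by simp
  qed
  show ?thesis
    using y proj null by (intro bexI[of _ y]) auto
qed


section \<open>The dual of a discrete abelian group\<close>

abbreviation discrete_dual :: "('a, 'b) monoid_scheme \<Rightarrow> ('a \<Rightarrow> complex) monoid" where
  "discrete_dual A \<equiv> pontryagin_dual A (discrete_topology (carrier A))"

abbreviation discrete_dual_topology :: "('a, 'b) monoid_scheme \<Rightarrow> ('a \<Rightarrow> complex) topology" where
  "discrete_dual_topology A \<equiv> dual_topology A (discrete_topology (carrier A))"

lemma discrete_dual_iff:
  "\<gamma> \<in> carrier (discrete_dual A) \<longleftrightarrow> \<gamma> \<in> extensional (carrier A) \<and>
    (\<forall>a\<in>carrier A. cmod (\<gamma> a) = 1) \<and>
    (\<forall>a\<in>carrier A. \<forall>b\<in>carrier A. \<gamma> (a \<otimes>\<^bsub>A\<^esub> b) = \<gamma> a * \<gamma> b)"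
  by (auto simp: pontryagin_dual_def hom_def circle_group_def)

lemma discrete_dual_mult:
  "mult (discrete_dual A) = (\<lambda>\<gamma> \<eta>. \<lambda>a\<in>carrier A. \<gamma> a * \<eta> a)"
  by (simp add: pontryagin_dual_def)

lemma discrete_dual_one: "one (discrete_dual A) = (\<lambda>a\<in>carrier A. 1)"
  by (simp add: pontryagin_dual_def)

lemma comm_group_discrete_dual:
  fixes A (structure)
  assumes "Group.group A"
  shows "comm_group (discrete_dual A)"
proof -
  interpret Group.group A by fact
  show ?thesis
  proof (rule comm_groupI)
  show "\<one>\<^bsub>discrete_dual A\<^esub> \<in> carrier (discrete_dual A)"
    by (auto simp: discrete_dual_iff discrete_dual_one)
  fix \<gamma> assume \<gamma>: "\<gamma> \<in> carrier (discrete_dual A)"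
  show "\<exists>\<eta>\<in>carrier (discrete_dual A). \<eta> \<otimes>\<^bsub>discrete_dual A\<^esub> \<gamma> = \<one>\<^bsub>discrete_dual A\<^esub>"
  proof (rule bexI)
    show "(\<lambda>a\<in>carrier A. cnj (\<gamma> a)) \<otimes>\<^bsub>discrete_dual A\<^esub> \<gamma> = \<one>\<^bsub>discrete_dual A\<^esub>"
      using \<gamma> by (auto simp: discrete_dual_iff discrete_dual_one discrete_dual_mult
          cnj_mult_self_if_norm_1)
    show "(\<lambda>a\<in>carrier A. cnj (\<gamma> a)) \<in> carrier (discrete_dual A)"
      using \<gamma> by (auto simp: discrete_dual_iff)
  qed
  show "\<one>\<^bsub>discrete_dual A\<^esub> \<otimes>\<^bsub>discrete_dual A\<^esub> \<gamma> = \<gamma>"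
    using \<gamma> by (auto simp: discrete_dual_iff discrete_dual_one discrete_dual_mult
        fun_eq_iff extensional_def)
qed (auto simp: discrete_dual_iff discrete_dual_mult norm_mult mult_ac)
qed

lemma discrete_dual_inv:
  assumes "Group.group A" "\<gamma> \<in> carrier (discrete_dual A)" "a \<in> carrier A"
  shows "(inv\<^bsub>discrete_dual A\<^esub> \<gamma>) a = cnj (\<gamma> a)"
proof -
  interpret D: comm_group "discrete_dual A"
    by (rule comm_group_discrete_dual) fact
  have "(inv\<^bsub>discrete_dual A\<^esub> \<gamma> \<otimes>\<^bsub>discrete_dual A\<^esub> \<gamma>) a = 1"
    using assms(2,3) D.l_inv[OF assms(2)] by (simp add: discrete_dual_one)
  then have "(inv\<^bsub>discrete_dual A\<^esub> \<gamma>) a * \<gamma> a = 1"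
    using assms(3) by (simp add: discrete_dual_mult)
  moreover have "cnj (\<gamma> a) * \<gamma> a = 1" "\<gamma> a \<noteq> 0"
    using assms(2,3) by (auto simp: discrete_dual_iff cnj_mult_self_if_norm_1)
  ultimately show ?thesis
    by (metis mult_cancel_right)
qed

lemma discrete_dual_at_one:
  assumes "Group.group A" "\<gamma> \<in> carrier (discrete_dual A)"
  shows "\<gamma> (one A) = 1"
proof -
  interpret Group.group A by fact
  have "\<gamma> (\<one>\<^bsub>A\<^esub> \<otimes>\<^bsub>A\<^esub> \<one>\<^bsub>A\<^esub>) = \<gamma> \<one>\<^bsub>A\<^esub> * \<gamma> \<one>\<^bsub>A\<^esub>" "cmod (\<gamma> \<one>\<^bsub>A\<^esub>) = 1"
    using assms(2) one_closed unfolding discrete_dual_iff by blast+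
  then show ?thesis
    by auto
qed

lemma discrete_dual_at_inv:
  assumes "Group.group A" "\<gamma> \<in> carrier (discrete_dual A)" "a \<in> carrier A"
  shows "\<gamma> (m_inv A a) = cnj (\<gamma> a)"
proof -
  interpret Group.group A by fact
  have "\<gamma> (inv\<^bsub>A\<^esub> a) * \<gamma> a = \<gamma> (inv\<^bsub>A\<^esub> a \<otimes>\<^bsub>A\<^esub> a)"
    using assms(2,3) inv_closed unfolding discrete_dual_iff by metis
  also have "\<dots> = 1"
    using assms by (simp add: discrete_dual_at_one)
  finally have "\<gamma> (inv\<^bsub>A\<^esub> a) * \<gamma> a = cnj (\<gamma> a) * \<gamma> a" "\<gamma> a \<noteq> 0"
    using assms(2,3) by (auto simp: discrete_dual_iff cnj_mult_self_if_norm_1)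
  then show ?thesis
    by simp
qed

lemma topspace_discrete_dual [simp]:
  "topspace (discrete_dual_topology A) = carrier (discrete_dual A)"
proof -
  have "carrier (discrete_dual A) \<in>
    {{\<gamma> \<in> carrier (discrete_dual A). \<gamma> ` K \<subseteq> V} | K V.
      compactin (discrete_topology (carrier A)) K \<and> open V}"
    by (auto intro!: exI[of _ "{}"])
  then show ?thesis
    unfolding dual_topology_def topology_generated_by_topspace by auto
qed

text \<open>Compact subsets of a discrete group are finite. So the compact-open topology on its dual is
  that of pointwise convergence, and the following two lemmas describe its neighbourhoods.\<close>

lemma openin_discrete_dual_box:
  assumes "finite F" "F \<subseteq> carrier A"
  shows "openin (discrete_dual_topology A)
    {\<gamma> \<in> carrier (discrete_dual A). \<forall>a\<in>F. cmod (\<gamma> a - z a) < e}"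
  using assms
proof (induction F rule: finite_induct)
  case empty
  then show ?case
    using openin_topspace[of "discrete_dual_topology A"] by simp
next
  case (insert b F)
  have "openin (discrete_dual_topology A)
      {\<gamma> \<in> carrier (discrete_dual A). \<gamma> ` {b} \<subseteq> ball (z b) e}"
    unfolding dual_topology_def
    by (rule topology_generated_by_Basis)
      (use insert.prems in \<open>auto simp: compactin_discrete_topology intro!: exI[of _ "{b}"] exI[of _ "ball (z b) e"]\<close>)
  with insert have "openin (discrete_dual_topology A)
      ({\<gamma> \<in> carrier (discrete_dual A). \<gamma> ` {b} \<subseteq> ball (z b) e} \<inter>
       {\<gamma> \<in> carrier (discrete_dual A). \<forall>a\<in>F. cmod (\<gamma> a - z a) < e})"
    by (intro openin_Int) auto
  also have "{\<gamma> \<in> carrier (discrete_dual A). \<gamma> ` {b} \<subseteq> ball (z b) e} \<inter>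
       {\<gamma> \<in> carrier (discrete_dual A). \<forall>a\<in>F. cmod (\<gamma> a - z a) < e}
     = {\<gamma> \<in> carrier (discrete_dual A). \<forall>a\<in>insert b F. cmod (\<gamma> a - z a) < e}"
    by (auto simp: dist_norm norm_minus_commute)
  finally show ?case .
qed

lemma discrete_dual_nhd_box:
  assumes "openin (discrete_dual_topology A) W" "\<gamma>\<^sub>0 \<in> W"
  obtains F e where "finite F" "F \<subseteq> carrier A" "e > 0"
    "{\<gamma> \<in> carrier (discrete_dual A). \<forall>a\<in>F. cmod (\<gamma> a - \<gamma>\<^sub>0 a) < e} \<subseteq> W"
proof -
  have "\<exists>F e. finite F \<and> F \<subseteq> carrier A \<and> e > 0 \<and>
    {\<gamma> \<in> carrier (discrete_dual A). \<forall>a\<in>F. cmod (\<gamma> a - \<gamma>\<^sub>0 a) < e} \<subseteq> W"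
    using assms unfolding dual_topology_def openin_topology_generated_by_iff
  proof (induction rule: generate_topology_on.induct)
    case (Int W W')
    obtain F e where F: "finite F" "F \<subseteq> carrier A" "e > 0"
      "{\<gamma> \<in> carrier (discrete_dual A). \<forall>a\<in>F. cmod (\<gamma> a - \<gamma>\<^sub>0 a) < e} \<subseteq> W"
      using Int by auto
    obtain F' e' where F': "finite F'" "F' \<subseteq> carrier A" "e' > 0"
      "{\<gamma> \<in> carrier (discrete_dual A). \<forall>a\<in>F'. cmod (\<gamma> a - \<gamma>\<^sub>0 a) < e'} \<subseteq> W'"
      using Int by auto
    show ?case
      using F F' by (intro exI[of _ "F \<union> F'"] exI[of _ "min e e'"]) auto
  next
    case (UN K)
    then obtain k where k: "k \<in> K" "\<gamma>\<^sub>0 \<in> k"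
      by auto
    obtain F e where F: "finite F" "F \<subseteq> carrier A" "e > 0"
      "{\<gamma> \<in> carrier (discrete_dual A). \<forall>a\<in>F. cmod (\<gamma> a - \<gamma>\<^sub>0 a) < e} \<subseteq> k"
      using UN.IH[OF k] by (elim exE conjE)
    then show ?case
      using k(1) by (intro exI[of _ F] exI[of _ e]) auto
  next
    case (Basis W)
    then obtain K V where K: "K \<subseteq> carrier A" "finite K" "open V" "\<gamma>\<^sub>0 ` K \<subseteq> V"
      "W = {\<gamma> \<in> carrier (discrete_dual A). \<gamma> ` K \<subseteq> V}"
      by (auto simp: compactin_discrete_topology)
    have "\<exists>e>0. \<forall>a\<in>K. ball (\<gamma>\<^sub>0 a) e \<subseteq> V"
      using K(2,4)
    proof (induction K rule: finite_induct)
      case empty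
      then show ?case
        by (auto intro: exI[of _ 1])
    next
      case (insert a K)
      then obtain e where e: "e > 0" "\<forall>a\<in>K. ball (\<gamma>\<^sub>0 a) e \<subseteq> V"
        by auto
      have "\<gamma>\<^sub>0 a \<in> V"
        using insert.prems by simp
      with \<open>open V\<close> obtain d where d: "d > 0" "ball (\<gamma>\<^sub>0 a) d \<subseteq> V"
        by (rule openE)
      show ?case
        using e d by (intro exI[of _ "min d e"]) (auto simp: subset_iff)
    qed
    then obtain e where e: "e > 0" "\<forall>a\<in>K. ball (\<gamma>\<^sub>0 a) e \<subseteq> V"
      by blast
    have "{\<gamma> \<in> carrier (discrete_dual A). \<forall>a\<in>K. cmod (\<gamma> a - \<gamma>\<^sub>0 a) < e} \<subseteq> W"
    proof
      fix \<gamma> assume \<gamma>: "\<gamma> \<in> {\<gamma> \<in> carrier (discrete_dual A). \<forall>a\<in>K. cmod (\<gamma> a - \<gamma>\<^sub>0 a) < e}"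
      have "\<gamma> a \<in> V" if "a \<in> K" for a
      proof -
        have "\<gamma> a \<in> ball (\<gamma>\<^sub>0 a) e"
          using \<gamma> that by (simp add: dist_norm norm_minus_commute)
        with e(2) that show ?thesis
          by blast
      qed
      with \<gamma> show "\<gamma> \<in> W"
        unfolding K(5) by auto
    qed
    with K(1,2) e(1) show ?case
      by (intro exI[of _ K] exI[of _ e]) simp
  qed simp
  then show thesis
    by (elim exE conjE) (rule that)
qed

text \<open>Restricted to \<open>F\<close>, the functions form a subset of a product of finitely many discs, which is
  totally bounded. The net is taken inside \<open>S\<close>, so that a net of a set of characters consists of
  characters.\<close>

lemma finite_net_of_bounded_functions:
  fixes S :: "('a \<Rightarrow> complex) set"
  assumes "finite F" "\<And>f a. \<lbrakk>f \<in> S; a \<in> F\<rbrakk> \<Longrightarrow> cmod (f a) \<le> B" "e > 0"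
  shows "\<exists>E. finite E \<and> E \<subseteq> S \<and> (\<forall>f\<in>S. \<exists>g\<in>E. \<forall>a\<in>F. cmod (f a - g a) < e)"
  using assms
proof (induction F arbitrary: S rule: finite_induct)
  case empty
  show ?case
  proof (cases "S = {}")
    case False
    then obtain f where "f \<in> S"
      by blast
    then show ?thesis
      by (intro exI[of _ "{f}"]) auto
  qed auto
next
  case (insert b F)
  have "\<forall>e>0. \<exists>K. finite K \<and> cball (0::complex) B \<subseteq> (\<Union>k\<in>K. ball k e)"
    using compact_cball compact_eq_totally_bounded by blast
  then obtain K :: "complex set" where K: "finite K" "cball 0 B \<subseteq> (\<Union>k\<in>K. ball k (e / 2))"
    using insert.prems(2) half_gt_zero by blast
  define S' where "S' = (\<lambda>k. {f \<in> S. f b \<in> ball k (e / 2)})"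
  have "\<exists>E. finite E \<and> E \<subseteq> S' k \<and> (\<forall>f\<in>S' k. \<exists>g\<in>E. \<forall>a\<in>F. cmod (f a - g a) < e)" for k
    by (rule insert.IH) (use insert.prems in \<open>auto simp: S'_def\<close>)
  then have "\<forall>k. \<exists>E. finite E \<and> E \<subseteq> S' k \<and> (\<forall>f\<in>S' k. \<exists>g\<in>E. \<forall>a\<in>F. cmod (f a - g a) < e)"
    by blast
  from choice[OF this] obtain E where E: "\<And>k. finite (E k)" "\<And>k. E k \<subseteq> S' k"
    "\<And>k f. f \<in> S' k \<Longrightarrow> \<exists>g\<in>E k. \<forall>a\<in>F. cmod (f a - g a) < e"
    by blast
  have "\<exists>g\<in>(\<Union>k\<in>K. E k). \<forall>a\<in>insert b F. cmod (f a - g a) < e" if f: "f \<in> S" for f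
  proof -
    have "f b \<in> cball 0 B"
      using insert.prems(1)[OF f] by simp
    then obtain k where k: "k \<in> K" "f b \<in> ball k (e / 2)"
      using K(2) by blast
    with f obtain g where g: "g \<in> E k" "\<forall>a\<in>F. cmod (f a - g a) < e"
      using E(3)[of f k] by (auto simp: S'_def)
    have "g b \<in> ball k (e / 2)"
      using g(1) E(2) by (auto simp: S'_def)
    with k(2) have "dist (f b) (g b) < e"
      by (metis dist_commute dist_triangle_half_l mem_ball)
    with g k show ?thesis
      by (auto simp: dist_norm)
  qed
  moreover have "finite (\<Union>k\<in>K. E k)" "(\<Union>k\<in>K. E k) \<subseteq> S"
    using K(1) E(1,2) by (auto simp: S'_def)
  ultimately show ?case
    by blast
qed


section \<open>Spectral decomposition of representations of a compact dual group\<close>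

text \<open>By \<open>separating\<close>, eigenspaces for different elements of \<open>A\<close> are orthogonal.\<close>

locale dual_action = A: Group.comm_group A + unitary_action H "discrete_dual A" U
  for A :: "('a, 'b) monoid_scheme" and H :: "('v, 'm) hilbert_scheme" (structure)
    and U :: "('a \<Rightarrow> complex) \<Rightarrow> 'v \<Rightarrow> 'v" +
  assumes complete: "Metric_space.mcomplete (carrier H) (hdist H)"
    and strongly_continuous: "x \<in> carrier H \<Longrightarrow>
      continuous_map (discrete_dual_topology A) (norm_topology H) (\<lambda>\<gamma>. U \<gamma> x)"
    and separating: "\<lbrakk>a \<in> carrier A; b \<in> carrier A; a \<noteq> b\<rbrakk>
      \<Longrightarrow> \<exists>\<gamma>\<in>carrier (discrete_dual A). \<gamma> a \<noteq> \<gamma> b"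
begin

sublocale G: Group.comm_group "discrete_dual A"
  by (rule comm_group_discrete_dual) (rule A.group_axioms)

abbreviation "\<Gamma> \<equiv> carrier (discrete_dual A)"

definition eigenspace :: "'a \<Rightarrow> 'v set" where
  "eigenspace a = {x \<in> carrier H. \<forall>\<gamma>\<in>\<Gamma>. U \<gamma> x = \<gamma> a \<odot> x}"

lemma eigenspace_closed: "x \<in> eigenspace a \<Longrightarrow> x \<in> carrier H"
  by (simp add: eigenspace_def)

lemma character_norm: "\<gamma> \<in> \<Gamma> \<Longrightarrow> a \<in> carrier A \<Longrightarrow> cmod (\<gamma> a) = 1"
  by (simp add: discrete_dual_iff)

lemma character_mult:
  "\<lbrakk>\<gamma> \<in> \<Gamma>; a \<in> carrier A; b \<in> carrier A\<rbrakk> \<Longrightarrow> \<gamma> (a \<otimes>\<^bsub>A\<^esub> b) = \<gamma> a * \<gamma> b"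
  by (simp add: discrete_dual_iff)

lemma character_inv: "\<lbrakk>\<gamma> \<in> \<Gamma>; a \<in> carrier A\<rbrakk> \<Longrightarrow> \<gamma> (inv\<^bsub>A\<^esub> a) = cnj (\<gamma> a)"
  by (rule discrete_dual_at_inv) (rule A.group_axioms)

text \<open>Twisting by \<open>a\<close> turns the eigenvectors for \<open>a\<^sup>-\<^sup>1\<close> into fixed vectors, to which the ergodic
  theorem applies.\<close>

lemma twisted_action:
  assumes a: "a \<in> carrier A"
  shows "unitary_action H (discrete_dual A) (\<lambda>\<gamma>. \<lambda>x\<in>carrier H. \<gamma> a \<odot> U \<gamma> x)"
proof
  show "(\<lambda>\<gamma>. \<lambda>x\<in>carrier H. \<gamma> a \<odot> U \<gamma> x) \<in> hom (discrete_dual A) (unitary_group H)"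
  proof (rule hom_unitary_groupI)
    fix \<gamma> assume "\<gamma> \<in> \<Gamma>"
    then show "(\<lambda>x\<in>carrier H. \<gamma> a \<odot> U \<gamma> x) \<in> unitaries H H"
      using a by (intro scaled_unitary act_unitary character_norm)
  next
    fix \<gamma> \<eta> x assume *: "\<gamma> \<in> \<Gamma>" "\<eta> \<in> \<Gamma>" "x \<in> carrier H"
    have "(\<gamma> \<otimes>\<^bsub>discrete_dual A\<^esub> \<eta>) a = \<gamma> a * \<eta> a"
      using a by (simp add: discrete_dual_mult)
    with * show "(\<lambda>x\<in>carrier H. (\<gamma> \<otimes>\<^bsub>discrete_dual A\<^esub> \<eta>) a \<odot> U (\<gamma> \<otimes>\<^bsub>discrete_dual A\<^esub> \<eta>) x) x
        = (\<lambda>x\<in>carrier H. \<gamma> a \<odot> U \<gamma> x) ((\<lambda>x\<in>carrier H. \<eta> a \<odot> U \<eta> x) x)"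
      by (simp add: act_mult act_smult scale_scale)
  qed simp
qed

lemma fixed_by_twisted_action_iff:
  assumes "a \<in> carrier A" "y \<in> carrier H"
  shows "(\<forall>\<gamma>\<in>\<Gamma>. (\<lambda>x\<in>carrier H. \<gamma> a \<odot> U \<gamma> x) y = y) \<longleftrightarrow> y \<in> eigenspace (inv\<^bsub>A\<^esub> a)"
proof -
  have "\<gamma> a \<odot> U \<gamma> y = y \<longleftrightarrow> U \<gamma> y = \<gamma> (inv\<^bsub>A\<^esub> a) \<odot> y" if \<gamma>: "\<gamma> \<in> \<Gamma>" for \<gamma>
  proof -
    have "cnj (\<gamma> a) * \<gamma> a = 1"
      using character_norm[OF \<gamma>] assms(1) by (simp add: cnj_mult_self_if_norm_1)
    then have "cnj (\<gamma> a) \<odot> (\<gamma> a \<odot> U \<gamma> y) = U \<gamma> y" "\<gamma> a \<odot> (cnj (\<gamma> a) \<odot> y) = y"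
      using \<gamma> assms(2) by (simp_all add: scale_scale scale_one mult.commute)
    then show ?thesis
      using character_inv[OF \<gamma> assms(1)] by metis
  qed
  then show ?thesis
    using assms(2) by (simp add: eigenspace_def)
qed

lemma eigenspace_projection:
  assumes a: "a \<in> carrier A" and x: "x \<in> carrier H"
  shows "\<exists>y\<in>eigenspace a. \<forall>z\<in>eigenspace a. cinner H x z = cinner H y z"
proof -
  interpret T: unitary_action H "discrete_dual A" "\<lambda>\<gamma>. \<lambda>x\<in>carrier H. \<gamma> (inv\<^bsub>A\<^esub> a) \<odot> U \<gamma> x"
    using a by (intro twisted_action) simp
  obtain y where y: "y \<in> carrier H"
    "\<forall>\<gamma>\<in>\<Gamma>. (\<lambda>x\<in>carrier H. \<gamma> (inv\<^bsub>A\<^esub> a) \<odot> U \<gamma> x) y = y"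
    "\<forall>z\<in>carrier H. (\<forall>\<gamma>\<in>\<Gamma>. (\<lambda>x\<in>carrier H. \<gamma> (inv\<^bsub>A\<^esub> a) \<odot> U \<gamma> x) z = z)
      \<longrightarrow> cinner H x z = cinner H y z"
    using T.ergodic_projection[OF complete x] by (elim bexE conjE) (rule that)
  have iff: "(\<forall>\<gamma>\<in>\<Gamma>. (\<lambda>x\<in>carrier H. \<gamma> (inv\<^bsub>A\<^esub> a) \<odot> U \<gamma> x) z = z) \<longleftrightarrow> z \<in> eigenspace a"
    if "z \<in> carrier H" for z
    using fixed_by_twisted_action_iff[of "inv\<^bsub>A\<^esub> a" z] a that by simp
  show ?thesis
  proof (intro bexI ballI)
    show "y \<in> eigenspace a"
      using iff[OF y(1)] y(2) by (rule iffD1)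
    show "cinner H x z = cinner H y z" if "z \<in> eigenspace a" for z
      using bspec[OF y(3) eigenspace_closed[OF that]] iff[OF eigenspace_closed[OF that]] that
      by (simp only: simp_thms)
  qed
qed

text \<open>The mean of this function is \<open>\<langle>y, x\<rangle>\<close>, where \<open>y\<close> is the projection of \<open>x\<close> onto the
  eigenspace of \<open>a\<^sup>-\<^sup>1\<close>, and \<open>y = 0\<close> by orthogonality.\<close>

lemma coefficient_mean_null:
  assumes a: "a \<in> carrier A" and x: "x \<in> carrier H"
    and orth: "\<And>z. z \<in> eigenspace (inv\<^bsub>A\<^esub> a) \<Longrightarrow> cinner H x z = 0"
  shows "mean_null (discrete_dual A) (\<lambda>\<gamma>. \<gamma> a * cinner H (U \<gamma> x) x)"
proof -
  interpret T: unitary_action H "discrete_dual A" "\<lambda>\<gamma>. \<lambda>x\<in>carrier H. \<gamma> a \<odot> U \<gamma> x"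
    using a by (rule twisted_action)
  obtain y where y: "y \<in> carrier H"
    "\<forall>\<gamma>\<in>\<Gamma>. (\<lambda>x\<in>carrier H. \<gamma> a \<odot> U \<gamma> x) y = y"
    "\<forall>z\<in>carrier H. (\<forall>\<gamma>\<in>\<Gamma>. (\<lambda>x\<in>carrier H. \<gamma> a \<odot> U \<gamma> x) z = z)
      \<longrightarrow> cinner H x z = cinner H y z"
    "\<forall>w\<in>carrier H. mean_null (discrete_dual A)
      (\<lambda>\<gamma>. cinner H ((\<lambda>x\<in>carrier H. \<gamma> a \<odot> U \<gamma> x) x) w - cinner H y w)"
    using T.ergodic_projection[OF complete x] by (elim bexE conjE) (rule that)
  have "y \<in> eigenspace (inv\<^bsub>A\<^esub> a)"
    using fixed_by_twisted_action_iff[OF a y(1)] y(2) by (rule iffD1)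
  then have "cinner H y y = 0"
    using mp[OF bspec[OF y(3) y(1)] y(2)] orth by simp
  then have "y = \<zero>"
    by (rule inner_self_eq_0[OF y(1)])
  then show ?thesis
    by (intro G.mean_null_cong[OF bspec[OF y(4) x]]) (simp add: inner_simps x)
qed

text \<open>Quantifying over the factor \<open>\<gamma> a\<close> says that all Fourier coefficients of \<open>\<gamma> \<mapsto> p \<gamma> \<langle>U\<^sub>\<gamma> x, x\<rangle>\<close>
  vanish. It makes the set closed under multiplication by characters, hence by trigonometric
  polynomials.\<close>

definition mean_null_weights :: "'v \<Rightarrow> (('a \<Rightarrow> complex) \<Rightarrow> complex) set" where
  "mean_null_weights x = {p. \<forall>a\<in>carrier A.
     mean_null (discrete_dual A) (\<lambda>\<gamma>. \<gamma> a * (p \<gamma> * cinner H (U \<gamma> x) x))}"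

lemma mean_null_weights_cong:
  "\<lbrakk>p \<in> mean_null_weights x; \<And>\<gamma>. \<gamma> \<in> \<Gamma> \<Longrightarrow> p \<gamma> = q \<gamma>\<rbrakk> \<Longrightarrow> q \<in> mean_null_weights x"
  unfolding mean_null_weights_def by (auto elim!: G.mean_null_cong)

lemma mean_null_weights_add:
  assumes "p \<in> mean_null_weights x" "q \<in> mean_null_weights x"
  shows "(\<lambda>\<gamma>. p \<gamma> + q \<gamma>) \<in> mean_null_weights x"
  unfolding mean_null_weights_def
proof (intro CollectI ballI)
  fix a assume "a \<in> carrier A"
  with assms have "mean_null (discrete_dual A) (\<lambda>\<gamma>. \<gamma> a * (p \<gamma> * cinner H (U \<gamma> x) x)
      + \<gamma> a * (q \<gamma> * cinner H (U \<gamma> x) x))"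
    by (intro G.mean_null_add) (auto simp: mean_null_weights_def)
  then show "mean_null (discrete_dual A) (\<lambda>\<gamma>. \<gamma> a * ((p \<gamma> + q \<gamma>) * cinner H (U \<gamma> x) x))"
    by (rule G.mean_null_cong) (simp add: algebra_simps)
qed

lemma mean_null_weights_cmult:
  assumes "p \<in> mean_null_weights x"
  shows "(\<lambda>\<gamma>. c * p \<gamma>) \<in> mean_null_weights x"
  unfolding mean_null_weights_def
proof (intro CollectI ballI)
  fix a assume "a \<in> carrier A"
  with assms have "mean_null (discrete_dual A) (\<lambda>\<gamma>. c * (\<gamma> a * (p \<gamma> * cinner H (U \<gamma> x) x)))"
    by (intro G.mean_null_cmult) (auto simp: mean_null_weights_def)
  then show "mean_null (discrete_dual A) (\<lambda>\<gamma>. \<gamma> a * (c * p \<gamma> * cinner H (U \<gamma> x) x))"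
    by (rule G.mean_null_cong) (simp add: algebra_simps)
qed

lemma mean_null_weights_zero: "(\<lambda>\<gamma>. 0) \<in> mean_null_weights x"
  by (simp add: mean_null_weights_def G.mean_null_zero)

lemma mean_null_weights_sum:
  assumes "\<And>i. i \<in> I \<Longrightarrow> f i \<in> mean_null_weights x"
  shows "(\<lambda>\<gamma>. \<Sum>i\<in>I. f i \<gamma>) \<in> mean_null_weights x"
  using assms
  by (induction I rule: infinite_finite_induct) (simp_all add: mean_null_weights_zero mean_null_weights_add)

lemma mean_null_weights_character_mult:
  assumes "p \<in> mean_null_weights x" and b: "b \<in> carrier A"
  shows "(\<lambda>\<gamma>. \<gamma> b * p \<gamma>) \<in> mean_null_weights x"
  unfolding mean_null_weights_def
proof (intro CollectI ballI)
  fix a assume a: "a \<in> carrier A"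
  with assms have "mean_null (discrete_dual A)
      (\<lambda>\<gamma>. \<gamma> (a \<otimes>\<^bsub>A\<^esub> b) * (p \<gamma> * cinner H (U \<gamma> x) x))"
    by (auto simp: mean_null_weights_def)
  then show "mean_null (discrete_dual A) (\<lambda>\<gamma>. \<gamma> a * (\<gamma> b * p \<gamma> * cinner H (U \<gamma> x) x))"
    by (rule G.mean_null_cong) (use a b in \<open>simp add: character_mult algebra_simps\<close>)
qed

text \<open>On the dual group, a trigonometric polynomial with values between 0 and 1 that is 1 at the
  trivial character. Its powers concentrate on the characters that are close to 1 on \<open>F\<close>.\<close>

definition bump :: "'a set \<Rightarrow> ('a \<Rightarrow> complex) \<Rightarrow> real" where
  "bump F \<gamma> = 1 - (\<Sum>b\<in>F. (cmod (\<gamma> b - 1))\<^sup>2) / (4 * real (card F))"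

text \<open>Since \<open>|\<gamma>(b) - 1|\<^sup>2 = 2 - \<gamma>(b) - \<gamma>(b\<^sup>-\<^sup>1)\<close>, the function \<open>bump F\<close> is a linear combination of
  characters.\<close>

lemma mean_null_weights_bump_mult:
  assumes p: "p \<in> mean_null_weights x" and F: "F \<subseteq> carrier A"
  shows "(\<lambda>\<gamma>. of_real (bump F \<gamma>) * p \<gamma>) \<in> mean_null_weights x"
proof -
  define c :: complex where "c = 1 / of_real (4 * real (card F))"
  have "(\<lambda>\<gamma>. p \<gamma> + (\<Sum>b\<in>F. (- 2 * c) * p \<gamma> + (c * (\<gamma> b * p \<gamma>) + c * (\<gamma> (inv\<^bsub>A\<^esub> b) * p \<gamma>))))
      \<in> mean_null_weights x"
    using F by (intro mean_null_weights_add mean_null_weights_sum mean_null_weights_cmult mean_null_weights_character_mult p)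
      auto
  then show ?thesis
  proof (rule mean_null_weights_cong)
    fix \<gamma> assume \<gamma>: "\<gamma> \<in> \<Gamma>"
    have sq: "(complex_of_real (cmod (\<gamma> b - 1)))\<^sup>2 = 2 - \<gamma> b - \<gamma> (inv\<^bsub>A\<^esub> b)" if "b \<in> F" for b
    proof -
      have b: "b \<in> carrier A"
        using that F by auto
      have "(complex_of_real (cmod (\<gamma> b - 1)))\<^sup>2 = (\<gamma> b - 1) * cnj (\<gamma> b - 1)"
        using complex_norm_square[of "\<gamma> b - 1"] by simp
      also have "\<dots> = cnj (\<gamma> b) * \<gamma> b + 1 - \<gamma> b - cnj (\<gamma> b)"
        by (simp add: algebra_simps)
      finally show ?thesis
        using cnj_mult_self_if_norm_1[OF character_norm[OF \<gamma> b]] character_inv[OF \<gamma> b] by simp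
    qed
    define s where "s = (\<Sum>b\<in>F. 2 - \<gamma> b - \<gamma> (inv\<^bsub>A\<^esub> b))"
    have "complex_of_real (bump F \<gamma>) = 1 - c * s"
      by (simp add: bump_def c_def s_def sq)
    moreover have "(\<Sum>b\<in>F. (- 2 * c) * p \<gamma> + (c * (\<gamma> b * p \<gamma>) + c * (\<gamma> (inv\<^bsub>A\<^esub> b) * p \<gamma>)))
        = s * (- c * p \<gamma>)"
      unfolding s_def sum_distrib_right by (intro sum.cong) (auto simp: algebra_simps)
    ultimately show "p \<gamma> + (\<Sum>b\<in>F. (- 2 * c) * p \<gamma> + (c * (\<gamma> b * p \<gamma>) + c * (\<gamma> (inv\<^bsub>A\<^esub> b) * p \<gamma>)))
        = of_real (bump F \<gamma>) * p \<gamma>"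
      by (simp only:) (simp add: algebra_simps)
  qed
qed

lemma mean_null_weights_bump_power:
  assumes x: "x \<in> carrier H" and F: "F \<subseteq> carrier A"
    and orth: "\<And>a z. \<lbrakk>a \<in> carrier A; z \<in> eigenspace a\<rbrakk> \<Longrightarrow> cinner H x z = 0"
  shows "(\<lambda>\<gamma>. of_real (bump F \<gamma> ^ n)) \<in> mean_null_weights x"
proof (induction n)
  case 0
  show ?case
    unfolding mean_null_weights_def
  proof (intro CollectI ballI)
    fix a assume a: "a \<in> carrier A"
    have "mean_null (discrete_dual A) (\<lambda>\<gamma>. \<gamma> a * cinner H (U \<gamma> x) x)"
      by (rule coefficient_mean_null[OF a x]) (rule orth[OF A.inv_closed[OF a]])
    then show "mean_null (discrete_dual A)
        (\<lambda>\<gamma>. \<gamma> a * (of_real (bump F \<gamma> ^ 0) * cinner H (U \<gamma> x) x))"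
      by simp
  qed
next
  case (Suc n)
  then show ?case
    using mean_null_weights_bump_mult[OF Suc F] by simp
qed

lemma bump_nonneg:
  assumes "\<gamma> \<in> \<Gamma>" "F \<subseteq> carrier A"
  shows "0 \<le> bump F \<gamma>"
proof -
  have "(cmod (\<gamma> b - 1))\<^sup>2 \<le> 2\<^sup>2" if "b \<in> F" for b
    using norm_triangle_ineq4[of "\<gamma> b" 1] character_norm[of \<gamma> b] assms that
    by (intro power_mono) auto
  then have "(\<Sum>b\<in>F. (cmod (\<gamma> b - 1))\<^sup>2) \<le> (\<Sum>b\<in>F. 4)"
    by (intro sum_mono) simp
  then show ?thesis
    by (cases "card F = 0") (auto simp: bump_def field_simps)
qed

lemma bump_le_far:
  assumes "finite F" "b \<in> F" "e \<le> cmod (\<gamma> b - 1)" "0 \<le> e"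
  shows "bump F \<gamma> \<le> 1 - e\<^sup>2 / (4 * real (card F))"
proof -
  have "e\<^sup>2 \<le> (cmod (\<gamma> b - 1))\<^sup>2"
    using assms by (intro power_mono) auto
  also have "\<dots> \<le> (\<Sum>b\<in>F. (cmod (\<gamma> b - 1))\<^sup>2)"
    using assms by (intro member_le_sum) auto
  finally show ?thesis
    by (simp add: bump_def divide_right_mono)
qed

lemma bump_ge_near:
  assumes "\<And>b. b \<in> F \<Longrightarrow> cmod (\<gamma> b - 1) \<le> d"
  shows "1 - d\<^sup>2 / 4 \<le> bump F \<gamma>"
proof (cases "card F = 0")
  case False
  have "(\<Sum>b\<in>F. (cmod (\<gamma> b - 1))\<^sup>2) \<le> (\<Sum>b\<in>F. d\<^sup>2)"
    using assms by (intro sum_mono power_mono) auto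
  then have "(\<Sum>b\<in>F. (cmod (\<gamma> b - 1))\<^sup>2) / (4 * real (card F)) \<le> (real (card F) * d\<^sup>2) / (4 * real (card F))"
    by (intro divide_right_mono) auto
  with False show ?thesis
    by (simp add: bump_def)
qed (simp add: bump_def)

text \<open>Suppose \<open>x \<noteq> 0\<close>, put \<open>\<phi>(\<gamma>) = \<langle>U\<^sub>\<gamma> x, x\<rangle>\<close> and \<open>g = bump F\<^sup>n \<phi>\<close>, and choose \<open>F\<close> and \<open>e\<close> such that
  \<open>Re \<phi> \<ge> \<parallel>x\<parallel>\<^sup>2/2\<close> holds at the characters within \<open>e\<close> of 1 on \<open>F\<close>. So \<open>Re \<phi>\<close> can be negative only
  where \<open>bump F \<le> q\<close>, whence \<open>Re g \<ge> - q\<^sup>n \<parallel>x\<parallel>\<^sup>2\<close> everywhere. On a smaller neighbourhood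
  \<open>bump F \<ge> q'\<close> with \<open>q' > q\<close>, so \<open>Re g \<ge> q'\<^sup>n \<parallel>x\<parallel>\<^sup>2/2\<close> there. Finitely many translates of that smaller
  neighbourhood cover the dual group. Let \<open>h\<close> be the sum of the corresponding translates of \<open>g\<close>. At each
  point one summand is large and the others are not very negative, and for large \<open>n\<close> the former
  prevails, because the number of translates does not depend on \<open>n\<close>. So \<open>Re h\<close> is bounded below by
  a positive constant \<open>c\<close>, and so is the real part of every average of \<open>h\<close>. But \<open>g\<close> has averages
  that are small on all translates.\<close>

theorem eigenspaces_total:
  assumes x: "x \<in> carrier H"
    and orth: "\<And>a z. \<lbrakk>a \<in> carrier A; z \<in> eigenspace a\<rbrakk> \<Longrightarrow> cinner H x z = 0"
  shows "x = \<zero>"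
proof (rule ccontr)
  assume "x \<noteq> \<zero>"
  define r where "r = hnorm H x"
  have r: "r > 0"
    using \<open>x \<noteq> \<zero>\<close> x hnorm_eq_0_iff[OF x] hnorm_nonneg[OF x] unfolding r_def by linarith
  define \<phi> where "\<phi> = (\<lambda>\<gamma>. cinner H (U \<gamma> x) x)"
  have \<phi>_bound: "\<bar>Re (\<phi> \<gamma>)\<bar> \<le> r\<^sup>2" if "\<gamma> \<in> \<Gamma>" for \<gamma>
    using Cauchy_Schwarz[of "U \<gamma> x" x] act_hnorm[of \<gamma> x] that x abs_Re_le_cmod[of "\<phi> \<gamma>"]
    by (simp add: \<phi>_def r_def power2_eq_square)
  obtain W where W: "openin (discrete_dual_topology A) W" "\<one>\<^bsub>discrete_dual A\<^esub> \<in> W"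
    "\<forall>\<gamma>\<in>W. hnorm H (U \<gamma> x \<ominus> U \<one>\<^bsub>discrete_dual A\<^esub> x) < r / 2"
  proof -
    have "\<one>\<^bsub>discrete_dual A\<^esub> \<in> topspace (discrete_dual_topology A)" "r / 2 > 0"
      using r by simp_all
    then have "\<exists>W. openin (discrete_dual_topology A) W \<and> \<one>\<^bsub>discrete_dual A\<^esub> \<in> W \<and>
        (\<forall>\<gamma>\<in>W. hnorm H (U \<gamma> x \<ominus> U \<one>\<^bsub>discrete_dual A\<^esub> x) < r / 2)"
      using strongly_continuous[OF x] unfolding continuous_map_norm_topology_iff by blast
    then show thesis
      by (elim exE conjE) (rule that)
  qed
  obtain F\<^sub>0 e\<^sub>0 where F\<^sub>0: "finite F\<^sub>0" "F\<^sub>0 \<subseteq> carrier A" "e\<^sub>0 > 0"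
    "{\<gamma> \<in> \<Gamma>. \<forall>a\<in>F\<^sub>0. cmod (\<gamma> a - \<one>\<^bsub>discrete_dual A\<^esub> a) < e\<^sub>0} \<subseteq> W"
    by (rule discrete_dual_nhd_box[OF W(1,2)])
  \<comment> \<open>adjoining the unit makes \<open>F\<close> nonempty, so that dividing by \<open>card F\<close> is meaningful\<close>
  define F where "F = insert \<one>\<^bsub>A\<^esub> F\<^sub>0"
  define e where "e = min e\<^sub>0 1"
  have F: "finite F" "F \<subseteq> carrier A" "card F > 0"
    using F\<^sub>0 by (auto simp: F_def card_gt_0_iff)
  have e: "e > 0" "e \<le> 1"
    using F\<^sub>0 by (auto simp: e_def)
  have near: "r\<^sup>2 / 2 \<le> Re (\<phi> \<gamma>)" if \<gamma>: "\<gamma> \<in> \<Gamma>" and close: "\<And>b. b \<in> F \<Longrightarrow> cmod (\<gamma> b - 1) < e" for \<gamma>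
  proof -
    have "\<gamma> \<in> W"
      using \<gamma> close F\<^sub>0(2) by (intro subsetD[OF F\<^sub>0(4)]) (auto simp: discrete_dual_one F_def e_def)
    then have "hnorm H (U \<gamma> x \<ominus> x) < r / 2"
      using W(3) x by (simp add: act_one)
    then have "hnorm H (U \<gamma> x \<ominus> x) * r \<le> r / 2 * r"
      using r by (intro mult_right_mono) auto
    then have "cmod (cinner H (U \<gamma> x \<ominus> x) x) \<le> r / 2 * r"
      using Cauchy_Schwarz[of "U \<gamma> x \<ominus> x" x] \<gamma> x by (simp add: r_def)
    then have "- (r / 2 * r) \<le> Re (cinner H (U \<gamma> x \<ominus> x) x)"
      using abs_Re_le_cmod[of "cinner H (U \<gamma> x \<ominus> x) x"] by linarith
    then show ?thesis
      using \<gamma> x inner_self_real[OF x] by (simp add: inner_simps \<phi>_def r_def power2_eq_square)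
  qed
  \<comment> \<open>\<open>q\<close> bounds \<open>bump F\<close> where \<open>|\<gamma> b - 1| \<ge> e\<close> for some \<open>b \<in> F\<close>; \<open>q'\<close> lies halfway between \<open>q\<close> and 1\<close>
  define q where "q = 1 - e\<^sup>2 / (4 * real (card F))"
  define q' where "q' = 1 - e\<^sup>2 / (8 * real (card F))"
  have "e\<^sup>2 \<le> 1" "e\<^sup>2 > 0"
    using e by (auto simp: power_le_one)
  moreover have "real (card F) \<ge> 1"
    using F(3) by simp
  ultimately have q: "0 < q" "q < q'"
    by (auto simp: q_def q'_def divide_simps)
  have far: "bump F \<gamma> \<le> q" if \<gamma>: "\<gamma> \<in> \<Gamma>" and "Re (\<phi> \<gamma>) < 0" for \<gamma>
  proof -
    have "\<not> (\<forall>b\<in>F. cmod (\<gamma> b - 1) < e)"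
    proof
      assume "\<forall>b\<in>F. cmod (\<gamma> b - 1) < e"
      then have "r\<^sup>2 / 2 \<le> Re (\<phi> \<gamma>)"
        by (intro near[OF \<gamma>]) simp
      with that show False
        using zero_le_power2[of r] by linarith
    qed
    then obtain b where "b \<in> F" "e \<le> cmod (\<gamma> b - 1)"
      by (auto simp: not_less)
    then show ?thesis
      using bump_le_far[OF F(1)] e by (simp add: q_def)
  qed
  \<comment> \<open>the largest radius for which \<open>bump_ge_near\<close> gives the bound \<open>q'\<close>\<close>
  define d where "d = e / sqrt (2 * real (card F))"
  have d: "d > 0" "d\<^sup>2 = e\<^sup>2 / (2 * real (card F))"
    using e F(3) by (auto simp: d_def power_divide)
  have "d\<^sup>2 < e\<^sup>2"
    using \<open>e\<^sup>2 > 0\<close> \<open>real (card F) \<ge> 1\<close> unfolding d(2) by (simp add: divide_simps)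
  then have "d < e"
    using e(1) by (simp add: power_less_imp_less_base)
  have bump_near: "q' \<le> bump F \<gamma>" if "\<And>b. b \<in> F \<Longrightarrow> cmod (\<gamma> b - 1) \<le> d" for \<gamma>
    using bump_ge_near[OF that] by (simp add: d(2) q'_def)
  obtain E where E: "finite E" "E \<subseteq> \<Gamma>"
    "\<forall>\<gamma>\<in>\<Gamma>. \<exists>\<eta>\<in>E. \<forall>b\<in>F. cmod (\<gamma> b - \<eta> b) < d"
  proof -
    have "cmod (\<gamma> b) \<le> 1" if "\<gamma> \<in> \<Gamma>" "b \<in> F" for \<gamma> b
      using character_norm[OF that(1)] F(2) that(2) by auto
    then show thesis
      using finite_net_of_bounded_functions[OF F(1) _ d(1), of \<Gamma> 1] that by blast
  qed
  define N where "N = real (card E)"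
  have "N > 0"
    using E(1) bspec[OF E(3) G.one_closed] by (auto simp: N_def card_gt_0_iff)
  obtain n where n: "(q / q') ^ n < 1 / (2 * N)"
    using real_arch_pow_inv[of "1 / (2 * N)" "q / q'"] q \<open>N > 0\<close> by auto
  \<comment> \<open>one summand of \<open>h\<close> below is at least \<open>q'\<^sup>n r\<^sup>2/2\<close>, the others at least \<open>- q\<^sup>n r\<^sup>2\<close>\<close>
  define c where "c = q' ^ n * (r\<^sup>2 / 2) - N * (q ^ n * r\<^sup>2)"
  have "N * q ^ n < q' ^ n / 2"
    using n q \<open>N > 0\<close> by (simp add: power_divide field_simps)
  then have "N * q ^ n * r\<^sup>2 < q' ^ n / 2 * r\<^sup>2"
    using r by simp
  then have c: "c > 0"
    by (simp add: c_def mult_ac)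
  define g where "g = (\<lambda>\<gamma>. complex_of_real (bump F \<gamma> ^ n) * \<phi> \<gamma>)"
  have "(\<lambda>\<gamma>. of_real (bump F \<gamma> ^ n)) \<in> mean_null_weights x"
    by (rule mean_null_weights_bump_power[OF x F(2)]) (rule orth)
  then have "mean_null (discrete_dual A)
      (\<lambda>\<gamma>. \<gamma> \<one>\<^bsub>A\<^esub> * (of_real (bump F \<gamma> ^ n) * cinner H (U \<gamma> x) x))"
    by (simp add: mean_null_weights_def)
  then have g: "mean_null (discrete_dual A) g"
    by (rule G.mean_null_cong) (simp add: g_def \<phi>_def discrete_dual_at_one[OF A.group_axioms])
  have "c / (2 * N) > 0"
    using c \<open>N > 0\<close> by simp
  from mean_nullD[OF g this] obtain M where M: "M \<in> averages \<Gamma>"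
    "\<forall>\<eta>\<in>\<Gamma>. cmod (M (\<lambda>\<gamma>. g (\<eta> \<otimes>\<^bsub>discrete_dual A\<^esub> \<gamma>))) \<le> c / (2 * N)"
    by (rule bexE)
  define h where "h = (\<lambda>\<gamma>. \<Sum>\<eta>\<in>E. g (inv\<^bsub>discrete_dual A\<^esub> \<eta> \<otimes>\<^bsub>discrete_dual A\<^esub> \<gamma>))"
  have g_lower: "- (q ^ n * r\<^sup>2) \<le> Re (g \<gamma>)" if \<gamma>: "\<gamma> \<in> \<Gamma>" for \<gamma>
  proof (cases "Re (\<phi> \<gamma>) < 0")
    case True
    have "bump F \<gamma> ^ n * (- Re (\<phi> \<gamma>)) \<le> q ^ n * r\<^sup>2"
      using far[OF \<gamma> True] bump_nonneg[OF \<gamma> F(2)] \<phi>_bound[OF \<gamma>] True q(1)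
      by (intro mult_mono power_mono) auto
    then show ?thesis
      by (simp add: g_def)
  next
    case False
    then have "0 \<le> Re (g \<gamma>)"
      using bump_nonneg[OF \<gamma> F(2)] by (simp add: g_def)
    moreover have "0 \<le> q ^ n * r\<^sup>2"
      using q(1) by simp
    ultimately show ?thesis
      by linarith
  qed
  have "c \<le> Re (h \<gamma>)" if \<gamma>: "\<gamma> \<in> \<Gamma>" for \<gamma>
  proof -
    obtain \<eta> where \<eta>: "\<eta> \<in> E" "\<forall>b\<in>F. cmod (\<gamma> b - \<eta> b) < d"
      using bspec[OF E(3) \<gamma>] by blast
    then have \<eta>_dual: "\<eta> \<in> \<Gamma>"
      using E(2) by blast
    define \<theta> where "\<theta> = inv\<^bsub>discrete_dual A\<^esub> \<eta> \<otimes>\<^bsub>discrete_dual A\<^esub> \<gamma>"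
    have \<theta>: "\<theta> \<in> \<Gamma>"
      using \<gamma> \<eta>_dual by (simp add: \<theta>_def)
    have \<theta>_near: "cmod (\<theta> b - 1) < d" if b: "b \<in> F" for b
    proof -
      have bA: "b \<in> carrier A"
        using b F(2) by blast
      have "\<theta> b - 1 = cnj (\<eta> b) * \<gamma> b - cnj (\<eta> b) * \<eta> b"
        using bA \<eta>_dual
        by (simp add: \<theta>_def discrete_dual_mult discrete_dual_inv[OF A.group_axioms]
            cnj_mult_self_if_norm_1 character_norm)
      also have "\<dots> = cnj (\<eta> b) * (\<gamma> b - \<eta> b)"
        by (simp add: algebra_simps)
      finally show ?thesis
        using \<eta>(2) b character_norm[OF \<eta>_dual bA] by (simp add: norm_mult)
    qed
    have "q' ^ n * (r\<^sup>2 / 2) \<le> bump F \<theta> ^ n * Re (\<phi> \<theta>)"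
    proof (intro mult_mono power_mono)
      show "q' \<le> bump F \<theta>"
        using \<theta>_near by (intro bump_near less_imp_le)
      show "r\<^sup>2 / 2 \<le> Re (\<phi> \<theta>)"
        using \<theta>_near \<open>d < e\<close> by (intro near[OF \<theta>]) (meson less_trans)
    qed (use q bump_nonneg[OF \<theta> F(2)] in auto)
    then have main: "q' ^ n * (r\<^sup>2 / 2) \<le> Re (g (inv\<^bsub>discrete_dual A\<^esub> \<eta> \<otimes>\<^bsub>discrete_dual A\<^esub> \<gamma>))"
      by (simp add: g_def \<theta>_def)
    have "(\<Sum>\<xi>\<in>E - {\<eta>}. - (q ^ n * r\<^sup>2))
        \<le> (\<Sum>\<xi>\<in>E - {\<eta>}. Re (g (inv\<^bsub>discrete_dual A\<^esub> \<xi> \<otimes>\<^bsub>discrete_dual A\<^esub> \<gamma>)))"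
      using E(2) \<gamma> by (intro sum_mono g_lower) auto
    moreover have "(\<Sum>\<xi>\<in>E - {\<eta>}. - (q ^ n * r\<^sup>2)) \<ge> - (N * (q ^ n * r\<^sup>2))"
    proof -
      have "real (card (E - {\<eta>})) * (q ^ n * r\<^sup>2) \<le> N * (q ^ n * r\<^sup>2)"
        unfolding N_def using E(1) q(1) by (intro mult_right_mono) (auto intro: card_mono)
      then show ?thesis
        by simp
    qed
    moreover have "Re (h \<gamma>) = Re (g (inv\<^bsub>discrete_dual A\<^esub> \<eta> \<otimes>\<^bsub>discrete_dual A\<^esub> \<gamma>))
        + (\<Sum>\<xi>\<in>E - {\<eta>}. Re (g (inv\<^bsub>discrete_dual A\<^esub> \<xi> \<otimes>\<^bsub>discrete_dual A\<^esub> \<gamma>)))"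
      by (simp add: h_def sum.remove[OF E(1) \<eta>(1)])
    ultimately show ?thesis
      using main by (simp add: c_def)
  qed
  then have "c \<le> Re (M h)"
    by (rule average_Re_ge[OF M(1)])
  also have "\<dots> \<le> cmod (M h)"
    by (rule complex_Re_le_cmod)
  also have "M h = (\<Sum>\<eta>\<in>E. M (\<lambda>\<gamma>. g (inv\<^bsub>discrete_dual A\<^esub> \<eta> \<otimes>\<^bsub>discrete_dual A\<^esub> \<gamma>)))"
    unfolding h_def by (rule average_sum[OF M(1)])
  also have "cmod \<dots> \<le> (\<Sum>\<eta>\<in>E. c / (2 * N))"
    using E(2) by (intro sum_norm_le bspec[OF M(2)]) auto
  also have "\<dots> = c / 2"
    using \<open>N > 0\<close> by (simp add: N_def)
  finally show False
    using c by simp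
qed

end


section \<open>Complete orthogonal decompositions\<close>

lemma small_tail:
  fixes g :: "'i \<Rightarrow> real"
  assumes "g summable_on I" "\<And>i. i \<in> I \<Longrightarrow> 0 \<le> g i" "e > 0"
  shows "\<exists>F. finite F \<and> F \<subseteq> I \<and> (\<forall>F'. finite F' \<and> F' \<subseteq> I \<and> F' \<inter> F = {} \<longrightarrow> sum g F' < e)"
proof -
  obtain F where F: "finite F" "F \<subseteq> I" "dist (sum g F) (infsum g I) \<le> e / 2"
    using infsum_finite_approximation[OF assms(1), of "e / 2"] assms(3) by auto
  have "sum g F' < e" if F': "finite F'" "F' \<subseteq> I" "F' \<inter> F = {}" for F'
  proof -
    have "sum g F' + sum g F = sum g (F' \<union> F)"
      using F F' by (simp add: sum.union_disjoint)
    also have "\<dots> \<le> infsum g I"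
      using F F' assms by (intro finite_sum_le_infsum) auto
    finally show ?thesis
      using F(3) assms(3) unfolding dist_real_def by linarith
  qed
  with F show ?thesis
    by (intro exI[of _ F]) auto
qed

locale orthogonal_decomposition = complex_inner_space H
  for H :: "('v, 'm) hilbert_scheme" (structure) +
  fixes I :: "'i set" and E :: "'i \<Rightarrow> 'v set"
  assumes complete: "Metric_space.mcomplete (carrier H) (hdist H)"
    and component_subset: "i \<in> I \<Longrightarrow> E i \<subseteq> carrier H"
    and orthogonal: "\<lbrakk>i \<in> I; j \<in> I; i \<noteq> j; x \<in> E i; y \<in> E j\<rbrakk> \<Longrightarrow> cinner H x y = 0"
    and projection: "\<lbrakk>i \<in> I; x \<in> carrier H\<rbrakk> \<Longrightarrow> \<exists>y\<in>E i. \<forall>z\<in>E i. cinner H x z = cinner H y z"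
    and total: "\<lbrakk>x \<in> carrier H; \<And>i z. \<lbrakk>i \<in> I; z \<in> E i\<rbrakk> \<Longrightarrow> cinner H x z = 0\<rbrakk> \<Longrightarrow> x = \<zero>"
begin

definition proj :: "'i \<Rightarrow> 'v \<Rightarrow> 'v" where
  "proj i x = (SOME y. y \<in> E i \<and> (\<forall>z\<in>E i. cinner H x z = cinner H y z))"

lemma component_closed: "i \<in> I \<Longrightarrow> x \<in> E i \<Longrightarrow> x \<in> carrier H"
  using component_subset by blast

lemma proj_in: "i \<in> I \<Longrightarrow> x \<in> carrier H \<Longrightarrow> proj i x \<in> E i"
  and inner_proj: "\<lbrakk>i \<in> I; x \<in> carrier H; z \<in> E i\<rbrakk> \<Longrightarrow> cinner H x z = cinner H (proj i x) z"
  using someI_ex[of "\<lambda>y. y \<in> E i \<and> (\<forall>z\<in>E i. cinner H x z = cinner H y z)"] projection[of i x]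
  unfolding proj_def by blast+

lemma proj_closed [simp]: "i \<in> I \<Longrightarrow> x \<in> carrier H \<Longrightarrow> proj i x \<in> carrier H"
  using component_closed proj_in by blast

text \<open>The projection is unique: if two vectors of \<open>E i\<close> have the same inner product with each of
  these two vectors, then their difference has norm zero.\<close>

lemma proj_eqI:
  assumes "i \<in> I" "x \<in> carrier H" "y \<in> E i" "\<And>z. z \<in> E i \<Longrightarrow> cinner H x z = cinner H y z"
  shows "proj i x = y"
proof -
  define p where "p = proj i x"
  have p: "p \<in> E i" "p \<in> carrier H" "y \<in> carrier H"
    using assms proj_in component_closed by (auto simp: p_def)
  have "cinner H p z = cinner H y z" if "z \<in> E i" for z
    using inner_proj[OF assms(1,2) that] assms(4)[OF that] by (simp add: p_def)
  from this[OF p(1)] this[OF assms(3)] have "cinner H (p \<ominus> y) (p \<ominus> y) = 0"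
    using p by (simp add: inner_minus_left inner_minus_right)
  then show ?thesis
    using inner_self_eq_0[of "p \<ominus> y"] p minus_eq_zero_iff[of p y] by (simp add: p_def)
qed

lemma inner_partial_sums:
  assumes f: "\<And>i. i \<in> I \<Longrightarrow> f i \<in> E i"
    and "finite F" "F \<subseteq> I" "finite F'" "F' \<subseteq> I"
  shows "cinner H (finsum H f F) (finsum H f F') = of_real (\<Sum>i\<in>F \<inter> F'. (hnorm H (f i))\<^sup>2)"
proof -
  have closed: "f i \<in> carrier H" if "i \<in> I" for i
    using f component_closed that by blast
  then have f': "f \<in> F \<rightarrow> carrier H" "f \<in> F' \<rightarrow> carrier H"
    using assms by auto
  then have S: "finsum H f F' \<in> carrier H"
    by simp
  have "cinner H (f i) (finsum H f F') = (if i \<in> F' then of_real ((hnorm H (f i))\<^sup>2) else 0)"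
    if i: "i \<in> F" for i
  proof -
    have fi: "f i \<in> carrier H" "i \<in> I"
      using closed i assms by auto
    have "cinner H (f i) (finsum H f F') = cnj (\<Sum>j\<in>F'. cinner H (f j) (f i))"
      using inner_commute[OF S fi(1)] inner_finsum_left[OF assms(4) f'(2) fi(1)] by simp
    also have "(\<Sum>j\<in>F'. cinner H (f j) (f i)) = (\<Sum>j\<in>F'. if j = i then cinner H (f i) (f i) else 0)"
    proof (intro sum.cong refl)
      fix j assume "j \<in> F'"
      then have "j \<in> I"
        using assms(5) by blast
      then show "cinner H (f j) (f i) = (if j = i then cinner H (f i) (f i) else 0)"
        using orthogonal[OF _ fi(2) _ f f[OF fi(2)]] by simp
    qed
    also have "\<dots> = (if i \<in> F' then of_real ((hnorm H (f i))\<^sup>2) else 0)"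
      using assms(4) by (simp add: inner_self_real[OF fi(1)])
    finally show ?thesis
      by simp
  qed
  then have "cinner H (finsum H f F) (finsum H f F')
      = (\<Sum>i\<in>F. if i \<in> F' then of_real ((hnorm H (f i))\<^sup>2) else 0)"
    using inner_finsum_left[OF assms(2) f'(1) S] by simp
  also have "\<dots> = (\<Sum>i\<in>F \<inter> F'. of_real ((hnorm H (f i))\<^sup>2))"
    using assms(2) by (simp add: sum.If_cases Int_def)
  finally show ?thesis
    by simp
qed

lemma hnorm_sq_partial_sum_diff:
  assumes f: "\<And>i. i \<in> I \<Longrightarrow> f i \<in> E i"
    and F: "finite F" "F \<subseteq> I" and F': "finite F'" "F' \<subseteq> I"
  shows "(hnorm H (finsum H f F \<ominus> finsum H f F'))\<^sup>2
    = (\<Sum>i\<in>F - F'. (hnorm H (f i))\<^sup>2) + (\<Sum>i\<in>F' - F. (hnorm H (f i))\<^sup>2)"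
proof -
  have "f \<in> F \<rightarrow> carrier H" "f \<in> F' \<rightarrow> carrier H"
    using f F(2) F'(2) component_closed by blast+
  then have closed: "finsum H f F \<in> carrier H" "finsum H f F' \<in> carrier H"
    by simp_all
  show ?thesis
    unfolding hnorm_sq_minus[OF closed]
    using closed sum.Int_Diff[OF F(1), of "\<lambda>i. (hnorm H (f i))\<^sup>2" F']
      sum.Int_Diff[OF F'(1), of "\<lambda>i. (hnorm H (f i))\<^sup>2" F]
    by (simp add: hnorm_sq[OF closed(1)] hnorm_sq[OF closed(2)] inner_partial_sums[OF f F F]
        inner_partial_sums[OF f F F'] inner_partial_sums[OF f F' F'] Int_commute[of F' F])
qed

text \<open>Choose finite sets \<open>F n\<close> outside of which every finite sum of squared norms is less than
  \<open>1/(n+1)\<close>. Two partial sums differ by the terms in the symmetric difference of their index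
  sets, whose squared norms add up to at most \<open>1/(m+1) + 1/(n+1)\<close>. So
  the partial sums form a Cauchy sequence.\<close>

theorem synthesis:
  assumes f: "\<And>i. i \<in> I \<Longrightarrow> f i \<in> E i"
    and summable: "(\<lambda>i. (hnorm H (f i))\<^sup>2) summable_on I"
  obtains y where "y \<in> carrier H" "\<And>i. i \<in> I \<Longrightarrow> proj i y = f i"
    "\<And>e. e > 0 \<Longrightarrow> \<exists>F. finite F \<and> F \<subseteq> I \<and> hnorm H (finsum H f F \<ominus> y) < e"
proof -
  define g where "g = (\<lambda>i. (hnorm H (f i))\<^sup>2)"
  have "\<exists>F. finite F \<and> F \<subseteq> I \<and>
      (\<forall>F'. finite F' \<and> F' \<subseteq> I \<and> F' \<inter> F = {} \<longrightarrow> sum g F' < 1 / real (Suc n))" for n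
    using summable by (intro small_tail) (auto simp: g_def)
  then obtain F where F: "\<And>n. finite (F n)" "\<And>n. F n \<subseteq> I"
    "\<And>n F'. finite F' \<and> F' \<subseteq> I \<and> F' \<inter> F n = {} \<Longrightarrow> sum g F' < 1 / real (Suc n)"
    by metis
  define s where "s = (\<lambda>n. finsum H f (F n))"
  have fI: "f i \<in> carrier H" if "i \<in> I" for i
    using f component_closed that by blast
  then have "f \<in> F n \<rightarrow> carrier H" for n
    using F(2) by blast
  then have s_closed: "s n \<in> carrier H" for n
    by (simp add: s_def)
  have inverse_small: "\<exists>N. \<forall>n\<ge>N. 1 / real (Suc n) < r" if "r > 0" for r :: real
    using LIMSEQ_D[OF LIMSEQ_inverse_real_of_nat that] by (simp add: inverse_eq_divide)
  have "\<exists>N. \<forall>m\<ge>N. \<forall>n\<ge>N. hnorm H (s m \<ominus> s n) < e" if e: "e > 0" for e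
  proof -
    obtain N where N: "\<And>n. n \<ge> N \<Longrightarrow> 1 / real (Suc n) < e\<^sup>2 / 2"
      using inverse_small[of "e\<^sup>2 / 2"] e by auto
    have "hnorm H (s m \<ominus> s n) < e" if "m \<ge> N" "n \<ge> N" for m n
    proof (rule power2_less_imp_less)
      have "(hnorm H (s m \<ominus> s n))\<^sup>2 = sum g (F m - F n) + sum g (F n - F m)"
        unfolding s_def g_def by (rule hnorm_sq_partial_sum_diff) (use f F in auto)
      also have "\<dots> < 1 / real (Suc n) + 1 / real (Suc m)"
        using F(1,2) by (intro add_strict_mono F(3)) auto
      also have "\<dots> < e\<^sup>2"
        using N[OF that(1)] N[OF that(2)] by simp
      finally show "(hnorm H (s m \<ominus> s n))\<^sup>2 < e\<^sup>2" .
    qed (use e in simp)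
    then show ?thesis by blast
  qed
  moreover have "range s \<subseteq> carrier H"
    using s_closed by auto
  ultimately obtain y where y: "y \<in> carrier H" "(\<lambda>n. hnorm H (s n \<ominus> y)) \<longlonglongrightarrow> 0"
    using complete unfolding mcomplete_iff by meson
  have proj: "proj i y = f i" if i: "i \<in> I" for i
  proof (rule proj_eqI[OF i y(1) f[OF i]])
    fix z assume z: "z \<in> E i"
    then have z': "z \<in> carrier H"
      using component_closed[OF i] by blast
    have bound: "cmod (cinner H (s n) z - cinner H (f i) z) \<le> sqrt (1 / real (Suc n)) * hnorm H z" for n
    proof -
      have "cinner H (s n) z = (\<Sum>j\<in>F n. cinner H (f j) z)"
        unfolding s_def using F(1,2) fI z' by (intro inner_finsum_left) auto
      also have "\<dots> = (\<Sum>j\<in>F n. if j = i then cinner H (f i) z else 0)"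
      proof (intro sum.cong refl)
        fix j assume "j \<in> F n"
        then have "j \<in> I"
          using F(2) by blast
        then show "cinner H (f j) z = (if j = i then cinner H (f i) z else 0)"
          using orthogonal[OF _ i _ f z] by simp
      qed
      also have "\<dots> = (if i \<in> F n then cinner H (f i) z else 0)"
        using F(1) by simp
      finally have inner: "cinner H (s n) z = (if i \<in> F n then cinner H (f i) z else 0)" .
      show ?thesis
      proof (cases "i \<in> F n")
        case False
        then have "(hnorm H (f i))\<^sup>2 < 1 / real (Suc n)"
          using F(3)[of "{i}" n] i by (simp add: g_def)
        then have "hnorm H (f i) \<le> sqrt (1 / real (Suc n))"
          by (intro real_le_rsqrt) simp
        then have "hnorm H (f i) * hnorm H z \<le> sqrt (1 / real (Suc n)) * hnorm H z"
          using z' by (intro mult_right_mono) auto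
        then show ?thesis
          using False Cauchy_Schwarz[OF fI[OF i] z'] by (simp add: inner)
      qed (use z' in \<open>simp add: inner\<close>)
    qed
    have "(\<lambda>n. sqrt (1 / real (Suc n)) * hnorm H z) \<longlonglongrightarrow> sqrt 0 * hnorm H z"
      using LIMSEQ_inverse_real_of_nat by (intro tendsto_intros) (simp add: inverse_eq_divide)
    then have lim: "(\<lambda>n. sqrt (1 / real (Suc n)) * hnorm H z) \<longlonglongrightarrow> 0"
      by simp
    have "(\<lambda>n. cinner H (s n) z - cinner H (f i) z) \<longlonglongrightarrow> 0"
      by (rule Lim_null_comparison[OF _ lim]) (use bound in simp)
    then have "(\<lambda>n. cinner H (s n) z) \<longlonglongrightarrow> cinner H (f i) z"
      by (rule LIM_zero_cancel)
    then show "cinner H y z = cinner H (f i) z"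
      using inner_tendsto[OF s_closed y(1) z' y(2)] LIMSEQ_unique by blast
  qed
  have approx: "\<exists>F. finite F \<and> F \<subseteq> I \<and> hnorm H (finsum H f F \<ominus> y) < e" if e: "e > 0" for e
  proof -
    obtain n where "hnorm H (s n \<ominus> y) < e"
      using LIMSEQ_D[OF y(2) e] y s_closed by fastforce
    then show ?thesis
      using F(1,2) unfolding s_def by blast
  qed
  show thesis
    using that[OF y(1) proj] approx by simp
qed

lemma inner_proj_right:
  assumes "i \<in> I" "x \<in> carrier H" "z \<in> E i"
  shows "cinner H z x = cinner H z (proj i x)"
  using inner_proj[OF assms] inner_commute[of x z] inner_commute[of "proj i x" z]
    component_closed[OF assms(1,3)] assms by simp

lemma hnorm_sq_minus_partial_sum:
  assumes x: "x \<in> carrier H" and F: "finite F" "F \<subseteq> I"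
  shows "(hnorm H (finsum H (\<lambda>i. proj i x) F \<ominus> x))\<^sup>2
    = (hnorm H x)\<^sup>2 - (\<Sum>i\<in>F. (hnorm H (proj i x))\<^sup>2)"
proof -
  have p: "(\<lambda>i. proj i x) \<in> F \<rightarrow> carrier H"
    using F x by auto
  then have closed: "finsum H (\<lambda>i. proj i x) F \<in> carrier H"
    by simp
  have "cinner H (finsum H (\<lambda>i. proj i x) F) x = (\<Sum>i\<in>F. cinner H (proj i x) x)"
    by (rule inner_finsum_left[OF F(1) p x])
  also have "\<dots> = (\<Sum>i\<in>F. of_real ((hnorm H (proj i x))\<^sup>2))"
  proof (intro sum.cong refl)
    fix i assume "i \<in> F"
    then have i: "i \<in> I"
      using F(2) by blast
    show "cinner H (proj i x) x = of_real ((hnorm H (proj i x))\<^sup>2)"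
      using inner_proj_right[OF i x proj_in[OF i x]] inner_self_real[OF proj_closed[OF i x]]
      by simp
  qed
  finally have 1: "Re (cinner H (finsum H (\<lambda>i. proj i x) F) x) = (\<Sum>i\<in>F. (hnorm H (proj i x))\<^sup>2)"
    by simp
  have "cinner H (finsum H (\<lambda>i. proj i x) F) (finsum H (\<lambda>i. proj i x) F)
      = of_real (\<Sum>i\<in>F \<inter> F. (hnorm H (proj i x))\<^sup>2)"
    by (rule inner_partial_sums[OF _ F F]) (rule proj_in[OF _ x])
  then have "(hnorm H (finsum H (\<lambda>i. proj i x) F))\<^sup>2 = (\<Sum>i\<in>F. (hnorm H (proj i x))\<^sup>2)"
    using closed by (simp add: hnorm_sq)
  with 1 show ?thesis
    using closed x by (simp add: hnorm_sq_minus)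
qed

text \<open>Synthesis from the components of \<open>x\<close> gives a vector with the same components, which is \<open>x\<close>
  itself because the decomposition is total. So the partial sums \<open>S\<close> of the components come
  arbitrarily close to \<open>x\<close>. By \<open>hnorm_sq_minus_partial_sum\<close> they stay close when terms are added,
  and the partial sums of the claimed series are the numbers \<open>\<langle>S, y\<rangle>\<close>.\<close>

theorem Parseval:
  assumes x: "x \<in> carrier H" and y: "y \<in> carrier H"
  shows "((\<lambda>i. cinner H (proj i x) (proj i y)) has_sum cinner H x y) I"
proof -
  have Bessel: "(\<Sum>i\<in>F. (hnorm H (proj i x))\<^sup>2) \<le> (hnorm H x)\<^sup>2" if "finite F" "F \<subseteq> I" for F
    using hnorm_sq_minus_partial_sum[OF x that]
      zero_le_power2[of "hnorm H (finsum H (\<lambda>i. proj i x) F \<ominus> x)"] by linarith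
  have "(\<lambda>i. (hnorm H (proj i x))\<^sup>2) summable_on I"
    using Bessel by (intro nonneg_bdd_above_summable_on bdd_aboveI2[where M = "(hnorm H x)\<^sup>2"]) auto
  then obtain x' where x': "x' \<in> carrier H" "\<And>i. i \<in> I \<Longrightarrow> proj i x' = proj i x"
    and approx: "\<And>e. e > 0 \<Longrightarrow>
      \<exists>F. finite F \<and> F \<subseteq> I \<and> hnorm H (finsum H (\<lambda>i. proj i x) F \<ominus> x') < e"
    using synthesis[of "\<lambda>i. proj i x"] proj_in[OF _ x] by metis
  have "x' \<ominus> x = \<zero>"
  proof (rule total)
    fix i z assume "i \<in> I" "z \<in> E i"
    then show "cinner H (x' \<ominus> x) z = 0"
      using x x' component_closed inner_proj[of i x z] inner_proj[of i x' z]
      by (simp add: inner_minus_left)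
  qed (use x x' in auto)
  then have "x' = x"
    using x x' minus_eq_zero_iff by blast
  have "\<exists>F\<^sub>0. finite F\<^sub>0 \<and> F\<^sub>0 \<subseteq> I \<and> (\<forall>F. finite F \<and> F\<^sub>0 \<subseteq> F \<and> F \<subseteq> I \<longrightarrow>
      dist (\<Sum>i\<in>F. cinner H (proj i x) (proj i y)) (cinner H x y) < e)" if e: "e > 0" for e
  proof -
    have pos: "hnorm H y + 1 > 0"
      using y by (simp add: add_nonneg_pos)
    with e have "e / (hnorm H y + 1) > 0"
      by simp
    from approx[OF this] obtain F\<^sub>0 where F\<^sub>0: "finite F\<^sub>0" "F\<^sub>0 \<subseteq> I"
      "hnorm H (finsum H (\<lambda>i. proj i x) F\<^sub>0 \<ominus> x) < e / (hnorm H y + 1)"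
      unfolding \<open>x' = x\<close> by blast
    have "dist (\<Sum>i\<in>F. cinner H (proj i x) (proj i y)) (cinner H x y) < e"
      if F: "finite F" "F\<^sub>0 \<subseteq> F" "F \<subseteq> I" for F
    proof -
      define s where "s = finsum H (\<lambda>i. proj i x) F"
      have p: "(\<lambda>i. proj i x) \<in> F \<rightarrow> carrier H" "(\<lambda>i. proj i x) \<in> F\<^sub>0 \<rightarrow> carrier H"
        using F x by auto
      then have s: "s \<in> carrier H" "finsum H (\<lambda>i. proj i x) F\<^sub>0 \<in> carrier H"
        by (simp_all add: s_def)
      have "(\<Sum>i\<in>F\<^sub>0. (hnorm H (proj i x))\<^sup>2) \<le> (\<Sum>i\<in>F. (hnorm H (proj i x))\<^sup>2)"
        using F by (intro sum_mono2) auto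
      then have "(hnorm H (s \<ominus> x))\<^sup>2 \<le> (hnorm H (finsum H (\<lambda>i. proj i x) F\<^sub>0 \<ominus> x))\<^sup>2"
        unfolding s_def hnorm_sq_minus_partial_sum[OF x F(1,3)]
          hnorm_sq_minus_partial_sum[OF x F\<^sub>0(1,2)] by simp
      then have "hnorm H (s \<ominus> x) \<le> hnorm H (finsum H (\<lambda>i. proj i x) F\<^sub>0 \<ominus> x)"
        by (rule power2_le_imp_le) (use s x in simp)
      with F\<^sub>0(3) have small: "hnorm H (s \<ominus> x) < e / (hnorm H y + 1)"
        by simp
      have "(\<Sum>i\<in>F. cinner H (proj i x) (proj i y)) = (\<Sum>i\<in>F. cinner H (proj i x) y)"
        using F(3) x y by (intro sum.cong refl) (auto simp: inner_proj_right[symmetric] proj_in)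
      also have "\<dots> = cinner H s y"
        unfolding s_def by (rule inner_finsum_left[OF F(1) p(1) y, symmetric])
      finally have "dist (\<Sum>i\<in>F. cinner H (proj i x) (proj i y)) (cinner H x y)
          = cmod (cinner H (s \<ominus> x) y)"
        using s x y by (simp add: dist_norm inner_minus_left)
      also have "\<dots> \<le> hnorm H (s \<ominus> x) * hnorm H y"
        using s x y by (intro Cauchy_Schwarz) auto
      also have "\<dots> \<le> hnorm H (s \<ominus> x) * (hnorm H y + 1)"
        using s x by (intro mult_left_mono) auto
      also have "\<dots> < e"
        using small pos by (simp add: pos_less_divide_eq)
      finally show ?thesis .
    qed
    with F\<^sub>0 show ?thesis
      by (intro exI[of _ F\<^sub>0]) auto
  qed
  then show ?thesis
    unfolding has_sum_def tendsto_iff eventually_finite_subsets_at_top by simp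
qed

end

text \<open>For a character with \<open>\<gamma>(a) \<noteq> \<gamma>(b)\<close>, invariance of the inner product under \<open>U\<^sub>\<gamma>\<close> multiplies
  it by \<open>\<gamma>(a) \<gamma>(b)\<^sup>-\<^sup>1 \<noteq> 1\<close>.\<close>

lemma (in dual_action) eigenspaces_orthogonal:
  assumes a: "a \<in> carrier A" and b: "b \<in> carrier A" and "a \<noteq> b"
    and x: "x \<in> eigenspace a" and y: "y \<in> eigenspace b"
  shows "cinner H x y = 0"
proof -
  obtain \<gamma> where \<gamma>: "\<gamma> \<in> \<Gamma>" "\<gamma> a \<noteq> \<gamma> b"
    using separating assms(1-3) by blast
  have closed: "x \<in> carrier H" "y \<in> carrier H"
    using x y by (auto simp: eigenspace_def)
  have "cinner H x y = cinner H (U \<gamma> x) (U \<gamma> y)"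
    using \<gamma>(1) closed by (simp add: act_inner)
  also have "\<dots> = \<gamma> a * cnj (\<gamma> b) * cinner H x y"
    using x y \<gamma>(1) closed by (simp add: eigenspace_def inner_simps)
  finally have "cinner H x y * (\<gamma> a * cnj (\<gamma> b) - 1) = 0"
    by (simp add: algebra_simps)
  moreover have "\<gamma> a * cnj (\<gamma> b) \<noteq> 1"
  proof
    assume 1: "\<gamma> a * cnj (\<gamma> b) = 1"
    have "cnj (\<gamma> b) * \<gamma> b = 1"
      using character_norm[OF \<gamma>(1) b] by (rule cnj_mult_self_if_norm_1)
    with 1 have "\<gamma> a = \<gamma> b"
      by (metis mult.commute mult.left_neutral mult.assoc)
    with \<gamma>(2) show False
      by simp
  qed
  ultimately show ?thesis
    by simp
qed

sublocale dual_action \<subseteq> spectral: orthogonal_decomposition H "carrier A" eigenspace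
proof
  show "Metric_space.mcomplete (carrier H) (hdist H)"
    by (rule complete)
  show "eigenspace a \<subseteq> carrier H" for a
    by (auto simp: eigenspace_def)
qed (use eigenspaces_orthogonal eigenspace_projection eigenspaces_total in blast)+


section \<open>The modular function\<close>

context locally_compact_group
begin

lemma compactin_r_coset:
  assumes K: "compactin T K" and s: "s \<in> carrier G"
  shows "compactin T (K #> s)"
proof -
  have "continuous_map T (prod_topology T T) (\<lambda>x. (x, s))"
    using s topspace_eq by (simp add: continuous_map_pairedI)
  then have "continuous_map T T ((\<lambda>(x, y). x \<otimes> y) \<circ> (\<lambda>x. (x, s)))"
    using continuous_mult by (rule continuous_map_compose)
  then have "compactin T ((\<lambda>x. x \<otimes> s) ` K)"
    using image_compactin[OF K] by (simp add: o_def)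
  also have "(\<lambda>x. x \<otimes> s) ` K = K #> s"
    by (auto simp: r_coset_def)
  finally show ?thesis .
qed

lemma compactin_measurable:
  assumes \<mu>: "left_haar_measure G T \<mu>" and K: "compactin T K"
  shows "K \<in> sets \<mu>"
proof -
  have "closedin T K"
    using Hausdorff K by (rule compactin_imp_closedin)
  then have "openin T (topspace T - K)" "K \<subseteq> topspace T"
    by (auto simp: closedin_def)
  then have "topspace T - (topspace T - K) \<in> sigma_sets (topspace T) {U. openin T U}"
    by (intro sigma_sets.Compl sigma_sets.Basic) simp
  moreover have "topspace T - (topspace T - K) = K"
    using \<open>K \<subseteq> topspace T\<close> by blast
  moreover have "{U. openin T U} \<subseteq> Pow (topspace T)"
    by (auto dest: openin_subset)
  ultimately show ?thesis
    using \<mu> by (simp add: left_haar_measure_def sets_measure_of)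
qed

text \<open>Compare the measures of \<open>K s t\<close> and \<open>(K s) t\<close> for a compact set \<open>K\<close> of positive measure. Such
  a set exists since the measure is nonzero and inner regular on the open set \<open>G\<close>, and its
  measure is finite, so it can be cancelled.\<close>

theorem modular_function_mult:
  assumes \<mu>: "left_haar_measure G T \<mu>" and \<Delta>: "modular_function G \<mu> \<Delta>"
    and s: "s \<in> carrier G" and t: "t \<in> carrier G"
  shows "\<Delta> (s \<otimes> t) = \<Delta> s * \<Delta> t"
proof -
  have "openin T (carrier G)"
    using openin_topspace[of T] topspace_eq by simp
  with \<mu> have "emeasure \<mu> (carrier G) = (SUP K\<in>{K. compactin T K \<and> K \<subseteq> carrier G}. emeasure \<mu> K)"
    by (simp add: left_haar_measure_def)
  moreover have "emeasure \<mu> (carrier G) \<noteq> 0"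
    using \<mu> by (simp add: left_haar_measure_def)
  ultimately obtain K where K: "compactin T K" "K \<subseteq> carrier G" "emeasure \<mu> K \<noteq> 0"
    by (metis (mono_tags, lifting) SUP_least bot_ennreal le_zero_eq mem_Collect_eq)
  have "emeasure \<mu> K < \<infinity>"
    using \<mu> K(1) by (simp add: left_haar_measure_def)
  then obtain m where m: "emeasure \<mu> K = ennreal m" "m > 0"
    using K(3) by (cases "emeasure \<mu> K") (auto simp: less_le)
  have pos: "\<Delta> s > 0" "\<Delta> t > 0" "\<Delta> (s \<otimes> t) > 0"
    using \<Delta> s t by (auto simp: modular_function_def)
  have scale: "emeasure \<mu> (E #> u) = ennreal (\<Delta> u) * emeasure \<mu> E"
    if "compactin T E" "u \<in> carrier G" for E u
    using \<Delta> that compactin_measurable[OF \<mu>] by (simp add: modular_function_def)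
  have "ennreal (\<Delta> (s \<otimes> t)) * emeasure \<mu> K = emeasure \<mu> (K #> (s \<otimes> t))"
    using scale[OF K(1)] s t by simp
  also have "K #> (s \<otimes> t) = (K #> s) #> t"
    using coset_mult_assoc[OF K(2) s t] by simp
  also have "emeasure \<mu> \<dots> = ennreal (\<Delta> t) * (ennreal (\<Delta> s) * emeasure \<mu> K)"
    using scale[OF compactin_r_coset[OF K(1) s] t] scale[OF K(1) s] by simp
  finally have "ennreal (\<Delta> (s \<otimes> t) * m) = ennreal (\<Delta> t * (\<Delta> s * m))"
    using m pos by (simp add: ennreal_mult)
  then have "\<Delta> (s \<otimes> t) * m = \<Delta> t * (\<Delta> s * m)"
    using m pos by (simp add: ennreal_inj)
  then show ?thesis
    using m(2) by simp
qed

end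

locale group_with_section = Group.group G for G :: "('g, 'b) monoid_scheme" (structure) +
  fixes \<Delta> :: "'g \<Rightarrow> real" and \<sigma> :: "real \<Rightarrow> 'g"
  assumes \<Delta>_mult: "\<lbrakk>s \<in> carrier G; t \<in> carrier G\<rbrakk> \<Longrightarrow> \<Delta> (s \<otimes> t) = \<Delta> s * \<Delta> t"
    and \<Delta>_pos: "s \<in> carrier G \<Longrightarrow> \<Delta> s > 0"
    and normalized: "normalized_section G \<Delta> \<sigma>"
begin

abbreviation D :: "real set" where
  "D \<equiv> modular_image G \<Delta>"

abbreviation N :: "'g set" where
  "N \<equiv> modular_kernel G \<Delta>"

lemma N_iff: "k \<in> N \<longleftrightarrow> k \<in> carrier G \<and> \<Delta> k = 1"
  by (simp add: kernel_def pos_real_group_def)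

lemma \<Delta>_nonzero: "s \<in> carrier G \<Longrightarrow> \<Delta> s \<noteq> 0"
  using \<Delta>_pos[of s] by simp

lemma \<Delta>_one: "\<Delta> \<one> = 1"
  using \<Delta>_mult[of \<one> \<one>] \<Delta>_pos[of \<one>] by simp

lemma \<Delta>_inv: "s \<in> carrier G \<Longrightarrow> \<Delta> (inv s) = inverse (\<Delta> s)"
  using \<Delta>_mult[of "inv s" s] \<Delta>_pos[of s] \<Delta>_one by (simp add: field_simps)

lemma section_closed [simp]: "\<delta> \<in> D \<Longrightarrow> \<sigma> \<delta> \<in> carrier G"
  and \<Delta>_section: "\<delta> \<in> D \<Longrightarrow> \<Delta> (\<sigma> \<delta>) = \<delta>"
  using normalized by (auto simp: normalized_section_def)

lemma one_D: "1 \<in> D"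
  using \<Delta>_one by (metis imageI one_closed)

lemma D_pos: "\<delta> \<in> D \<Longrightarrow> \<delta> > 0"
  using \<Delta>_pos by auto

lemma mult_D: "\<lbrakk>\<delta> \<in> D; \<epsilon> \<in> D\<rbrakk> \<Longrightarrow> \<delta> * \<epsilon> \<in> D"
  using \<Delta>_mult by (metis (no_types, lifting) imageE imageI m_closed)

lemma inverse_D: "\<delta> \<in> D \<Longrightarrow> inverse \<delta> \<in> D"
  using \<Delta>_inv by (metis (no_types, lifting) imageE imageI inv_closed)

lemma shift_D: "\<lbrakk>s \<in> carrier G; \<delta> \<in> D\<rbrakk> \<Longrightarrow> inverse (\<Delta> s) * \<delta> \<in> D"
  by (intro mult_D inverse_D) auto

lemma shift_mult: "s \<in> carrier G \<Longrightarrow> \<Delta> s * (inverse (\<Delta> s) * \<delta>) = \<delta>"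
  using \<Delta>_pos[of s] by simp

lemma cocycle_in_N:
  assumes "s \<in> carrier G" "\<delta> \<in> D"
  shows "inv (\<sigma> \<delta>) \<otimes> s \<otimes> \<sigma> (inverse (\<Delta> s) * \<delta>) \<in> N"
  using assms shift_D[OF assms] D_pos[OF assms(2)] \<Delta>_pos[OF assms(1)]
  by (simp add: N_iff \<Delta>_mult \<Delta>_inv \<Delta>_section field_simps)

lemma comm_group_image: "comm_group (modular_image_group G \<Delta>)"
proof (rule comm_groupI)
  fix \<delta> assume "\<delta> \<in> carrier (modular_image_group G \<Delta>)"
  then have \<delta>: "\<delta> \<in> D"
    by simp
  show "\<exists>\<epsilon>\<in>carrier (modular_image_group G \<Delta>).
      \<epsilon> \<otimes>\<^bsub>modular_image_group G \<Delta>\<^esub> \<delta> = \<one>\<^bsub>modular_image_group G \<Delta>\<^esub>"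
    using D_pos[OF \<delta>] inverse_D[OF \<delta>]
    by (intro bexI[of _ "inverse \<delta>"]) (simp_all add: pos_real_group_def)
qed (use mult_D one_D in \<open>simp_all add: pos_real_group_def mult.assoc mult.commute\<close>)

lemma modular_dual_eq: "discrete_dual (modular_image_group G \<Delta>) = modular_dual G \<Delta>"
  "discrete_dual_topology (modular_image_group G \<Delta>) = modular_dual_topology G \<Delta>"
  by simp_all

lemma comm_group_modular_dual: "comm_group (modular_dual G \<Delta>)"
  using comm_group_discrete_dual[OF comm_group.axioms(2)[OF comm_group_image]] by simp

lemma modular_dual_norm: "\<lbrakk>\<gamma> \<in> carrier (modular_dual G \<Delta>); \<delta> \<in> D\<rbrakk> \<Longrightarrow> cmod (\<gamma> \<delta>) = 1"
  using discrete_dual_iff[of \<gamma> "modular_image_group G \<Delta>"] by (auto simp: modular_dual_eq)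

lemma modular_dual_mult:
  "\<lbrakk>\<gamma> \<in> carrier (modular_dual G \<Delta>); \<delta> \<in> D; \<epsilon> \<in> D\<rbrakk> \<Longrightarrow> \<gamma> (\<delta> * \<epsilon>) = \<gamma> \<delta> * \<gamma> \<epsilon>"
  using discrete_dual_iff[of \<gamma> "modular_image_group G \<Delta>"]
  by (auto simp: modular_dual_eq pos_real_group_def)

text \<open>The characters \<open>x \<mapsto> x\<^sup>i\<^sup>t\<close> of the positive reals suffice: for the right \<open>t\<close>, the values at
  \<open>\<delta>\<close> and \<open>\<epsilon>\<close> differ by the factor \<open>e\<^sup>i\<^sup>\<pi> = -1\<close>.\<close>

lemma modular_dual_separating:
  assumes "\<delta> \<in> D" "\<epsilon> \<in> D" "\<delta> \<noteq> \<epsilon>"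
  shows "\<exists>\<gamma>\<in>carrier (modular_dual G \<Delta>). \<gamma> \<delta> \<noteq> \<gamma> \<epsilon>"
proof -
  have pos: "\<delta> > 0" "\<epsilon> > 0"
    using assms D_pos by auto
  define t where "t = pi / (ln \<delta> - ln \<epsilon>)"
  define \<gamma> where "\<gamma> = (\<lambda>x\<in>D. cis (t * ln x))"
  have "ln \<delta> \<noteq> ln \<epsilon>"
    using assms(3) pos by simp
  then have "t * ln \<delta> = pi + t * ln \<epsilon>"
    by (simp add: t_def field_simps)
  then have "\<gamma> \<delta> = - \<gamma> \<epsilon>"
    using assms by (simp add: \<gamma>_def cis_mult[symmetric])
  moreover have "\<gamma> \<epsilon> \<noteq> 0"
    using assms by (simp add: \<gamma>_def)
  moreover have "\<gamma> \<in> carrier (modular_dual G \<Delta>)"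
    unfolding modular_dual_eq[symmetric] discrete_dual_iff
    using mult_D \<Delta>_nonzero
    by (auto simp: \<gamma>_def pos_real_group_def ln_mult distrib_left cis_mult)
  ultimately show ?thesis
    by (intro bexI[of _ \<gamma>]) auto
qed

end


section \<open>The dual action on an induced representation\<close>

lemma infsum_le_if_finite_sums_le:
  fixes f :: "'i \<Rightarrow> real"
  assumes "\<And>F. finite F \<Longrightarrow> F \<subseteq> I \<Longrightarrow> sum f F \<le> b" "\<And>i. i \<in> I \<Longrightarrow> 0 \<le> f i"
  shows "infsum f I \<le> b"
proof (rule infsum_le_finite_sums)
  show "f summable_on I"
    using assms by (intro nonneg_bdd_above_summable_on bdd_aboveI2[where M = b]) auto
qed (use assms in auto)

definition multiplier :: "'i set \<Rightarrow> ('v, 'm) hilbert_scheme \<Rightarrow> ('i \<Rightarrow> complex) \<Rightarrow> ('i \<Rightarrow> 'v) \<Rightarrow> 'i \<Rightarrow> 'v" where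
  "multiplier I H \<gamma> f = (\<lambda>i\<in>I. \<gamma> i \<odot>\<^bsub>H\<^esub> f i)"

context complex_inner_space
begin

lemma multiplier_closed:
  assumes "f \<in> carrier (l2_space I H)" "\<And>i. i \<in> I \<Longrightarrow> cmod (\<gamma> i) = 1"
  shows "multiplier I H \<gamma> f \<in> carrier (l2_space I H)"
proof -
  have f: "f i \<in> carrier H" if "i \<in> I" for i
    using assms(1) that by (auto simp: l2_space_def)
  have "(\<lambda>i. (hnorm H (multiplier I H \<gamma> f i))\<^sup>2) summable_on I \<longleftrightarrow> (\<lambda>i. (hnorm H (f i))\<^sup>2) summable_on I"
    by (rule summable_on_cong) (simp add: multiplier_def hnorm_smult f assms(2))
  then show ?thesis
    using assms(1) f by (auto simp: l2_space_def multiplier_def)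
qed

lemma multiplier_inner:
  assumes f: "\<And>i. i \<in> I \<Longrightarrow> f i \<in> carrier H" and g: "\<And>i. i \<in> I \<Longrightarrow> g i \<in> carrier H"
    and "\<And>i. i \<in> I \<Longrightarrow> cmod (\<gamma> i) = 1"
  shows "cinner (l2_space I H) (multiplier I H \<gamma> f) (multiplier I H \<gamma> g) = cinner (l2_space I H) f g"
proof -
  have "cinner H (\<gamma> i \<odot> f i) (\<gamma> i \<odot> g i) = cinner H (f i) (g i)" if "i \<in> I" for i
  proof -
    have "cinner H (\<gamma> i \<odot> f i) (\<gamma> i \<odot> g i) = (cnj (\<gamma> i) * \<gamma> i) * cinner H (f i) (g i)"
      using f g that by (simp add: inner_simps)
    then show ?thesis
      using cnj_mult_self_if_norm_1[OF assms(3)[OF that]] by simp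
  qed
  then show ?thesis
    by (auto simp: l2_space_def multiplier_def intro!: infsum_cong)
qed

end

locale modular_rep = group_with_section G \<Delta> \<sigma> + unitary_action H G \<pi>
  for G :: "('g, 'b) monoid_scheme" and \<Delta> \<sigma>
    and H :: "('v, 'm) hilbert_scheme" (structure) and \<pi>
begin

text \<open>The operator \<open>U\<^sub>\<gamma>\<close> is multiplication by \<open>\<gamma>\<close> transported to \<open>H\<close> along \<open>W\<close>. Since \<open>W\<close> is
  injective, each identity for \<open>U\<close> follows from the pointwise one for multiplication operators.\<close>

lemma multiplier_action:
  fixes H\<^sub>1 :: "('w, 'n) hilbert_scheme"
  assumes H\<^sub>1: "complex_inner_space H\<^sub>1" and W: "W \<in> unitaries H (l2_space D H\<^sub>1)"
  obtains U where
    "\<And>\<gamma> x. \<lbrakk>\<gamma> \<in> carrier (modular_dual G \<Delta>); x \<in> carrier H\<rbrakk>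
      \<Longrightarrow> W (U \<gamma> x) = multiplier D H\<^sub>1 \<gamma> (W x)"
    "U \<in> hom (modular_dual G \<Delta>) (unitary_group H)"
proof -
  interpret H1: complex_inner_space H\<^sub>1 by fact
  interpret dual: Group.comm_group "modular_dual G \<Delta>"
    by (rule comm_group_modular_dual)
  define L where "L = l2_space D H\<^sub>1"
  define m where "m = multiplier D H\<^sub>1"
  have W: "W \<in> unitaries H L"
    using W by (simp add: L_def)
  note [simp] = unitaries_closed[OF W]
  have inj: "x = y" if "W x = W y" "x \<in> carrier H" "y \<in> carrier H" for x y
    using that unitaries_bij[OF W] by (auto simp: bij_betw_def inj_on_def)
  have L_closed: "f \<delta> \<in> carrier H\<^sub>1" if "f \<in> carrier L" "\<delta> \<in> D" for f \<delta>
    using that by (auto simp: L_def l2_space_def)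
  have m_closed: "m \<gamma> f \<in> carrier L" if "\<gamma> \<in> carrier (modular_dual G \<Delta>)" "f \<in> carrier L" for \<gamma> f
    using that modular_dual_norm[OF that(1)]
    unfolding L_def m_def by (intro H1.multiplier_closed)
  have m_inner: "cinner L (m \<gamma> f) (m \<gamma> g) = cinner L f g"
    if "\<gamma> \<in> carrier (modular_dual G \<Delta>)" "f \<in> carrier L" "g \<in> carrier L" for \<gamma> f g
    using L_closed that modular_dual_norm[OF that(1)]
    unfolding L_def m_def by (intro H1.multiplier_inner)
  define U where "U = (\<lambda>\<gamma>. \<lambda>x\<in>carrier H. inv_into (carrier H) W (m \<gamma> (W x)))"
  have surj: "W ` carrier H = carrier L"
    using unitaries_bij[OF W] by (simp add: bij_betw_def)
  have U_closed: "U \<gamma> x \<in> carrier H" and WU: "W (U \<gamma> x) = m \<gamma> (W x)"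
    if "\<gamma> \<in> carrier (modular_dual G \<Delta>)" "x \<in> carrier H" for \<gamma> x
  proof -
    have "m \<gamma> (W x) \<in> W ` carrier H"
      using that by (simp add: surj m_closed)
    then show "U \<gamma> x \<in> carrier H" "W (U \<gamma> x) = m \<gamma> (W x)"
      using that(2) by (simp_all add: U_def inv_into_into f_inv_into_f)
  qed
  have "U \<in> hom (modular_dual G \<Delta>) (unitary_group H)"
  proof (rule hom_unitary_groupI)
    fix \<gamma> assume \<gamma>: "\<gamma> \<in> carrier (modular_dual G \<Delta>)"
    show "U \<gamma> \<in> unitaries H H"
    proof (rule unitariesI)
      show "U \<gamma> \<in> carrier H \<rightarrow>\<^sub>E carrier H"
        using U_closed[OF \<gamma>] by (auto simp: U_def)
      show "\<exists>x\<in>carrier H. U \<gamma> x = y" if y: "y \<in> carrier H" for y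
      proof -
        have "multiplier D H\<^sub>1 (\<lambda>\<delta>. cnj (\<gamma> \<delta>)) (W y) \<in> carrier L"
          using y modular_dual_norm[OF \<gamma>] unitaries_closed[OF W y] unfolding L_def
          by (intro H1.multiplier_closed) auto
        then obtain x where x: "x \<in> carrier H" "W x = multiplier D H\<^sub>1 (\<lambda>\<delta>. cnj (\<gamma> \<delta>)) (W y)"
          using surj by (metis imageE)
        have "m \<gamma> (W x) = W y"
        proof (rule extensionalityI)
          show "W y \<in> extensional D"
            using unitaries_closed[OF W y] by (auto simp: L_def l2_space_def PiE_def)
          fix \<delta> assume \<delta>: "\<delta> \<in> D"
          then show "m \<gamma> (W x) \<delta> = W y \<delta>"
            using L_closed[OF unitaries_closed[OF W y] \<delta>]
              cnj_mult_self_if_norm_1[OF modular_dual_norm[OF \<gamma> \<delta>]]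
            by (simp add: m_def multiplier_def x(2) H1.scale_scale H1.scale_one mult.commute)
        qed (simp add: m_def multiplier_def)
        then have "U \<gamma> x = y"
          using x(1) y \<gamma> by (intro inj) (simp_all add: WU U_closed)
        with x(1) show ?thesis
          by blast
      qed
      fix x y assume xy: "x \<in> carrier H" "y \<in> carrier H"
      show "U \<gamma> (x \<oplus> y) = U \<gamma> x \<oplus> U \<gamma> y"
      proof (rule inj)
        have "W x \<delta> \<in> carrier H\<^sub>1" "W y \<delta> \<in> carrier H\<^sub>1" if "\<delta> \<in> D" for \<delta>
          using L_closed xy that by simp_all
        then have "m \<gamma> (W x \<oplus>\<^bsub>L\<^esub> W y) = m \<gamma> (W x) \<oplus>\<^bsub>L\<^esub> m \<gamma> (W y)"
          by (auto simp: m_def multiplier_def L_def l2_space_def H1.smult_r_distr)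
        then show "W (U \<gamma> (x \<oplus> y)) = W (U \<gamma> x \<oplus> U \<gamma> y)"
          using \<gamma> xy by (simp add: WU U_closed unitaries_add[OF W])
      qed (use \<gamma> xy U_closed in auto)
      show "cinner H (U \<gamma> x) (U \<gamma> y) = cinner H x y"
        using unitaries_inner[OF W U_closed[OF \<gamma> xy(1)] U_closed[OF \<gamma> xy(2)]] \<gamma> xy
        by (simp add: WU m_inner unitaries_inner[OF W])
    next
      fix c x assume x: "x \<in> carrier H"
      show "U \<gamma> (c \<odot> x) = c \<odot> U \<gamma> x"
      proof (rule inj)
        have "W x \<delta> \<in> carrier H\<^sub>1" if "\<delta> \<in> D" for \<delta>
          using L_closed x that by simp
        then have "m \<gamma> (c \<odot>\<^bsub>L\<^esub> W x) = c \<odot>\<^bsub>L\<^esub> m \<gamma> (W x)"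
          by (auto simp: m_def multiplier_def L_def l2_space_def H1.scale_scale mult.commute)
        then show "W (U \<gamma> (c \<odot> x)) = W (c \<odot> U \<gamma> x)"
          using \<gamma> x by (simp add: WU U_closed unitaries_smult[OF W])
      qed (use \<gamma> x U_closed in auto)
    qed
  next
    fix \<gamma> \<eta> x assume *: "\<gamma> \<in> carrier (modular_dual G \<Delta>)" "\<eta> \<in> carrier (modular_dual G \<Delta>)"
      "x \<in> carrier H"
    have closed: "\<gamma> \<otimes>\<^bsub>modular_dual G \<Delta>\<^esub> \<eta> \<in> carrier (modular_dual G \<Delta>)"
      using *(1,2) by (rule dual.m_closed)
    show "U (\<gamma> \<otimes>\<^bsub>modular_dual G \<Delta>\<^esub> \<eta>) x = U \<gamma> (U \<eta> x)"
    proof (rule inj)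
      have "W x \<delta> \<in> carrier H\<^sub>1" if "\<delta> \<in> D" for \<delta>
        using L_closed * that by simp
      then have "m (\<gamma> \<otimes>\<^bsub>modular_dual G \<Delta>\<^esub> \<eta>) (W x) = m \<gamma> (m \<eta> (W x))"
        by (auto simp: m_def multiplier_def pontryagin_dual_def H1.scale_scale)
      then show "W (U (\<gamma> \<otimes>\<^bsub>modular_dual G \<Delta>\<^esub> \<eta>) x) = W (U \<gamma> (U \<eta> x))"
        using * closed by (simp add: WU U_closed)
    qed (use * closed U_closed in auto)
  next
    fix \<gamma> \<eta> assume *: "\<gamma> \<in> carrier (modular_dual G \<Delta>)" "\<eta> \<in> carrier (modular_dual G \<Delta>)"
    show "\<gamma> \<otimes>\<^bsub>modular_dual G \<Delta>\<^esub> \<eta> \<in> carrier (modular_dual G \<Delta>)"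
      using * by (rule dual.m_closed)
  qed
  then show thesis
    using that[of U] WU by (simp add: m_def)
qed

text \<open>Writing \<open>g \<delta> = \<parallel>W x \<delta>\<parallel>\<^sup>2\<close>, the squared distance of \<open>U\<^sub>\<gamma> x\<close> and \<open>U\<^sub>\<eta> x\<close> is the sum of
  \<open>|\<gamma>(\<delta>) - \<eta>(\<delta>)|\<^sup>2 g(\<delta>)\<close>. Outside a finite set \<open>F\<close> the sum of \<open>g\<close> is small and the factor is at
  most 4; on \<open>F\<close> the factor is small for all \<open>\<gamma>\<close> in a neighbourhood of \<open>\<eta>\<close>.\<close>

lemma multiplier_action_continuous:
  fixes H\<^sub>1 :: "('w, 'n) hilbert_scheme"
  assumes H\<^sub>1: "complex_inner_space H\<^sub>1" and W: "W \<in> unitaries H (l2_space D H\<^sub>1)"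
    and U_closed: "\<And>\<gamma> x. \<lbrakk>\<gamma> \<in> carrier (modular_dual G \<Delta>); x \<in> carrier H\<rbrakk> \<Longrightarrow> U \<gamma> x \<in> carrier H"
    and WU: "\<And>\<gamma> x. \<lbrakk>\<gamma> \<in> carrier (modular_dual G \<Delta>); x \<in> carrier H\<rbrakk>
      \<Longrightarrow> W (U \<gamma> x) = multiplier D H\<^sub>1 \<gamma> (W x)"
    and x: "x \<in> carrier H"
  shows "continuous_map (modular_dual_topology G \<Delta>) (norm_topology H) (\<lambda>\<gamma>. U \<gamma> x)"
proof -
  interpret H1: complex_inner_space H\<^sub>1 by fact
  define \<Gamma> where "\<Gamma> = carrier (modular_dual G \<Delta>)"
  define g where "g = (\<lambda>\<delta>. (hnorm H\<^sub>1 (W x \<delta>))\<^sup>2)"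
  have Wx: "W x \<in> carrier (l2_space D H\<^sub>1)"
    by (rule unitaries_closed[OF W x])
  then have Wx_closed: "W x \<delta> \<in> carrier H\<^sub>1" if "\<delta> \<in> D" for \<delta>
    using that by (auto simp: l2_space_def)
  have g: "g summable_on D"
    using Wx by (simp add: l2_space_def g_def)
  have char_dist: "(cmod (\<gamma> \<delta> - \<eta> \<delta>))\<^sup>2 \<le> 4" if "\<gamma> \<in> \<Gamma>" "\<eta> \<in> \<Gamma>" "\<delta> \<in> D" for \<gamma> \<eta> \<delta>
  proof -
    have "cmod (\<gamma> \<delta> - \<eta> \<delta>) \<le> 2"
      using norm_triangle_ineq4[of "\<gamma> \<delta>" "\<eta> \<delta>"] modular_dual_norm that by (simp add: \<Gamma>_def)
    then show ?thesis
      using power_mono[of "cmod (\<gamma> \<delta> - \<eta> \<delta>)" 2 2] by simp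
  qed
  have dist: "(hnorm H (U \<gamma> x \<ominus> U \<eta> x))\<^sup>2 = (\<Sum>\<^sub>\<infinity>\<delta>\<in>D. (cmod (\<gamma> \<delta> - \<eta> \<delta>))\<^sup>2 * g \<delta>)"
    if \<gamma>: "\<gamma> \<in> \<Gamma>" and \<eta>: "\<eta> \<in> \<Gamma>" for \<gamma> \<eta>
  proof -
    have closed: "U \<gamma> x \<in> carrier H" "U \<eta> x \<in> carrier H"
      using that x U_closed by (auto simp: \<Gamma>_def)
    define v where "v = U \<gamma> x \<ominus> U \<eta> x"
    have v: "v \<in> carrier H"
      using closed by (simp add: v_def)
    have "W v = W (U \<gamma> x) \<oplus>\<^bsub>l2_space D H\<^sub>1\<^esub> (-1) \<odot>\<^bsub>l2_space D H\<^sub>1\<^esub> W (U \<eta> x)"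
      using closed by (simp add: v_def minus_eq_add_scale unitaries_add[OF W] unitaries_smult[OF W])
    then have Wv: "W v \<delta> = \<gamma> \<delta> \<odot>\<^bsub>H\<^sub>1\<^esub> W x \<delta> \<oplus>\<^bsub>H\<^sub>1\<^esub> (-1) \<odot>\<^bsub>H\<^sub>1\<^esub> (\<eta> \<delta> \<odot>\<^bsub>H\<^sub>1\<^esub> W x \<delta>)"
      if "\<delta> \<in> D" for \<delta>
      using that \<gamma> \<eta> x WU by (simp add: \<Gamma>_def l2_space_def multiplier_def)
    have "cinner H\<^sub>1 (W v \<delta>) (W v \<delta>) = of_real ((cmod (\<gamma> \<delta> - \<eta> \<delta>))\<^sup>2 * g \<delta>)" if \<delta>: "\<delta> \<in> D" for \<delta>
    proof -
      have "cinner H\<^sub>1 (W v \<delta>) (W v \<delta>)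
          = (\<gamma> \<delta> - \<eta> \<delta>) * cnj (\<gamma> \<delta> - \<eta> \<delta>) * cinner H\<^sub>1 (W x \<delta>) (W x \<delta>)"
        using Wx_closed[OF \<delta>] by (simp add: Wv[OF \<delta>] H1.inner_simps algebra_simps)
      also have "(\<gamma> \<delta> - \<eta> \<delta>) * cnj (\<gamma> \<delta> - \<eta> \<delta>) = of_real ((cmod (\<gamma> \<delta> - \<eta> \<delta>))\<^sup>2)"
        by (rule complex_norm_square[symmetric])
      finally show ?thesis
        by (simp add: H1.inner_self_real[OF Wx_closed[OF \<delta>]] g_def)
    qed
    then have "cinner (l2_space D H\<^sub>1) (W v) (W v)
        = (\<Sum>\<^sub>\<infinity>\<delta>\<in>D. complex_of_real ((cmod (\<gamma> \<delta> - \<eta> \<delta>))\<^sup>2 * g \<delta>))"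
      by (auto simp: l2_space_def intro!: infsum_cong)
    also have "\<dots> = of_real (\<Sum>\<^sub>\<infinity>\<delta>\<in>D. (cmod (\<gamma> \<delta> - \<eta> \<delta>))\<^sup>2 * g \<delta>)"
    proof (rule infsumI, rule has_sum_of_real, rule has_sum_infsum)
      have "(\<lambda>\<delta>. 4 * g \<delta>) summable_on D"
        using g by (rule summable_on_cmult_right)
      then show "(\<lambda>\<delta>. (cmod (\<gamma> \<delta> - \<eta> \<delta>))\<^sup>2 * g \<delta>) summable_on D"
        by (rule summable_on_comparison_test)
          (use char_dist[OF \<gamma> \<eta>] in \<open>auto simp: g_def intro!: mult_right_mono\<close>)
    qed
    finally show ?thesis
      using v unitaries_inner[OF W v v] by (simp add: v_def[symmetric] hnorm_sq)
  qed
  show ?thesis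
    unfolding continuous_map_norm_topology_iff
  proof (intro conjI ballI allI impI)
    show "(\<lambda>\<gamma>. U \<gamma> x) \<in> topspace (modular_dual_topology G \<Delta>) \<rightarrow> carrier H"
      using U_closed x topspace_discrete_dual[of "modular_image_group G \<Delta>"] by auto
    fix \<eta> and e :: real assume "\<eta> \<in> topspace (modular_dual_topology G \<Delta>)" and e: "e > 0"
    then have \<eta>: "\<eta> \<in> \<Gamma>"
      using topspace_discrete_dual[of "modular_image_group G \<Delta>"] by (simp add: \<Gamma>_def)
    obtain F where F: "finite F" "F \<subseteq> D"
      "\<forall>F'. finite F' \<and> F' \<subseteq> D \<and> F' \<inter> F = {} \<longrightarrow> sum g F' < e\<^sup>2 / 16"
      using small_tail[OF g, of "e\<^sup>2 / 16"] e by (auto simp: g_def)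
    \<comment> \<open>the summand 1 only keeps \<open>s\<close> positive\<close>
    define s where "s = sum g F + 1"
    have s: "s > 0"
      by (simp add: s_def g_def sum_nonneg add_nonneg_pos)
    define d where "d = e / (2 * sqrt s)"
    have d: "d > 0" "d\<^sup>2 * s = e\<^sup>2 / 4"
      using e s by (auto simp: d_def power_divide power_mult_distrib)
    define B where "B = {\<gamma> \<in> \<Gamma>. \<forall>\<delta>\<in>F. cmod (\<gamma> \<delta> - \<eta> \<delta>) < d}"
    have "openin (modular_dual_topology G \<Delta>) B"
      using openin_discrete_dual_box[OF F(1), of "modular_image_group G \<Delta>" \<eta> d] F(2)
      by (simp add: B_def \<Gamma>_def)
    moreover have "\<eta> \<in> B"
      using \<eta> d(1) by (simp add: B_def)
    moreover have "hnorm H (U \<gamma> x \<ominus> U \<eta> x) < e" if \<gamma>: "\<gamma> \<in> B" for \<gamma>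
    proof (rule power2_less_imp_less)
      have \<gamma>': "\<gamma> \<in> \<Gamma>"
        using \<gamma> by (simp add: B_def)
      define h where "h = (\<lambda>\<delta>. (cmod (\<gamma> \<delta> - \<eta> \<delta>))\<^sup>2 * g \<delta>)"
      have "infsum h D \<le> e\<^sup>2 / 2"
      proof (rule infsum_le_if_finite_sums_le)
        fix F' assume F': "finite F'" "F' \<subseteq> D"
        have "sum h (F' \<inter> F) \<le> (\<Sum>\<delta>\<in>F' \<inter> F. d\<^sup>2 * g \<delta>)"
          unfolding h_def using \<gamma> by (intro sum_mono mult_right_mono power_mono) (auto simp: B_def g_def less_imp_le)
        also have "\<dots> \<le> (\<Sum>\<delta>\<in>F. d\<^sup>2 * g \<delta>)"
          using F(1) by (intro sum_mono2) (auto simp: g_def)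
        also have "\<dots> \<le> d\<^sup>2 * s"
          by (simp add: s_def sum_distrib_left[symmetric] mult_left_mono)
        finally have 1: "sum h (F' \<inter> F) \<le> e\<^sup>2 / 4"
          using d(2) by simp
        have "sum h (F' - F) \<le> (\<Sum>\<delta>\<in>F' - F. 4 * g \<delta>)"
          unfolding h_def
        proof (intro sum_mono mult_right_mono)
          fix \<delta> assume "\<delta> \<in> F' - F"
          then have "\<delta> \<in> D"
            using F' by auto
          with \<gamma>' \<eta> show "(cmod (\<gamma> \<delta> - \<eta> \<delta>))\<^sup>2 \<le> 4"
            by (rule char_dist)
        qed (simp add: g_def)
        also have "\<dots> = 4 * sum g (F' - F)"
          by (simp add: sum_distrib_left)
        also have "sum g (F' - F) < e\<^sup>2 / 16"
          using F(3) F' by auto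
        finally have 2: "sum h (F' - F) \<le> e\<^sup>2 / 4"
          by simp
        show "sum h F' \<le> e\<^sup>2 / 2"
          using sum.Int_Diff[OF F'(1), of h F] 1 2 by simp
      qed (simp add: h_def g_def)
      also have "\<dots> < e\<^sup>2"
        using e by simp
      finally show "(hnorm H (U \<gamma> x \<ominus> U \<eta> x))\<^sup>2 < e\<^sup>2"
        using dist[OF \<gamma>' \<eta>] by (simp add: h_def)
    qed (use e in simp)
    ultimately show "\<exists>B. openin (modular_dual_topology G \<Delta>) B \<and> \<eta> \<in> B \<and>
        (\<forall>\<gamma>\<in>B. hnorm H (U \<gamma> x \<ominus> U \<eta> x) < e)"
      by blast
  qed
qed

text \<open>Both sides of the commutation relation have the same value at \<open>\<delta>\<close>, because
  \<open>\<gamma>(\<Delta>(s)) \<gamma>(\<Delta>(s)\<^sup>-\<^sup>1 \<delta>) = \<gamma>(\<delta>)\<close>.\<close>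

theorem dual_action_if_induced:
  fixes H\<^sub>1 :: "('w, 'n) hilbert_scheme"
  assumes H: "complex_hilbert_space H"
    and induced: "induced_from_modular_kernel G T \<Delta> \<sigma> H \<pi> H\<^sub>1 \<pi>\<^sub>1"
  shows "\<exists>U. unitary_representation (modular_dual G \<Delta>) (modular_dual_topology G \<Delta>) H U \<and>
    implements_dual_action G \<Delta> H \<pi> U"
proof -
  have H\<^sub>1: "complex_inner_space H\<^sub>1" and hom\<^sub>1: "\<pi>\<^sub>1 \<in> hom (G\<lparr>carrier := N\<rparr>) (unitary_group H\<^sub>1)"
    using induced by (simp_all add: induced_from_modular_kernel_def unitary_representation_def
        complex_hilbert_space_iff)
  interpret H1: complex_inner_space H\<^sub>1 by (rule H\<^sub>1)
  have \<pi>\<^sub>1: "\<pi>\<^sub>1 k \<in> unitaries H\<^sub>1 H\<^sub>1" if "k \<in> N" for k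
    using hom_in_carrier[OF hom\<^sub>1] that by (simp add: unitary_group_simps)
  obtain W where W: "W \<in> unitaries H (l2_space D H\<^sub>1)"
    and inter: "\<forall>s\<in>carrier G. \<forall>x\<in>carrier H. W (\<pi> s x) = induced_rep G \<Delta> \<sigma> H\<^sub>1 \<pi>\<^sub>1 s (W x)"
    using induced unfolding induced_from_modular_kernel_def unitarily_equivalent_def
    by (elim conjE bexE)
  obtain U where WU: "\<And>\<gamma> x. \<lbrakk>\<gamma> \<in> carrier (modular_dual G \<Delta>); x \<in> carrier H\<rbrakk>
      \<Longrightarrow> W (U \<gamma> x) = multiplier D H\<^sub>1 \<gamma> (W x)"
    and U: "U \<in> hom (modular_dual G \<Delta>) (unitary_group H)"
    using multiplier_action[OF H\<^sub>1 W] by metis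
  interpret dual: Group.comm_group "modular_dual G \<Delta>"
    by (rule comm_group_modular_dual)
  interpret U: unitary_action H "modular_dual G \<Delta>" U
    by unfold_locales (rule U)
  have inj: "x = y" if "W x = W y" "x \<in> carrier H" "y \<in> carrier H" for x y
    using that unitaries_bij[OF W] by (auto simp: bij_betw_def inj_on_def)
  have Wx: "W x \<in> carrier (l2_space D H\<^sub>1)" if "x \<in> carrier H" for x
    using unitaries_closed[OF W that] .
  have Wx_closed: "W x \<delta> \<in> carrier H\<^sub>1" if "x \<in> carrier H" "\<delta> \<in> D" for x \<delta>
    using Wx[OF that(1)] that(2) by (auto simp: l2_space_def)
  have commute: "U \<gamma> (\<pi> s y) = \<gamma> (\<Delta> s) \<odot> \<pi> s (U \<gamma> y)"
    if \<gamma>: "\<gamma> \<in> carrier (modular_dual G \<Delta>)" and s: "s \<in> carrier G" and y: "y \<in> carrier H" for \<gamma> s y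
  proof (rule inj)
    have closed: "\<pi> s y \<in> carrier H" "U \<gamma> y \<in> carrier H" "\<pi> s (U \<gamma> y) \<in> carrier H"
      using \<gamma> s y by simp_all
    have W\<pi>: "W (\<pi> s z) \<delta> = \<pi>\<^sub>1 (inv\<^bsub>G\<^esub> (\<sigma> \<delta>) \<otimes>\<^bsub>G\<^esub> s \<otimes>\<^bsub>G\<^esub> \<sigma> (inverse (\<Delta> s) * \<delta>)) (W z (inverse (\<Delta> s) * \<delta>))"
      if "z \<in> carrier H" "\<delta> \<in> D" for z \<delta>
      using inter s that Wx[OF that(1)] by (simp add: induced_rep_def)
    show "W (U \<gamma> (\<pi> s y)) = W (\<gamma> (\<Delta> s) \<odot> \<pi> s (U \<gamma> y))"
    proof (rule extensionalityI)
      show "W (U \<gamma> (\<pi> s y)) \<in> extensional D" "W (\<gamma> (\<Delta> s) \<odot> \<pi> s (U \<gamma> y)) \<in> extensional D"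
        using Wx[of "U \<gamma> (\<pi> s y)"] Wx[of "\<gamma> (\<Delta> s) \<odot> \<pi> s (U \<gamma> y)"] \<gamma> closed
        by (auto simp: l2_space_def PiE_def)
      fix \<delta> assume \<delta>: "\<delta> \<in> D"
      define \<delta>' where "\<delta>' = inverse (\<Delta> s) * \<delta>"
      have \<delta>': "\<delta>' \<in> D"
        using shift_D[OF s \<delta>] by (simp add: \<delta>'_def)
      define A where "A = \<pi>\<^sub>1 (inv\<^bsub>G\<^esub> (\<sigma> \<delta>) \<otimes>\<^bsub>G\<^esub> s \<otimes>\<^bsub>G\<^esub> \<sigma> \<delta>')"
      have A: "A \<in> unitaries H\<^sub>1 H\<^sub>1"
        using \<pi>\<^sub>1[OF cocycle_in_N[OF s \<delta>]] by (simp add: A_def \<delta>'_def)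
      have v: "W y \<delta>' \<in> carrier H\<^sub>1"
        using Wx_closed[OF y \<delta>'] .
      have "W (\<gamma> (\<Delta> s) \<odot> \<pi> s (U \<gamma> y)) \<delta> = \<gamma> (\<Delta> s) \<odot>\<^bsub>H\<^sub>1\<^esub> W (\<pi> s (U \<gamma> y)) \<delta>"
        using closed \<delta> by (simp add: unitaries_smult[OF W]) (simp add: l2_space_def)
      also have "W (\<pi> s (U \<gamma> y)) \<delta> = A (\<gamma> \<delta>' \<odot>\<^bsub>H\<^sub>1\<^esub> W y \<delta>')"
        using W\<pi>[OF closed(2) \<delta>] \<delta>' WU[OF \<gamma> y]
        by (simp add: A_def \<delta>'_def[symmetric] multiplier_def)
      also have "\<gamma> (\<Delta> s) \<odot>\<^bsub>H\<^sub>1\<^esub> A (\<gamma> \<delta>' \<odot>\<^bsub>H\<^sub>1\<^esub> W y \<delta>') = (\<gamma> (\<Delta> s) * \<gamma> \<delta>') \<odot>\<^bsub>H\<^sub>1\<^esub> A (W y \<delta>')"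
        using v unitaries_closed[OF A v] by (simp add: unitaries_smult[OF A] H1.scale_scale)
      also have "\<gamma> (\<Delta> s) * \<gamma> \<delta>' = \<gamma> \<delta>"
        using modular_dual_mult[OF \<gamma> imageI[OF s] \<delta>'] shift_mult[OF s, of \<delta>] by (simp add: \<delta>'_def)
      also have "A (W y \<delta>') = W (\<pi> s y) \<delta>"
        using W\<pi>[OF y \<delta>] by (simp add: A_def \<delta>'_def)
      also have "\<gamma> \<delta> \<odot>\<^bsub>H\<^sub>1\<^esub> W (\<pi> s y) \<delta> = W (U \<gamma> (\<pi> s y)) \<delta>"
        using WU[OF \<gamma> closed(1)] \<delta> by (simp add: multiplier_def)
      finally show "W (U \<gamma> (\<pi> s y)) \<delta> = W (\<gamma> (\<Delta> s) \<odot> \<pi> s (U \<gamma> y)) \<delta>"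
        by simp
    qed
  qed (use \<gamma> s y in auto)
  have "implements_dual_action G \<Delta> H \<pi> U"
    unfolding implements_dual_action_def
  proof (intro ballI)
    fix \<gamma> s x assume *: "\<gamma> \<in> carrier (modular_dual G \<Delta>)" "s \<in> carrier G" "x \<in> carrier H"
    show "U \<gamma> (\<pi> s (adjoint_op H (U \<gamma>) x)) = \<gamma> (\<Delta> s) \<odot> \<pi> s x"
      using commute[OF *(1,2), of "U (inv\<^bsub>modular_dual G \<Delta>\<^esub> \<gamma>) x"] *
      by (simp add: U.adjoint_act U.act_act_inv)
  qed
  moreover have "unitary_representation (modular_dual G \<Delta>) (modular_dual_topology G \<Delta>) H U"
    unfolding unitary_representation_def
    using H U multiplier_action_continuous[OF H\<^sub>1 W U.act_closed WU] by blast
  ultimately show ?thesis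
    by blast
qed

end


section \<open>Induced representations from dual actions\<close>

context dual_action
begin

lemma eigenspace_submodule: "a \<in> carrier A \<Longrightarrow> submodule (eigenspace a) complex_ring H"
proof (rule submoduleI)
  show "eigenspace a \<subseteq> carrier H"
    by (auto simp: eigenspace_def)
  show smult: "c \<odot> x \<in> eigenspace a" if "x \<in> eigenspace a" for c x
    using that by (simp add: eigenspace_def act_smult scale_scale mult.commute)
  show "\<ominus> x \<in> eigenspace a" if "x \<in> eigenspace a" for x
    using smult[OF that] uminus_eq_scale[OF eigenspace_closed[OF that]] by simp
  show "x \<oplus> y \<in> eigenspace a" if "x \<in> eigenspace a" "y \<in> eigenspace a" for x y
    using that by (simp add: eigenspace_def act_add smult_r_distr)
  have "0 \<odot> \<zero> = \<zero>"
    by (intro vector_eqI) (auto simp: inner_simps)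
  moreover have "U \<gamma> (0 \<odot> \<zero>) = \<gamma> a \<odot> \<zero>" if "\<gamma> \<in> \<Gamma>" for \<gamma>
    using that by (subst act_smult) (auto intro!: vector_eqI simp: inner_simps)
  ultimately show "\<zero> \<in> eigenspace a"
    by (simp add: eigenspace_def)
qed

text \<open>Taking inner products with a fixed vector is continuous, and \<open>U\<^sub>\<gamma>\<close> can be moved to that
  vector, so the eigenvalue equation passes to the limit.\<close>

lemma eigenspace_limit:
  assumes s: "range s \<subseteq> eigenspace a" and l: "l \<in> carrier H"
    and lim: "(\<lambda>n. hnorm H (s n \<ominus> l)) \<longlonglongrightarrow> 0"
  shows "l \<in> eigenspace a"
proof -
  have sn: "s n \<in> carrier H" "\<gamma> \<in> \<Gamma> \<Longrightarrow> U \<gamma> (s n) = \<gamma> a \<odot> s n" for n \<gamma>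
    using s by (auto simp: eigenspace_def subset_iff)
  have "U \<gamma> l = \<gamma> a \<odot> l" if \<gamma>: "\<gamma> \<in> \<Gamma>" for \<gamma>
  proof (rule vector_eqI)
    fix z assume z: "z \<in> carrier H"
    have "(\<lambda>n. cinner H (s n) (U (inv\<^bsub>discrete_dual A\<^esub> \<gamma>) z)) \<longlonglongrightarrow> cinner H l (U (inv\<^bsub>discrete_dual A\<^esub> \<gamma>) z)"
      using sn l z \<gamma> lim by (intro inner_tendsto) auto
    moreover have "cinner H (s n) (U (inv\<^bsub>discrete_dual A\<^esub> \<gamma>) z) = \<gamma> a * cinner H (s n) z" for n
      using act_inner_adjoint[OF \<gamma> sn(1) z] sn z \<gamma> by (simp add: inner_simps)
    moreover have "(\<lambda>n. \<gamma> a * cinner H (s n) z) \<longlonglongrightarrow> \<gamma> a * cinner H l z"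
      using sn l z lim by (intro tendsto_intros inner_tendsto) auto
    ultimately have "cinner H l (U (inv\<^bsub>discrete_dual A\<^esub> \<gamma>) z) = \<gamma> a * cinner H l z"
      using LIMSEQ_unique by simp
    then show "cinner H (U \<gamma> l) z = cinner H (\<gamma> a \<odot> l) z"
      using \<gamma> l z by (simp add: act_inner_adjoint inner_simps)
  qed (use \<gamma> l in auto)
  with l show ?thesis
    by (simp add: eigenspace_def)
qed

lemma eigenspace_hilbert: "a \<in> carrier A \<Longrightarrow> complex_hilbert_space (H\<lparr>carrier := eigenspace a\<rparr>)"
  by (intro complex_hilbert_subspace eigenspace_submodule complete eigenspace_limit)

end

locale modular_dual_rep = modular_rep G \<Delta> \<sigma> H \<pi> +
    dual: dual_action "modular_image_group G \<Delta>" H U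
  for G :: "('g, 'b) monoid_scheme" and \<Delta> \<sigma>
    and H :: "('v, 'm) hilbert_scheme" (structure) and \<pi> U +
  assumes commutation: "\<lbrakk>\<gamma> \<in> carrier (modular_dual G \<Delta>); s \<in> carrier G; x \<in> carrier H\<rbrakk>
    \<Longrightarrow> U \<gamma> (\<pi> s x) = \<gamma> (\<Delta> s) \<odot> \<pi> s (U \<gamma> x)"
begin

text \<open>The key to the converse: the commutation relation says that \<open>\<pi>(s)\<close> shifts the grading by
  eigenspaces.\<close>

lemma act_eigenspace:
  assumes s: "s \<in> carrier G" and \<delta>: "\<delta> \<in> D" and x: "x \<in> dual.eigenspace \<delta>"
  shows "\<pi> s x \<in> dual.eigenspace (\<Delta> s * \<delta>)"
proof -
  have "x \<in> carrier H"
    using x by (rule dual.eigenspace_closed)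
  with x s \<delta> modular_dual_mult[OF _ imageI[OF s] \<delta>] show ?thesis
    by (simp add: dual.eigenspace_def commutation act_smult scale_scale)
qed

abbreviation P :: "real \<Rightarrow> 'v \<Rightarrow> 'v" where
  "P \<equiv> dual.spectral.proj"

lemma P_in: "\<delta> \<in> D \<Longrightarrow> x \<in> carrier H \<Longrightarrow> P \<delta> x \<in> dual.eigenspace \<delta>"
  using dual.spectral.proj_in by simp

lemma P_closed [simp]: "\<delta> \<in> D \<Longrightarrow> x \<in> carrier H \<Longrightarrow> P \<delta> x \<in> carrier H"
  using dual.spectral.proj_closed by simp

lemma P_eqI:
  assumes "\<delta> \<in> D" "x \<in> carrier H" "y \<in> dual.eigenspace \<delta>"
    "\<And>z. z \<in> dual.eigenspace \<delta> \<Longrightarrow> cinner H x z = cinner H y z"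
  shows "P \<delta> x = y"
  using assms by (intro dual.spectral.proj_eqI) auto

lemma inner_P: "\<lbrakk>\<delta> \<in> D; x \<in> carrier H; z \<in> dual.eigenspace \<delta>\<rbrakk> \<Longrightarrow> cinner H x z = cinner H (P \<delta> x) z"
  by (rule dual.spectral.inner_proj) auto

lemma P_add:
  assumes "\<delta> \<in> D" "x \<in> carrier H" "y \<in> carrier H"
  shows "P \<delta> (x \<oplus> y) = P \<delta> x \<oplus> P \<delta> y"
proof (rule P_eqI)
  show "P \<delta> x \<oplus> P \<delta> y \<in> dual.eigenspace \<delta>"
    using submoduleE(5)[OF dual.eigenspace_submodule] P_in assms by simp
  show "cinner H (x \<oplus> y) z = cinner H (P \<delta> x \<oplus> P \<delta> y) z" if "z \<in> dual.eigenspace \<delta>" for z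
    using assms dual.eigenspace_closed[OF that] inner_P[OF assms(1,2) that]
      inner_P[OF assms(1,3) that]
    by (simp add: inner_add_left)
qed (use assms in auto)

lemma P_scale:
  assumes "\<delta> \<in> D" "x \<in> carrier H"
  shows "P \<delta> (c \<odot> x) = c \<odot> P \<delta> x"
proof (rule P_eqI)
  show "c \<odot> P \<delta> x \<in> dual.eigenspace \<delta>"
    using assms by (intro submoduleE(4)[OF dual.eigenspace_submodule] P_in) auto
  show "cinner H (c \<odot> x) z = cinner H (c \<odot> P \<delta> x) z" if "z \<in> dual.eigenspace \<delta>" for z
    using assms dual.eigenspace_closed[OF that] inner_P[OF assms that]
    by (simp add: inner_smult_left)
qed (use assms in auto)

lemma P_act:
  assumes s: "s \<in> carrier G" and \<delta>: "\<delta> \<in> D" and x: "x \<in> carrier H"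
  shows "P \<delta> (\<pi> s x) = \<pi> s (P (inverse (\<Delta> s) * \<delta>) x)"
proof (rule P_eqI)
  define \<delta>' where "\<delta>' = inverse (\<Delta> s) * \<delta>"
  have \<delta>': "\<delta>' \<in> D"
    using shift_D[OF s \<delta>] by (simp add: \<delta>'_def)
  show "\<pi> s (P (inverse (\<Delta> s) * \<delta>) x) \<in> dual.eigenspace \<delta>"
    using act_eigenspace[OF s \<delta>' P_in[OF \<delta>' x]] shift_mult[OF s, of \<delta>] by (simp add: \<delta>'_def)
  fix z assume z: "z \<in> dual.eigenspace \<delta>"
  have z': "\<pi> (inv\<^bsub>G\<^esub> s) z \<in> dual.eigenspace \<delta>'"
    using act_eigenspace[OF inv_closed[OF s] \<delta> z] by (simp add: \<delta>'_def \<Delta>_inv[OF s])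
  have "cinner H (\<pi> s x) z = cinner H (\<pi> s (P \<delta>' x)) z"
    using inner_P[OF \<delta>' x z'] s x dual.eigenspace_closed[OF z] P_closed[OF \<delta>' x]
    by (simp add: act_inner_adjoint)
  then show "cinner H (\<pi> s x) z = cinner H (\<pi> s (P (inverse (\<Delta> s) * \<delta>) x)) z"
    by (simp add: \<delta>'_def)
qed (use s \<delta> x in auto)

definition H\<^sub>1 :: "('v, 'm) hilbert_scheme" where
  "H\<^sub>1 = H\<lparr>carrier := dual.eigenspace 1\<rparr>"

definition \<pi>\<^sub>1 :: "'g \<Rightarrow> 'v \<Rightarrow> 'v" where
  "\<pi>\<^sub>1 k = restrict (\<pi> k) (dual.eigenspace 1)"

lemma H\<^sub>1_simps [simp]: "carrier H\<^sub>1 = dual.eigenspace 1" "cinner H\<^sub>1 = cinner H"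
  "add H\<^sub>1 = add H" "smult H\<^sub>1 = smult H" "hnorm H\<^sub>1 = hnorm H"
  by (simp_all add: H\<^sub>1_def hnorm_def fun_eq_iff)

lemma complex_hilbert_space_H\<^sub>1: "complex_hilbert_space H\<^sub>1"
  unfolding H\<^sub>1_def using one_D by (intro dual.eigenspace_hilbert) simp

lemma act_kernel:
  assumes "k \<in> N" "x \<in> dual.eigenspace 1"
  shows "\<pi> k x \<in> dual.eigenspace 1"
  using act_eigenspace[OF _ one_D assms(2), of k] assms(1) by (simp add: N_iff)

lemma kernel_representation:
  assumes top: "topspace T = carrier G"
    and cont: "\<And>x. x \<in> carrier H \<Longrightarrow> continuous_map T (norm_topology H) (\<lambda>s. \<pi> s x)"
  shows "unitary_representation (G\<lparr>carrier := N\<rparr>) (subtopology T N) H\<^sub>1 \<pi>\<^sub>1"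
proof -
  interpret H1: complex_inner_space H\<^sub>1
    using complex_hilbert_space_H\<^sub>1 by (simp add: complex_hilbert_space_iff)
  have N_mult: "k \<otimes>\<^bsub>G\<^esub> l \<in> N" if "k \<in> N" "l \<in> N" for k l
    using that by (simp add: N_iff \<Delta>_mult)
  have N_inv: "inv\<^bsub>G\<^esub> k \<in> N" if "k \<in> N" for k
    using that by (simp add: N_iff \<Delta>_inv)
  have "\<pi>\<^sub>1 \<in> hom (G\<lparr>carrier := N\<rparr>) (unitary_group H\<^sub>1)"
  proof (rule hom_unitary_groupI)
    fix k assume "k \<in> carrier (G\<lparr>carrier := N\<rparr>)"
    then have k: "k \<in> N" "k \<in> carrier G"
      by (auto simp: N_iff)
    show "\<pi>\<^sub>1 k \<in> unitaries H\<^sub>1 H\<^sub>1"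
    proof (rule H1.unitariesI)
      show "\<pi>\<^sub>1 k \<in> carrier H\<^sub>1 \<rightarrow>\<^sub>E carrier H\<^sub>1"
        using act_kernel[OF k(1)] by (auto simp: \<pi>\<^sub>1_def)
      show "\<exists>x\<in>carrier H\<^sub>1. \<pi>\<^sub>1 k x = y" if "y \<in> carrier H\<^sub>1" for y
        using act_kernel[OF N_inv[OF k(1)], of y] that dual.eigenspace_closed[of y] k(2)
        by (intro bexI[of _ "\<pi> (inv\<^bsub>G\<^esub> k) y"]) (simp_all add: \<pi>\<^sub>1_def act_act_inv)
      show "\<pi>\<^sub>1 k (x \<oplus>\<^bsub>H\<^sub>1\<^esub> y) = \<pi>\<^sub>1 k x \<oplus>\<^bsub>H\<^sub>1\<^esub> \<pi>\<^sub>1 k y" if "x \<in> carrier H\<^sub>1" "y \<in> carrier H\<^sub>1" for x y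
        using that H1.M.a_closed[of x y] k(2) dual.eigenspace_closed[of x] dual.eigenspace_closed[of y]
        by (simp add: \<pi>\<^sub>1_def act_add)
      show "\<pi>\<^sub>1 k (c \<odot>\<^bsub>H\<^sub>1\<^esub> x) = c \<odot>\<^bsub>H\<^sub>1\<^esub> \<pi>\<^sub>1 k x" if "x \<in> carrier H\<^sub>1" for c x
        using that H1.scale_closed[of x c] k(2) dual.eigenspace_closed[of x]
        by (simp add: \<pi>\<^sub>1_def act_smult)
      show "cinner H\<^sub>1 (\<pi>\<^sub>1 k x) (\<pi>\<^sub>1 k y) = cinner H\<^sub>1 x y" if "x \<in> carrier H\<^sub>1" "y \<in> carrier H\<^sub>1" for x y
        using that k(2) dual.eigenspace_closed[of x] dual.eigenspace_closed[of y]
        by (simp add: \<pi>\<^sub>1_def act_inner)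
    qed
  next
    fix k l x assume "k \<in> carrier (G\<lparr>carrier := N\<rparr>)" "l \<in> carrier (G\<lparr>carrier := N\<rparr>)"
      "x \<in> carrier H\<^sub>1"
    then have *: "k \<in> carrier G" "l \<in> carrier G" "k \<in> N" "l \<in> N" "x \<in> dual.eigenspace 1" "x \<in> carrier H"
      using dual.eigenspace_closed by (auto simp: N_iff)
    then show "\<pi>\<^sub>1 (k \<otimes>\<^bsub>G\<lparr>carrier := N\<rparr>\<^esub> l) x = \<pi>\<^sub>1 k (\<pi>\<^sub>1 l x)"
      using act_kernel[OF *(4,5)] by (simp add: \<pi>\<^sub>1_def act_mult)
  qed (use N_mult in simp)
  moreover have "continuous_map (subtopology T N) (norm_topology H\<^sub>1) (\<lambda>k. \<pi>\<^sub>1 k x)"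
    if "x \<in> carrier H\<^sub>1" for x
    unfolding H1.continuous_map_norm_topology_iff
  proof (intro conjI ballI allI impI)
    have x: "x \<in> dual.eigenspace 1" "x \<in> carrier H"
      using that dual.eigenspace_closed by auto
    show "(\<lambda>k. \<pi>\<^sub>1 k x) \<in> topspace (subtopology T N) \<rightarrow> carrier H\<^sub>1"
      using x act_kernel by (auto simp: \<pi>\<^sub>1_def)
    fix k and e :: real assume k: "k \<in> topspace (subtopology T N)" and e: "e > 0"
    then have k: "k \<in> N" "k \<in> topspace T"
      by auto
    obtain B where B: "openin T B" "k \<in> B" "\<forall>l\<in>B. hnorm H (\<pi> l x \<ominus> \<pi> k x) < e"
      using cont[OF x(2)] k(2) e unfolding continuous_map_norm_topology_iff by meson
    show "\<exists>B. openin (subtopology T N) B \<and> k \<in> B \<and>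
        (\<forall>l\<in>B. hnorm H\<^sub>1 (\<pi>\<^sub>1 l x \<ominus>\<^bsub>H\<^sub>1\<^esub> \<pi>\<^sub>1 k x) < e)"
    proof (intro exI[of _ "B \<inter> N"] conjI ballI)
      show "openin (subtopology T N) (B \<inter> N)"
        using B(1) by (auto simp: openin_subtopology)
      show "k \<in> B \<inter> N"
        using B(2) k by simp
      fix l assume l: "l \<in> B \<inter> N"
      have "hnorm H\<^sub>1 (\<pi> l x \<ominus>\<^bsub>H\<^sub>1\<^esub> \<pi> k x) = hnorm H (\<pi> l x \<ominus> \<pi> k x)"
        unfolding H\<^sub>1_def
        by (rule hnorm_minus_subspace[OF dual.eigenspace_submodule])
          (use one_D act_kernel x(1) k(1) l in auto)
      then show "hnorm H\<^sub>1 (\<pi>\<^sub>1 l x \<ominus>\<^bsub>H\<^sub>1\<^esub> \<pi>\<^sub>1 k x) < e"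
        using B(3) l x(1) by (simp add: \<pi>\<^sub>1_def)
    qed
  qed
  ultimately show ?thesis
    by (simp add: unitary_representation_def complex_hilbert_space_H\<^sub>1)
qed

text \<open>The component of \<open>x\<close> in each eigenspace is moved into the eigenspace of 1 by means of the
  section.\<close>

definition fibre_map :: "'v \<Rightarrow> real \<Rightarrow> 'v" where
  "fibre_map = (\<lambda>x\<in>carrier H. \<lambda>\<delta>\<in>D. \<pi> (inv\<^bsub>G\<^esub> (\<sigma> \<delta>)) (P \<delta> x))"

lemma to_fibre:
  assumes \<delta>: "\<delta> \<in> D" and x: "x \<in> dual.eigenspace \<delta>"
  shows "\<pi> (inv\<^bsub>G\<^esub> (\<sigma> \<delta>)) x \<in> dual.eigenspace 1"
  using act_eigenspace[OF _ \<delta> x, of "inv\<^bsub>G\<^esub> (\<sigma> \<delta>)"] \<delta> D_pos[OF \<delta>]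
  by (simp add: \<Delta>_inv \<Delta>_section)

lemma from_fibre:
  assumes \<delta>: "\<delta> \<in> D" and x: "x \<in> dual.eigenspace 1"
  shows "\<pi> (\<sigma> \<delta>) x \<in> dual.eigenspace \<delta>"
  using act_eigenspace[OF section_closed[OF \<delta>] one_D x] \<delta> by (simp add: \<Delta>_section)

text \<open>The map preserves inner products by \<open>Parseval\<close> and is onto by \<open>synthesis\<close>.\<close>

theorem fibre_map_unitary: "fibre_map \<in> unitaries H (l2_space D H\<^sub>1)"
proof (rule unitariesI)
  have inner: "cinner H (fibre_map x \<delta>) (fibre_map y \<delta>) = cinner H (P \<delta> x) (P \<delta> y)"
    if "x \<in> carrier H" "y \<in> carrier H" "\<delta> \<in> D" for x y \<delta>
    using that by (simp add: fibre_map_def act_inner)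
  show "fibre_map \<in> carrier H \<rightarrow>\<^sub>E carrier (l2_space D H\<^sub>1)"
  proof (rule PiE_I)
    fix x assume x: "x \<in> carrier H"
    have "((\<lambda>\<delta>. Re (cinner H (P \<delta> x) (P \<delta> x))) has_sum Re (cinner H x x)) D"
      using has_sum_Re[OF dual.spectral.Parseval[OF x x]] by simp
    then have "(\<lambda>\<delta>. Re (cinner H (P \<delta> x) (P \<delta> x))) summable_on D"
      by (rule has_sum_imp_summable)
    then have "(\<lambda>\<delta>. (hnorm H (fibre_map x \<delta>))\<^sup>2) summable_on D"
      by (rule iffD1[OF summable_on_cong, rotated])
        (use x in \<open>simp add: hnorm_sq[symmetric] fibre_map_def act_hnorm\<close>)
    then show "fibre_map x \<in> carrier (l2_space D H\<^sub>1)"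
      using x to_fibre P_in by (auto simp: l2_space_def fibre_map_def)
  qed (simp add: fibre_map_def)
  show "cinner (l2_space D H\<^sub>1) (fibre_map x) (fibre_map y) = cinner H x y" if "x \<in> carrier H" "y \<in> carrier H" for x y
  proof -
    have "cinner (l2_space D H\<^sub>1) (fibre_map x) (fibre_map y) = (\<Sum>\<^sub>\<infinity>\<delta>\<in>D. cinner H (P \<delta> x) (P \<delta> y))"
      using inner that by (auto simp: l2_space_def intro!: infsum_cong)
    also have "\<dots> = cinner H x y"
      using infsumI[OF dual.spectral.Parseval[OF that]] by simp
    finally show ?thesis .
  qed
  show "fibre_map (x \<oplus> y) = fibre_map x \<oplus>\<^bsub>l2_space D H\<^sub>1\<^esub> fibre_map y" if "x \<in> carrier H" "y \<in> carrier H" for x y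
    using that by (auto simp: fibre_map_def l2_space_def P_add act_add intro!: restrict_ext)
  show "fibre_map (c \<odot> x) = c \<odot>\<^bsub>l2_space D H\<^sub>1\<^esub> fibre_map x" if "x \<in> carrier H" for c x
    using that by (auto simp: fibre_map_def l2_space_def P_scale act_smult intro!: restrict_ext)
  fix f assume f: "f \<in> carrier (l2_space D H\<^sub>1)"
  then have f_in: "f \<delta> \<in> dual.eigenspace 1" if "\<delta> \<in> D" for \<delta>
    using that by (auto simp: l2_space_def)
  have "(\<lambda>\<delta>. (hnorm H (\<pi> (\<sigma> \<delta>) (f \<delta>)))\<^sup>2) summable_on D \<longleftrightarrow> (\<lambda>\<delta>. (hnorm H (f \<delta>))\<^sup>2) summable_on D"
    by (rule summable_on_cong) (use dual.eigenspace_closed[OF f_in] in \<open>simp add: act_hnorm\<close>)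
  with f have summable: "(\<lambda>\<delta>. (hnorm H (\<pi> (\<sigma> \<delta>) (f \<delta>)))\<^sup>2) summable_on carrier (modular_image_group G \<Delta>)"
    by (simp add: l2_space_def)
  have fibre: "\<pi> (\<sigma> \<delta>) (f \<delta>) \<in> dual.eigenspace \<delta>" if "\<delta> \<in> carrier (modular_image_group G \<Delta>)" for \<delta>
    using that f_in from_fibre by simp
  obtain x where x: "x \<in> carrier H" "\<forall>\<delta>\<in>D. P \<delta> x = \<pi> (\<sigma> \<delta>) (f \<delta>)"
  proof (rule dual.spectral.synthesis[OF fibre summable])
    fix y assume "y \<in> carrier H"
      and "\<And>\<delta>. \<delta> \<in> carrier (modular_image_group G \<Delta>) \<Longrightarrow> P \<delta> y = \<pi> (\<sigma> \<delta>) (f \<delta>)"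
    then show thesis
      by (intro that) auto
  qed
  have "fibre_map x = f"
  proof (rule extensionalityI)
    show "f \<in> extensional D" "fibre_map x \<in> extensional D"
      using f x(1) by (auto simp: l2_space_def fibre_map_def PiE_def)
    show "fibre_map x \<delta> = f \<delta>" if "\<delta> \<in> D" for \<delta>
      using x(1) bspec[OF x(2) that] that dual.eigenspace_closed[OF f_in[OF that]]
      by (simp add: fibre_map_def act_inv_act)
  qed
  with x(1) show "\<exists>x\<in>carrier H. fibre_map x = f"
    by blast
qed

text \<open>With \<open>\<delta>' = \<Delta>(s)\<^sup>-\<^sup>1 \<delta>\<close>, the operator \<open>\<pi>(\<sigma>(\<delta>)\<^sup>-\<^sup>1 s \<sigma>(\<delta>'))\<close> in the induced representation undoes
  the \<open>\<pi>(\<sigma>(\<delta>'))\<^sup>-\<^sup>1\<close> in the map. What remains is \<open>\<pi>(\<sigma>(\<delta>))\<^sup>-\<^sup>1 \<pi>(s)\<close> on the component of \<open>x\<close> at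
  \<open>\<delta>'\<close>, and \<open>\<pi>(s)\<close> takes that component to the component of \<open>\<pi>(s) x\<close> at \<open>\<delta>\<close>.\<close>

theorem fibre_map_intertwines:
  assumes s: "s \<in> carrier G" and x: "x \<in> carrier H"
  shows "fibre_map (\<pi> s x) = induced_rep G \<Delta> \<sigma> H\<^sub>1 \<pi>\<^sub>1 s (fibre_map x)"
proof (rule extensionalityI)
  have fx: "fibre_map x \<in> carrier (l2_space D H\<^sub>1)"
    by (rule unitaries_closed[OF fibre_map_unitary x])
  show "fibre_map (\<pi> s x) \<in> extensional D"
    using s x by (simp add: fibre_map_def)
  show "induced_rep G \<Delta> \<sigma> H\<^sub>1 \<pi>\<^sub>1 s (fibre_map x) \<in> extensional D"
    using fx by (simp add: induced_rep_def)
  fix \<delta> assume \<delta>: "\<delta> \<in> D"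
  define \<delta>' where "\<delta>' = inverse (\<Delta> s) * \<delta>"
  have \<delta>': "\<delta>' \<in> D"
    using shift_D[OF s \<delta>] by (simp add: \<delta>'_def)
  define p where "p = P \<delta>' x"
  have p: "p \<in> carrier H" "\<pi> (inv\<^bsub>G\<^esub> (\<sigma> \<delta>')) p \<in> dual.eigenspace 1"
    using \<delta>' x to_fibre[OF \<delta>' P_in] by (simp_all add: p_def)
  have "induced_rep G \<Delta> \<sigma> H\<^sub>1 \<pi>\<^sub>1 s (fibre_map x) \<delta>
      = \<pi>\<^sub>1 (inv\<^bsub>G\<^esub> (\<sigma> \<delta>) \<otimes>\<^bsub>G\<^esub> s \<otimes>\<^bsub>G\<^esub> \<sigma> \<delta>') (\<pi> (inv\<^bsub>G\<^esub> (\<sigma> \<delta>')) p)"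
    using fx \<delta> \<delta>' x by (simp add: induced_rep_def \<delta>'_def[symmetric]) (simp add: fibre_map_def p_def)
  also have "\<dots> = \<pi> (inv\<^bsub>G\<^esub> (\<sigma> \<delta>) \<otimes>\<^bsub>G\<^esub> s \<otimes>\<^bsub>G\<^esub> \<sigma> \<delta>') (\<pi> (inv\<^bsub>G\<^esub> (\<sigma> \<delta>')) p)"
    using p(2) by (simp add: \<pi>\<^sub>1_def)
  also have "\<dots> = \<pi> (inv\<^bsub>G\<^esub> (\<sigma> \<delta>)) (\<pi> s p)"
    using s \<delta> \<delta>' p(1) by (simp add: act_mult act_act_inv)
  also have "\<pi> s p = P \<delta> (\<pi> s x)"
    using P_act[OF s \<delta> x] by (simp add: p_def \<delta>'_def)
  also have "\<pi> (inv\<^bsub>G\<^esub> (\<sigma> \<delta>)) (P \<delta> (\<pi> s x)) = fibre_map (\<pi> s x) \<delta>"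
    using s \<delta> x by (simp add: fibre_map_def)
  finally show "fibre_map (\<pi> s x) \<delta> = induced_rep G \<Delta> \<sigma> H\<^sub>1 \<pi>\<^sub>1 s (fibre_map x) \<delta>"
    by (rule sym)
qed

theorem induced_if_dual_action:
  assumes "topspace T = carrier G"
    and "\<And>x. x \<in> carrier H \<Longrightarrow> continuous_map T (norm_topology H) (\<lambda>s. \<pi> s x)"
  shows "induced_from_modular_kernel G T \<Delta> \<sigma> H \<pi> H\<^sub>1 \<pi>\<^sub>1"
  unfolding induced_from_modular_kernel_def unitarily_equivalent_def
  using kernel_representation[OF assms] fibre_map_unitary fibre_map_intertwines by blast

end


section \<open>The characterization\<close>

(* "Some Hilbert space" in (i) means one over an arbitrary type. HOL cannot quantify over types
   inside a formula, so the first conjunct is (i) <--> (ii) with the Hilbert space found among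
   those over the type 'h of the given one, and the second is (i) --> (ii) for a Hilbert space
   over any other type 'k. *)
theorem theorem4p1:
  fixes G :: "('g, 'b) monoid_scheme" and T :: "'g topology" and \<mu> :: "'g measure"
    and \<Delta> :: "'g \<Rightarrow> real" and \<sigma> :: "real \<Rightarrow> 'g"
    and H :: "'h hilbert" and \<pi> :: "'g \<Rightarrow> 'h \<Rightarrow> 'h"
  assumes "locally_compact_group G T"
    and "left_haar_measure G T \<mu>"
    and "modular_function G \<mu> \<Delta>"
    and "almost_unimodular G T \<Delta>"
    and "normalized_section G \<Delta> \<sigma>"
    and "unitary_representation G T H \<pi>"
  shows "((\<exists>(H\<^sub>1 :: 'h hilbert) \<pi>\<^sub>1. induced_from_modular_kernel G T \<Delta> \<sigma> H \<pi> H\<^sub>1 \<pi>\<^sub>1) \<longleftrightarrow>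
          (\<exists>U. unitary_representation (modular_dual G \<Delta>) (modular_dual_topology G \<Delta>) H U \<and>
               implements_dual_action G \<Delta> H \<pi> U)) \<and>
         ((\<exists>(H\<^sub>1 :: 'k hilbert) \<pi>\<^sub>1. induced_from_modular_kernel G T \<Delta> \<sigma> H \<pi> H\<^sub>1 \<pi>\<^sub>1) \<longrightarrow>
          (\<exists>U. unitary_representation (modular_dual G \<Delta>) (modular_dual_topology G \<Delta>) H U \<and>
               implements_dual_action G \<Delta> H \<pi> U))"
proof -
  interpret G: locally_compact_group G T by fact
  have H: "complex_hilbert_space H" and hom: "\<pi> \<in> hom G (unitary_group H)"
    and cont: "\<And>x. x \<in> carrier H \<Longrightarrow> continuous_map T (norm_topology H) (\<lambda>s. \<pi> s x)"
    using assms(6) by (simp_all add: unitary_representation_def)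
  interpret H: complex_inner_space H
    using H by (simp add: complex_hilbert_space_iff)
  have complete: "Metric_space.mcomplete (carrier H) (hdist H)"
    using H by (simp add: complex_hilbert_space_iff)
  interpret modular_rep G \<Delta> \<sigma> H \<pi>
  proof unfold_locales
    show "\<Delta> (s \<otimes>\<^bsub>G\<^esub> t) = \<Delta> s * \<Delta> t" if "s \<in> carrier G" "t \<in> carrier G" for s t
      using G.modular_function_mult[OF assms(2,3) that] .
    show "\<Delta> s > 0" if "s \<in> carrier G" for s
      using assms(3) that by (simp add: modular_function_def)
  qed (rule assms(5) hom)+
  have induced_if_dual: "\<exists>(H\<^sub>1 :: 'h hilbert) \<pi>\<^sub>1. induced_from_modular_kernel G T \<Delta> \<sigma> H \<pi> H\<^sub>1 \<pi>\<^sub>1"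
    if U: "unitary_representation (modular_dual G \<Delta>) (modular_dual_topology G \<Delta>) H U"
      and implements: "implements_dual_action G \<Delta> H \<pi> U" for U
  proof -
    interpret image: Group.comm_group "modular_image_group G \<Delta>"
      by (rule comm_group_image)
    interpret dual: Group.comm_group "modular_dual G \<Delta>"
      by (rule comm_group_modular_dual)
    have hom_U: "U \<in> hom (modular_dual G \<Delta>) (unitary_group H)"
      using U by (simp add: unitary_representation_def)
    interpret U: unitary_action H "modular_dual G \<Delta>" U
      by unfold_locales (rule hom_U)
    have commutation: "U \<gamma> (\<pi> s x) = \<gamma> (\<Delta> s) \<odot>\<^bsub>H\<^esub> \<pi> s (U \<gamma> x)"
      if "\<gamma> \<in> carrier (modular_dual G \<Delta>)" "s \<in> carrier G" "x \<in> carrier H" for \<gamma> s x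
    proof -
      have "U \<gamma> (\<pi> s (adjoint_op H (U \<gamma>) (U \<gamma> x))) = \<gamma> (\<Delta> s) \<odot>\<^bsub>H\<^esub> \<pi> s (U \<gamma> x)"
        using implements that U.act_closed by (simp add: implements_dual_action_def)
      then show ?thesis
        using that by (simp add: U.adjoint_act U.act_inv_act)
    qed
    interpret modular_dual_rep G \<Delta> \<sigma> H \<pi> U
    proof (intro modular_dual_rep.intro dual_action.intro)
      show "modular_rep G \<Delta> \<sigma> H \<pi>" "comm_group (modular_image_group G \<Delta>)"
        by unfold_locales
      show "unitary_action H (discrete_dual (modular_image_group G \<Delta>)) U"
        using U.unitary_action_axioms by simp
      show "dual_action_axioms (modular_image_group G \<Delta>) H U"
        using U complete modular_dual_separating
        by (intro dual_action_axioms.intro) (simp_all add: unitary_representation_def)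
      show "modular_dual_rep_axioms G \<Delta> H \<pi> U"
        using commutation by (rule modular_dual_rep_axioms.intro)
    qed
    have "induced_from_modular_kernel G T \<Delta> \<sigma> H \<pi> H\<^sub>1 \<pi>\<^sub>1"
      using G.topspace_eq cont by (rule induced_if_dual_action)
    then show ?thesis
      by blast
  qed
  show ?thesis
  proof (intro conjI iffI impI)
    assume "\<exists>(H\<^sub>1 :: 'h hilbert) \<pi>\<^sub>1. induced_from_modular_kernel G T \<Delta> \<sigma> H \<pi> H\<^sub>1 \<pi>\<^sub>1"
    then show "\<exists>U. unitary_representation (modular_dual G \<Delta>) (modular_dual_topology G \<Delta>) H U \<and>
        implements_dual_action G \<Delta> H \<pi> U"
      by (elim exE) (rule dual_action_if_induced[OF H])
  next
    assume "\<exists>U. unitary_representation (modular_dual G \<Delta>) (modular_dual_topology G \<Delta>) H U \<and>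
        implements_dual_action G \<Delta> H \<pi> U"
    then show "\<exists>(H\<^sub>1 :: 'h hilbert) \<pi>\<^sub>1. induced_from_modular_kernel G T \<Delta> \<sigma> H \<pi> H\<^sub>1 \<pi>\<^sub>1"
      by (elim exE conjE) (rule induced_if_dual)
  next
    assume "\<exists>(H\<^sub>1 :: 'k hilbert) \<pi>\<^sub>1. induced_from_modular_kernel G T \<Delta> \<sigma> H \<pi> H\<^sub>1 \<pi>\<^sub>1"
    then show "\<exists>U. unitary_representation (modular_dual G \<Delta>) (modular_dual_topology G \<Delta>) H U \<and>
        implements_dual_action G \<Delta> H \<pi> U"
      by (elim exE) (rule dual_action_if_induced[OF H])
  qed
qed

end
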